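(* Let $\Bbbk$ be a field and let $A$ be an affine Poisson domain over $\Bbbk$ whose Poisson center $\mathcal Z_P(A)$ is affine. Let $\mathcal P$ be a stable property of Poisson algebras. If the Poisson discriminant $d=d_{\mathcal P}(A)$ exists and is effective either in $A$ or in $\mathcal Z_P(A)$, then $A$ is Poisson cancellative.
   Context: A Poisson algebra over $\Bbbk$ is a commutative $\Bbbk$-algebra $A$ with a $\Bbbk$-bilinear bracket $\{\,,\}$ making $A$ a Lie algebra and such that $\{a,-\}$ is a $\Bbbk$-derivation for every $a\in A$. Affine means finitely generated as a $\Bbbk$-algebra; domain means integral domain. The Poisson center is $\mathcal Z_P(A)=\{z\in A:\{z,a\}=0\ \forall a\in A\}$. $A[t_1,\dots,t_n]=A\otimes\Bbbk[t_1,\dots,t_n]$ carries the bracket extending that of $A$ with all $t_i$ Poisson central; its Poisson center is $\mathcal Z_P(A)[t_1,\dots,t_n]$. $A$ is Poisson cancellative if for every Poisson algebra $B$ over $\Bbbk$, $A[t]\cong B[t]$ as Poisson algebras implies $A\cong B$ as Poisson algebras. Discriminant. A property $\mathcal P$ is a property of Poisson algebras invariant under isomorphism. Put $\mathcal Z=\mathcal Z_P(A)$, $L_{\mathcal P}(A)=\{\mathfrak m\in\mathrm{MaxSpec}(\mathcal Z): A/\mathfrak mA\text{ has property }\mathcal P\}$, $D_{\mathcal P}(A)=\mathrm{MaxSpec}(\mathcal Z)\setminus L_{\mathcal P}(A)$, and $I_{\mathcal P}(A)=\bigcap_{\mathfrak m\in D_{\mathcal P}(A)}\mathfrak m\subseteq\mathcal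 Z$. If $I_{\mathcal P}(A)$ is a principal ideal of $\mathcal Z$ generated by $d$, then $d=d_{\mathcal P}(A)$ is called the $\mathcal P$-discriminant (Poisson discriminant) of $A$ and is said to exist. $\mathcal P$ is stable if for every Poisson $\Bbbk$-algebra $C$ with affine Poisson center and every $n\ge1$, $I_{\mathcal P}(C\otimes\Bbbk[t_1,\dots,t_n])=I_{\mathcal P}(C)\otimes\Bbbk[t_1,\dots,t_n]$ as ideals of $\mathcal Z_P(C)\otimes\Bbbk[t_1,\dots,t_n]$. Effectiveness. Let $C$ be an affine commutative domain generated as an algebra by $Y=\bigoplus_{i=1}^n\Bbbk x_i$. An element $0\ne f\in C$ is effective in $C$ if: (1) there is an ascending exhaustive $\mathbb N$-filtration $F$ on $C$ (with $F_iC\cdot F_jC\subseteq F_{i+j}C$) such that $\mathrm{gr}_F(C)$ is a domain; let $\deg_C$ be the associated degree; and (2) for every $\mathbb N$-filtered commutative algebra $T$ with $\mathrm{gr}\,T$ a domain (with associated degree $\deg_T$) and every subset $\{y_1,\dots,y_n\}\subset T$ that (a) is linearly independent in $T/\Bbbk 1_T$ and (b) satisfies $\deg_T y_i\ge\deg_C x_i$ for all $i$ and $\deg_T y_{i_0}>\deg_C x_{i_0}$ for some $i_0$, there is a polynomial presentation $f=f(x_1,\dots,x_n)$ of $f$ such that either $f(y_1,\dots,y_n)=0$ or $\deg_T f(y_1,\dots,y_n)>\deg_C f$.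
   Formalization: In the definition of effective, the generators x_1,...,x_n are required to be linearly independent modulo the scalars k1; if Y may contain 1, every nonzero element is effective and the claim fails (P always true, d = 1, zero bracket on a non-cancellative affine domain). *)

theory Defs
  imports "HOL-Algebra.Algebra" "HOL-Library.Multiset"
begin

section \<open>Poisson algebras\<close>

record ('k, 'a) poisson_alg = "('k, 'a) module" +
  bracket :: "'a \<Rightarrow> 'a \<Rightarrow> 'a"

text \<open>The library locale \<^locale>\<open>algebra\<close> is that of commutative unital algebras; the zero
  algebra is allowed. Two-sided linearity and the Leibniz rule in the second argument make every
  \<open>{a, -}\<close> a \<open>K\<close>-derivation.\<close>

locale poisson_algebra = algebra K A
  for K :: "('k, 'm) ring_scheme" (structure) and A :: "('k, 'a, 'x) poisson_alg_scheme" (structure) +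
  assumes bracket_closed:
      "\<lbrakk>a \<in> carrier A; b \<in> carrier A\<rbrakk> \<Longrightarrow> bracket A a b \<in> carrier A"
    and bracket_add_left:
      "\<lbrakk>a \<in> carrier A; b \<in> carrier A; c \<in> carrier A\<rbrakk> \<Longrightarrow>
        bracket A (a \<oplus>\<^bsub>A\<^esub> b) c = bracket A a c \<oplus>\<^bsub>A\<^esub> bracket A b c"
    and bracket_add_right:
      "\<lbrakk>a \<in> carrier A; b \<in> carrier A; c \<in> carrier A\<rbrakk> \<Longrightarrow>
        bracket A a (b \<oplus>\<^bsub>A\<^esub> c) = bracket A a b \<oplus>\<^bsub>A\<^esub> bracket A a c"
    and bracket_smult_left:
      "\<lbrakk>r \<in> carrier K; a \<in> carrier A; b \<in> carrier A\<rbrakk> \<Longrightarrow>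
        bracket A (r \<odot>\<^bsub>A\<^esub> a) b = r \<odot>\<^bsub>A\<^esub> bracket A a b"
    and bracket_smult_right:
      "\<lbrakk>r \<in> carrier K; a \<in> carrier A; b \<in> carrier A\<rbrakk> \<Longrightarrow>
        bracket A a (r \<odot>\<^bsub>A\<^esub> b) = r \<odot>\<^bsub>A\<^esub> bracket A a b"
    and bracket_alternating:
      "a \<in> carrier A \<Longrightarrow> bracket A a a = \<zero>\<^bsub>A\<^esub>"
    and bracket_jacobi:
      "\<lbrakk>a \<in> carrier A; b \<in> carrier A; c \<in> carrier A\<rbrakk> \<Longrightarrow>
        bracket A a (bracket A b c) \<oplus>\<^bsub>A\<^esub> bracket A b (bracket A c a)
          \<oplus>\<^bsub>A\<^esub> bracket A c (bracket A a b) = \<zero>\<^bsub>A\<^esub>"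
    and bracket_leibniz:
      "\<lbrakk>a \<in> carrier A; b \<in> carrier A; c \<in> carrier A\<rbrakk> \<Longrightarrow>
        bracket A a (b \<otimes>\<^bsub>A\<^esub> c) = bracket A a b \<otimes>\<^bsub>A\<^esub> c \<oplus>\<^bsub>A\<^esub> b \<otimes>\<^bsub>A\<^esub> bracket A a c"

definition poisson_iso ::
  "('k, 'm) ring_scheme \<Rightarrow> ('k, 'a, 'x) poisson_alg_scheme \<Rightarrow> ('k, 'b, 'y) poisson_alg_scheme
    \<Rightarrow> ('a \<Rightarrow> 'b) set" where
  "poisson_iso K A B = {h. h \<in> ring_iso A B
     \<and> (\<forall>r\<in>carrier K. \<forall>a\<in>carrier A. h (r \<odot>\<^bsub>A\<^esub> a) = r \<odot>\<^bsub>B\<^esub> h a)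
     \<and> (\<forall>a\<in>carrier A. \<forall>b\<in>carrier A. h (bracket A a b) = bracket B (h a) (h b))}"

definition poisson_isomorphic ::
  "('k, 'm) ring_scheme \<Rightarrow> ('k, 'a, 'x) poisson_alg_scheme \<Rightarrow> ('k, 'b, 'y) poisson_alg_scheme
    \<Rightarrow> bool" where
  "poisson_isomorphic K A B \<longleftrightarrow> poisson_iso K A B \<noteq> {}"

definition poisson_center :: "('k, 'a, 'x) poisson_alg_scheme \<Rightarrow> 'a set" where
  "poisson_center A = {z \<in> carrier A. \<forall>a\<in>carrier A. bracket A z a = \<zero>\<^bsub>A\<^esub>}"

abbreviation center_alg :: "('k, 'a, 'x) poisson_alg_scheme \<Rightarrow> ('k, 'a, 'x) poisson_alg_scheme" where
  "center_alg A \<equiv> A\<lparr>carrier := poisson_center A\<rparr>"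

definition subalg :: "('k, 'm) ring_scheme \<Rightarrow> ('k, 'a, 'x) module_scheme \<Rightarrow> 'a set \<Rightarrow> bool" where
  "subalg K A V \<longleftrightarrow> subring V A \<and> submodule V K A"

definition generates :: "('k, 'm) ring_scheme \<Rightarrow> ('k, 'a, 'x) module_scheme \<Rightarrow> 'a set \<Rightarrow> bool" where
  "generates K A S \<longleftrightarrow> S \<subseteq> carrier A \<and> subalg K A hull S = carrier A"

definition affine_alg :: "('k, 'm) ring_scheme \<Rightarrow> ('k, 'a, 'x) module_scheme \<Rightarrow> bool" where
  "affine_alg K A \<longleftrightarrow> (\<exists>S. finite S \<and> generates K A S)"


section \<open>Polynomial extensions\<close>

text \<open>As in \<^theory>\<open>HOL-Algebra.Indexed_Polynomials\<close>, a monomial is the multiset of its variables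
  and a polynomial is its coefficient function. The variables are \<open>t\<^sub>i\<close> for \<open>i < n\<close>.\<close>

definition mpoly_carrier :: "('a, 'm) ring_scheme \<Rightarrow> nat \<Rightarrow> (nat multiset \<Rightarrow> 'a) set" where
  "mpoly_carrier R n = {p. range p \<subseteq> carrier R \<and> finite {M. p M \<noteq> \<zero>\<^bsub>R\<^esub>}
     \<and> (\<forall>M. p M \<noteq> \<zero>\<^bsub>R\<^esub> \<longrightarrow> set_mset M \<subseteq> {..<n})}"

definition poly_ext ::
  "('k, 'a, 'x) poisson_alg_scheme \<Rightarrow> nat \<Rightarrow> ('k, nat multiset \<Rightarrow> 'a) poisson_alg" where
  "poly_ext A n = \<lparr>
     carrier = mpoly_carrier A n,
     monoid.mult = (\<lambda>p q M. \<Oplus>\<^bsub>A\<^esub> N\<in>{N. N \<subseteq># M}. p N \<otimes>\<^bsub>A\<^esub> q (M - N)),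
     monoid.one = (\<lambda>M. if M = {#} then \<one>\<^bsub>A\<^esub> else \<zero>\<^bsub>A\<^esub>),
     ring.zero = (\<lambda>M. \<zero>\<^bsub>A\<^esub>),
     ring.add = (\<lambda>p q M. p M \<oplus>\<^bsub>A\<^esub> q M),
     module.smult = (\<lambda>r p M. r \<odot>\<^bsub>A\<^esub> p M),
     bracket = (\<lambda>p q M. \<Oplus>\<^bsub>A\<^esub> N\<in>{N. N \<subseteq># M}. bracket A (p N) (q (M - N)))\<rparr>"

definition poisson_cancellative ::
  "'b itself \<Rightarrow> ('k, 'm) ring_scheme \<Rightarrow> ('k, 'a, 'x) poisson_alg_scheme \<Rightarrow> bool" where
  "poisson_cancellative _ K A \<longleftrightarrow>
     (\<forall>B :: ('k, 'b) poisson_alg. poisson_algebra K B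
        \<longrightarrow> poisson_isomorphic K (poly_ext A 1) (poly_ext B 1) \<longrightarrow> poisson_isomorphic K A B)"


section \<open>Poisson discriminants\<close>

text \<open>Scalar multiplication and bracket on cosets follow the pattern of \<^const>\<open>rcoset_mult\<close>.\<close>

definition poisson_quot ::
  "('k, 'a, 'x) poisson_alg_scheme \<Rightarrow> 'a set \<Rightarrow> ('k, 'a set) poisson_alg" where
  "poisson_quot A I = \<lparr>
     carrier = carrier (A Quot I),
     monoid.mult = monoid.mult (A Quot I),
     monoid.one = monoid.one (A Quot I),
     ring.zero = ring.zero (A Quot I),
     ring.add = ring.add (A Quot I),
     module.smult = (\<lambda>r U. \<Union>u\<in>U. I +>\<^bsub>A\<^esub> (r \<odot>\<^bsub>A\<^esub> u)),
     bracket = (\<lambda>U V. \<Union>u\<in>U. \<Union>v\<in>V. I +>\<^bsub>A\<^esub> bracket A u v)\<rparr>"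

text \<open>HOL has no predicates ranging over algebras on all types, so a property of Poisson algebras
  is an isomorphism-invariant predicate on the Poisson algebras carried by subsets of one type
  \<open>'u\<close>; it is transported along isomorphism to algebras on other types, such as quotients and
  polynomial extensions. When \<open>'u\<close> is infinite, every quotient of a polynomial extension of an
  algebra carried by \<open>'u\<close> has an isomorphic copy carried by \<open>'u\<close>.\<close>

definition poisson_property ::
  "('k, 'm) ring_scheme \<Rightarrow> (('k, 'u) poisson_alg \<Rightarrow> bool) \<Rightarrow> bool" where
  "poisson_property K P \<longleftrightarrow> (\<forall>R S. poisson_algebra K R \<longrightarrow> poisson_algebra K S
     \<longrightarrow> poisson_isomorphic K R S \<longrightarrow> P R \<longrightarrow> P S)"

definition has_property ::
  "('k, 'm) ring_scheme \<Rightarrow> (('k, 'u) poisson_alg \<Rightarrow> bool) \<Rightarrow> ('k, 'a, 'x) poisson_alg_scheme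
    \<Rightarrow> bool" where
  "has_property K P Q \<longleftrightarrow> (\<exists>R. poisson_algebra K R \<and> poisson_isomorphic K R Q \<and> P R)"

definition max_spec :: "('a, 'm) ring_scheme \<Rightarrow> 'a set set" where
  "max_spec R = {m. maximalideal m R}"

definition L_locus ::
  "('k, 'm) ring_scheme \<Rightarrow> (('k, 'u) poisson_alg \<Rightarrow> bool) \<Rightarrow> ('k, 'a, 'x) poisson_alg_scheme
    \<Rightarrow> 'a set set" where
  "L_locus K P A =
     {m \<in> max_spec (center_alg A). has_property K P (poisson_quot A (Idl\<^bsub>A\<^esub> m))}"

definition D_locus ::
  "('k, 'm) ring_scheme \<Rightarrow> (('k, 'u) poisson_alg \<Rightarrow> bool) \<Rightarrow> ('k, 'a, 'x) poisson_alg_scheme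
    \<Rightarrow> 'a set set" where
  "D_locus K P A = max_spec (center_alg A) - L_locus K P A"

text \<open>The intersection is taken inside the Poisson center: it is the whole center when
  \<^const>\<open>D_locus\<close> is empty.\<close>

definition disc_ideal ::
  "('k, 'm) ring_scheme \<Rightarrow> (('k, 'u) poisson_alg \<Rightarrow> bool) \<Rightarrow> ('k, 'a, 'x) poisson_alg_scheme
    \<Rightarrow> 'a set" where
  "disc_ideal K P A = poisson_center A \<inter> \<Inter>(D_locus K P A)"

definition is_discriminant ::
  "('k, 'm) ring_scheme \<Rightarrow> (('k, 'u) poisson_alg \<Rightarrow> bool) \<Rightarrow> ('k, 'a, 'x) poisson_alg_scheme
    \<Rightarrow> 'a \<Rightarrow> bool" where
  "is_discriminant K P A d \<longleftrightarrow>
     d \<in> poisson_center A \<and> disc_ideal K P A = PIdl\<^bsub>center_alg A\<^esub> d"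

text \<open>\<open>I \<otimes> K[t\<^sub>1, \<dots>, t\<^sub>n]\<close> consists of the polynomials all of whose coefficients lie in \<open>I\<close>.\<close>

definition stable_property ::
  "('k, 'm) ring_scheme \<Rightarrow> (('k, 'u) poisson_alg \<Rightarrow> bool) \<Rightarrow> bool" where
  "stable_property K P \<longleftrightarrow>
     (\<forall>(C :: ('k, 'u) poisson_alg) n. poisson_algebra K C \<longrightarrow> affine_alg K (center_alg C) \<longrightarrow> n \<ge> 1
        \<longrightarrow> disc_ideal K P (poly_ext C n)
            = {p \<in> mpoly_carrier C n. range p \<subseteq> disc_ideal K P C})"


section \<open>Filtrations and effective elements\<close>

definition filtration ::
  "('k, 'm) ring_scheme \<Rightarrow> ('k, 'a, 'x) module_scheme \<Rightarrow> (nat \<Rightarrow> 'a set) \<Rightarrow> bool" where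
  "filtration K A F \<longleftrightarrow>
     (\<forall>i. submodule (F i) K A) \<and> (\<forall>i. F i \<subseteq> F (Suc i)) \<and> (\<Union>i. F i) = carrier A
     \<and> \<one>\<^bsub>A\<^esub> \<in> F 0 \<and> (\<forall>i j. \<forall>a\<in>F i. \<forall>b\<in>F j. a \<otimes>\<^bsub>A\<^esub> b \<in> F (i + j))"

definition filt_deg :: "(nat \<Rightarrow> 'a set) \<Rightarrow> 'a \<Rightarrow> nat" where
  "filt_deg F a = (LEAST i. a \<in> F i)"

definition filt_pred :: "('a, 'm) ring_scheme \<Rightarrow> (nat \<Rightarrow> 'a set) \<Rightarrow> nat \<Rightarrow> 'a set" where
  "filt_pred A F i = (if i = 0 then {\<zero>\<^bsub>A\<^esub>} else F (i - 1))"

text \<open>The associated graded ring, the direct sum of the \<open>F\<^sub>i / F\<^sub>i\<^sub>-\<^sub>1\<close>: an element is a family of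
  cosets, almost all of them zero. The product is the convolution product, computed on all
  families of representatives at once, as in \<^const>\<open>rcoset_mult\<close>.\<close>

definition assoc_graded ::
  "('a, 'm) ring_scheme \<Rightarrow> (nat \<Rightarrow> 'a set) \<Rightarrow> (nat \<Rightarrow> 'a set) ring" where
  "assoc_graded A F = \<lparr>
     carrier = {g. (\<forall>i. \<exists>x\<in>F i. g i = filt_pred A F i +>\<^bsub>A\<^esub> x) \<and> finite {i. g i \<noteq> filt_pred A F i}},
     monoid.mult = (\<lambda>g h k. \<Union>{filt_pred A F k +>\<^bsub>A\<^esub> (\<Oplus>\<^bsub>A\<^esub> i\<in>{..k}. a i \<otimes>\<^bsub>A\<^esub> b (k - i)) | a b.
                        \<forall>i\<le>k. a i \<in> g i \<and> b i \<in> h i}),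
     monoid.one = (\<lambda>i. filt_pred A F i +>\<^bsub>A\<^esub> (if i = 0 then \<one>\<^bsub>A\<^esub> else \<zero>\<^bsub>A\<^esub>)),
     ring.zero = filt_pred A F,
     ring.add = (\<lambda>g h i. g i <+>\<^bsub>A\<^esub> h i)\<rparr>"

text \<open>Linear independence of \<open>y\<^sub>0, \<dots>, y\<^sub>n\<^sub>-\<^sub>1\<close> in the quotient space \<open>T / K1\<^sub>T\<close>.\<close>

definition indep_mod_scalars ::
  "('k, 'm) ring_scheme \<Rightarrow> ('k, 'a, 'x) module_scheme \<Rightarrow> nat \<Rightarrow> (nat \<Rightarrow> 'a) \<Rightarrow> bool" where
  "indep_mod_scalars K T n y \<longleftrightarrow>
     (\<forall>c r. c ` {..<n} \<subseteq> carrier K \<longrightarrow> r \<in> carrier K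
        \<longrightarrow> (\<Oplus>\<^bsub>T\<^esub> i\<in>{..<n}. c i \<odot>\<^bsub>T\<^esub> y i) = r \<odot>\<^bsub>T\<^esub> \<one>\<^bsub>T\<^esub> \<longrightarrow> (\<forall>i<n. c i = \<zero>\<^bsub>K\<^esub>))"

definition mpoly_eval ::
  "('k, 'm) ring_scheme \<Rightarrow> ('k, 'a, 'x) module_scheme \<Rightarrow> (nat \<Rightarrow> 'a) \<Rightarrow> (nat multiset \<Rightarrow> 'k) \<Rightarrow> 'a"
  where
  "mpoly_eval K T y p =
     (\<Oplus>\<^bsub>T\<^esub> M\<in>{M. p M \<noteq> \<zero>\<^bsub>K\<^esub>}. p M \<odot>\<^bsub>T\<^esub> (\<Otimes>\<^bsub>T\<^esub> i\<in>set_mset M. y i [^]\<^bsub>T\<^esub> count M i))"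

text \<open>The generators \<open>x\<^sub>i\<close> of \<open>C\<close> are taken linearly independent modulo the scalars, i.e.
  \<open>Y = \<Oplus>\<^sub>i K x\<^sub>i\<close> with \<open>Y \<inter> K1 = 0\<close>, matching the condition on test sets. If \<open>Y\<close> were
  allowed to contain a scalar combination \<open>l(x) = 1\<close>, then adding \<open>(l(x) - 1) x\<^sub>j\<^sup>N\<close>, with \<open>j\<close>
  strictly degree-increasing and \<open>N\<close> large, to a presentation would make every nonzero element
  effective. The filtered test algebras \<open>T\<close> are carried by subsets of the type of \<open>C\<close>.\<close>

definition effective ::
  "('k, 'm) ring_scheme \<Rightarrow> ('k, 'u, 'x) module_scheme \<Rightarrow> 'u \<Rightarrow> bool" where
  "effective K C f \<longleftrightarrow> f \<in> carrier C \<and> f \<noteq> \<zero>\<^bsub>C\<^esub> \<and>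
     (\<exists>n x. generates K C (x ` {..<n}) \<and> indep_mod_scalars K C n x \<and>
       (\<exists>F. filtration K C F \<and> domain (assoc_graded C F) \<and>
         (\<forall>(T :: ('k, 'u) module) G y.
            algebra K T \<and> filtration K T G \<and> domain (assoc_graded T G)
            \<and> y ` {..<n} \<subseteq> carrier T \<and> indep_mod_scalars K T n y
            \<and> (\<forall>i<n. filt_deg G (y i) \<ge> filt_deg F (x i))
            \<and> (\<exists>i<n. filt_deg G (y i) > filt_deg F (x i))
            \<longrightarrow> (\<exists>p\<in>mpoly_carrier K n. mpoly_eval K C x p = f
                  \<and> (mpoly_eval K T y p = \<zero>\<^bsub>T\<^esub>
                     \<or> filt_deg G (mpoly_eval K T y p) > filt_deg F f)))))"

end

theory Submission
  imports Defs
begin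

text \<open>
  Let \<open>\<phi>: A[s] \<cong> B[t]\<close> be an isomorphism of Poisson algebras. It maps the Poisson center
  \<open>Z\<^sub>A[s]\<close> of \<open>A[s]\<close> onto \<open>Z\<^sub>B[t]\<close>, and everything follows once it is known to map
  \<open>Z\<^sub>A\<close> into \<open>Z\<^sub>B\<close>.

  The discriminant provides one element that behaves well. Discriminant ideals are invariant under
  isomorphisms, and by stability those of \<open>A[s]\<close> and \<open>B[t]\<close> consist of the polynomials with
  coefficients in those of \<open>A\<close> and \<open>B\<close>. Hence \<open>\<phi>(d)\<close> divides every constant
  in the discriminant ideal of \<open>B\<close>; as \<open>B\<close> is a domain, \<open>\<phi>(d)\<close> is itself constant
  (\<open>discriminant_constant\<close>).

  Effectiveness spreads this from \<open>d\<close> to all of \<open>C\<close>, where \<open>C\<close> is \<open>A\<close> or \<open>Z\<^sub>A\<close>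
  and \<open>D\<close> is \<open>B\<close> or \<open>Z\<^sub>B\<close> accordingly (\<open>effective_imp_constants\<close>). Let
  \<open>H: D[t] \<rightarrow> C[s]\<close> be the homomorphism that agrees with \<open>\<phi>\<inverse>\<close> on \<open>D\<close> and sends
  \<open>t\<close> to \<open>\<phi>\<inverse>(t) + s\<^sup>N\<close>. The elements \<open>y\<^sub>j = H(\<phi>(x\<^sub>j))\<close> are congruent to
  the generators \<open>x\<^sub>j\<close> modulo \<open>s\<^sup>N\<close>. Suppose that some \<open>\<phi>(x\<^sub>i)\<close> involves
  \<open>t\<close>; then \<open>y\<^sub>i\<close> involves \<open>s\<close> for large \<open>N\<close>. If \<open>s\<close> is given a large
  weight, no \<open>y\<^sub>j\<close> has smaller degree than \<open>x\<^sub>j\<close>, and \<open>y\<^sub>i\<close> has larger degree than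
  \<open>x\<^sub>i\<close>. But \<open>H \<circ> \<phi>\<close> fixes \<open>d\<close>, because \<open>\<phi>(d) \<in> D\<close>, so every presentation
  of \<open>d\<close> takes at the \<open>y\<^sub>j\<close> the value \<open>d\<close> again: it neither vanishes nor gains degree,
  against effectiveness. Here \<open>H \<circ> \<phi>\<close> takes the place of the exponential of a locally
  nilpotent derivation, and it works in every characteristic.

  Finally let \<open>\<phi>(Z\<^sub>A) \<subseteq> Z\<^sub>B\<close> and let \<open>v \<in> Z\<^sub>B\<close> be the image of the constant
  coefficient of \<open>\<phi>\<inverse>(t)\<close>. Then \<open>\<phi>(s)\<close> divides \<open>t - v\<close>; the cofactor is a unit,
  and \<open>A \<cong> A[s]/(s) \<cong> B[t]/(t - v) \<cong> B\<close>
  (\<open>poisson_isomorphic_if_center_constants\<close>).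

  Stability and the test algebras of effectiveness concern algebras carried by the type
  \<open>'u\<close> of \<open>A\<close>. As \<open>'u\<close> is infinite, the polynomials over \<open>'u\<close> embed into it, and so
  \<open>C[s]\<close> and \<open>B\<close>, which embeds into \<open>B[t] \<cong> A[s]\<close>, have isomorphic copies there.
\<close>

section \<open>Transport along isomorphisms\<close>

text \<open>A ring isomorphism does not determine the zero of its target as long as the target is a bare
  record. The condition on zero makes being an algebra carry over to \<open>S\<close>.\<close>

definition alg_iso ::
  "('k, 'm) ring_scheme \<Rightarrow> ('k, 'a, 'x) module_scheme \<Rightarrow> ('k, 'b, 'y) module_scheme \<Rightarrow> ('a \<Rightarrow> 'b) set"
  where
  "alg_iso K R S = {h. h \<in> ring_iso R S \<and> h \<zero>\<^bsub>R\<^esub> = \<zero>\<^bsub>S\<^esub>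
     \<and> (\<forall>r\<in>carrier K. \<forall>a\<in>carrier R. h (r \<odot>\<^bsub>R\<^esub> a) = r \<odot>\<^bsub>S\<^esub> h a)}"

lemma alg_isoD:
  assumes "h \<in> alg_iso K R S"
  shows "h \<in> ring_iso R S" and "h \<in> ring_hom R S" and "bij_betw h (carrier R) (carrier S)"
    and "inj_on h (carrier R)" and "h ` carrier R = carrier S"
    and "h \<zero>\<^bsub>R\<^esub> = \<zero>\<^bsub>S\<^esub>" and "h \<one>\<^bsub>R\<^esub> = \<one>\<^bsub>S\<^esub>"
    and "\<And>x. x \<in> carrier R \<Longrightarrow> h x \<in> carrier S"
    and "\<And>x y. \<lbrakk>x \<in> carrier R; y \<in> carrier R\<rbrakk> \<Longrightarrow> h (x \<oplus>\<^bsub>R\<^esub> y) = h x \<oplus>\<^bsub>S\<^esub> h y"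
    and "\<And>x y. \<lbrakk>x \<in> carrier R; y \<in> carrier R\<rbrakk> \<Longrightarrow> h (x \<otimes>\<^bsub>R\<^esub> y) = h x \<otimes>\<^bsub>S\<^esub> h y"
    and "\<And>r x. \<lbrakk>r \<in> carrier K; x \<in> carrier R\<rbrakk> \<Longrightarrow> h (r \<odot>\<^bsub>R\<^esub> x) = r \<odot>\<^bsub>S\<^esub> h x"
  using assms by (auto simp: alg_iso_def ring_iso_def ring_hom_def bij_betw_def)

lemma ring_iso_inv_into:
  assumes "ring R" and h: "h \<in> ring_iso R S"
  shows "inv_into (carrier R) h \<in> ring_iso S R"
proof (rule ring_iso_memI)
  interpret R: ring R by fact
  let ?g = "inv_into (carrier R) h"
  note D = ring_iso_memE[OF h]
  have sur: "y \<in> h ` carrier R" if "y \<in> carrier S" for y using D(5) that by (simp add: bij_betw_def)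
  note g = inv_into_into[OF sur] f_inv_into_f[OF sur]
  have gh: "?g (h x) = x" if "x \<in> carrier R" for x using D(5) that by (simp add: bij_betw_def)
  show "bij_betw ?g (carrier S) (carrier R)" by (rule bij_betw_inv_into[OF D(5)])
  show "?g \<one>\<^bsub>S\<^esub> = \<one>\<^bsub>R\<^esub>" using gh[of "\<one>\<^bsub>R\<^esub>"] D(4) by simp
  fix a b assume a: "a \<in> carrier S" and b: "b \<in> carrier S"
  show "?g a \<in> carrier R" by (rule g(1)[OF a])
  show "?g (a \<otimes>\<^bsub>S\<^esub> b) = ?g a \<otimes>\<^bsub>R\<^esub> ?g b"
    using gh[of "?g a \<otimes>\<^bsub>R\<^esub> ?g b"] D(2)[of "?g a" "?g b"] g[OF a] g[OF b] by simp
  show "?g (a \<oplus>\<^bsub>S\<^esub> b) = ?g a \<oplus>\<^bsub>R\<^esub> ?g b"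
    using gh[of "?g a \<oplus>\<^bsub>R\<^esub> ?g b"] D(3)[of "?g a" "?g b"] g[OF a] g[OF b] by simp
qed

lemma cring_alg_iso:
  assumes "cring R" "h \<in> alg_iso K R S" shows "cring S"
proof -
  have "cring (S\<lparr>zero := h \<zero>\<^bsub>R\<^esub>\<rparr>)"
    by (rule cring.ring_iso_imp_img_cring[OF assms(1) alg_isoD(1)[OF assms(2)]])
  then show ?thesis by (simp add: alg_isoD(6)[OF assms(2)])
qed

lemma domain_alg_iso:
  assumes "domain R" "h \<in> alg_iso K R S" shows "domain S"
proof -
  have "domain (S\<lparr>zero := h \<zero>\<^bsub>R\<^esub>\<rparr>)"
    by (rule domain.ring_iso_imp_img_domain[OF assms(1) alg_isoD(1)[OF assms(2)]])
  then show ?thesis by (simp add: alg_isoD(6)[OF assms(2)])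
qed

lemma algebra_alg_iso:
  assumes "algebra K R" and h: "h \<in> alg_iso K R S" shows "algebra K S"
proof -
  interpret R: algebra K R by fact
  interpret S: cring S by (rule cring_alg_iso[OF R.M_cring h])
  note D = alg_isoD[OF h]
  have sur: "\<And>y. y \<in> carrier S \<Longrightarrow> \<exists>x\<in>carrier R. y = h x" using D(5) by auto
  show ?thesis
  proof (rule algebraI)
    fix a x assume "a \<in> carrier K" "x \<in> carrier S"
    with sur obtain x' where "x' \<in> carrier R" "x = h x'" by blast
    with \<open>a \<in> carrier K\<close> D(8)[OF R.smult_closed] show "a \<odot>\<^bsub>S\<^esub> x \<in> carrier S"
      by (simp add: D(11)[symmetric])
  next
    fix a b x assume K: "a \<in> carrier K" "b \<in> carrier K" and "x \<in> carrier S"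
    with sur obtain x' where "x' \<in> carrier R" "x = h x'" by blast
    with K show "(a \<oplus>\<^bsub>K\<^esub> b) \<odot>\<^bsub>S\<^esub> x = a \<odot>\<^bsub>S\<^esub> x \<oplus>\<^bsub>S\<^esub> b \<odot>\<^bsub>S\<^esub> x"
      and "(a \<otimes>\<^bsub>K\<^esub> b) \<odot>\<^bsub>S\<^esub> x = a \<odot>\<^bsub>S\<^esub> (b \<odot>\<^bsub>S\<^esub> x)"
      by (simp_all add: D(9,11)[symmetric] R.smult_l_distr R.smult_assoc1)
  next
    fix a x y assume K: "a \<in> carrier K" and "x \<in> carrier S" "y \<in> carrier S"
    with sur obtain x' y' where "x' \<in> carrier R" "x = h x'" "y' \<in> carrier R" "y = h y'" by metis
    with K show "a \<odot>\<^bsub>S\<^esub> (x \<oplus>\<^bsub>S\<^esub> y) = a \<odot>\<^bsub>S\<^esub> x \<oplus>\<^bsub>S\<^esub> a \<odot>\<^bsub>S\<^esub> y"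
      and "(a \<odot>\<^bsub>S\<^esub> x) \<otimes>\<^bsub>S\<^esub> y = a \<odot>\<^bsub>S\<^esub> (x \<otimes>\<^bsub>S\<^esub> y)"
      by (simp_all add: D(9,10,11)[symmetric] R.smult_r_distr R.smult_assoc2)
  next
    fix x assume "x \<in> carrier S"
    with sur obtain x' where "x' \<in> carrier R" "x = h x'" by blast
    then show "\<one>\<^bsub>K\<^esub> \<odot>\<^bsub>S\<^esub> x = x" by (simp add: D(11)[symmetric])
  qed (use R.R_cring S.cring_axioms in auto)
qed

lemma poisson_iso_alg_iso:
  assumes "h \<in> poisson_iso K R S" "h \<zero>\<^bsub>R\<^esub> = \<zero>\<^bsub>S\<^esub>" shows "h \<in> alg_iso K R S"
  using assms by (simp add: poisson_iso_def alg_iso_def)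

lemma poisson_isoD:
  assumes "h \<in> poisson_iso K R S"
  shows "h \<in> ring_iso R S" and "h \<in> ring_hom R S" and "bij_betw h (carrier R) (carrier S)"
    and "inj_on h (carrier R)" and "h ` carrier R = carrier S" and "h \<one>\<^bsub>R\<^esub> = \<one>\<^bsub>S\<^esub>"
    and "\<And>x. x \<in> carrier R \<Longrightarrow> h x \<in> carrier S"
    and "\<And>x y. \<lbrakk>x \<in> carrier R; y \<in> carrier R\<rbrakk> \<Longrightarrow> h (x \<oplus>\<^bsub>R\<^esub> y) = h x \<oplus>\<^bsub>S\<^esub> h y"
    and "\<And>x y. \<lbrakk>x \<in> carrier R; y \<in> carrier R\<rbrakk> \<Longrightarrow> h (x \<otimes>\<^bsub>R\<^esub> y) = h x \<otimes>\<^bsub>S\<^esub> h y"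
    and "\<And>r x. \<lbrakk>r \<in> carrier K; x \<in> carrier R\<rbrakk> \<Longrightarrow> h (r \<odot>\<^bsub>R\<^esub> x) = r \<odot>\<^bsub>S\<^esub> h x"
    and "\<And>x y. \<lbrakk>x \<in> carrier R; y \<in> carrier R\<rbrakk> \<Longrightarrow> h (bracket R x y) = bracket S (h x) (h y)"
  using assms by (auto simp: poisson_iso_def ring_iso_def ring_hom_def bij_betw_def)

lemma poisson_iso_zero:
  assumes "h \<in> poisson_iso K R S" "ring R" "ring S" shows "h \<zero>\<^bsub>R\<^esub> = \<zero>\<^bsub>S\<^esub>"
  by (rule ring_hom_zero[OF poisson_isoD(2)[OF assms(1)] assms(2,3)])

lemma poisson_algebra_iso:
  assumes "poisson_algebra K R" and h: "h \<in> poisson_iso K R S" and h0: "h \<zero>\<^bsub>R\<^esub> = \<zero>\<^bsub>S\<^esub>"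
  shows "poisson_algebra K S"
proof -
  interpret R: poisson_algebra K R by fact
  have ai: "h \<in> alg_iso K R S" by (rule poisson_iso_alg_iso[OF h h0])
  interpret S: algebra K S by (rule algebra_alg_iso[OF R.algebra_axioms ai])
  note D = poisson_isoD[OF h]
  note B = D(8,9,10,11)[symmetric]
  have sur: "\<And>y. y \<in> carrier S \<Longrightarrow> \<exists>x\<in>carrier R. y = h x" using D(5) by auto
  show ?thesis
  proof
    fix a b assume "a \<in> carrier S" "b \<in> carrier S"
    with sur obtain a' b' where "a' \<in> carrier R" "a = h a'" "b' \<in> carrier R" "b = h b'" by metis
    then show "bracket S a b \<in> carrier S" by (simp add: B D(7) R.bracket_closed)
  next
    fix a b c assume "a \<in> carrier S" "b \<in> carrier S" "c \<in> carrier S"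
    with sur obtain a' b' c' where "a' \<in> carrier R" "a = h a'" "b' \<in> carrier R" "b = h b'"
      "c' \<in> carrier R" "c = h c'" by metis
    note * = this
    show "bracket S (a \<oplus>\<^bsub>S\<^esub> b) c = bracket S a c \<oplus>\<^bsub>S\<^esub> bracket S b c"
      "bracket S a (b \<oplus>\<^bsub>S\<^esub> c) = bracket S a b \<oplus>\<^bsub>S\<^esub> bracket S a c"
      "bracket S a (b \<otimes>\<^bsub>S\<^esub> c) = bracket S a b \<otimes>\<^bsub>S\<^esub> c \<oplus>\<^bsub>S\<^esub> b \<otimes>\<^bsub>S\<^esub> bracket S a c"
      using * by (simp_all add: B R.bracket_closed R.bracket_add_left R.bracket_add_right R.bracket_leibniz)
    show "bracket S a (bracket S b c) \<oplus>\<^bsub>S\<^esub> bracket S b (bracket S c a)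
          \<oplus>\<^bsub>S\<^esub> bracket S c (bracket S a b) = \<zero>\<^bsub>S\<^esub>"
      using * by (simp add: B R.bracket_closed R.bracket_jacobi h0[symmetric])
  next
    fix r a b assume r: "r \<in> carrier K" and "a \<in> carrier S" "b \<in> carrier S"
    with sur obtain a' b' where "a' \<in> carrier R" "a = h a'" "b' \<in> carrier R" "b = h b'" by metis
    with r show "bracket S (r \<odot>\<^bsub>S\<^esub> a) b = r \<odot>\<^bsub>S\<^esub> bracket S a b"
      "bracket S a (r \<odot>\<^bsub>S\<^esub> b) = r \<odot>\<^bsub>S\<^esub> bracket S a b"
      by (simp_all add: B R.bracket_closed R.bracket_smult_left R.bracket_smult_right)
  next
    fix a assume "a \<in> carrier S"
    with sur obtain a' where "a' \<in> carrier R" "a = h a'" by metis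
    then show "bracket S a a = \<zero>\<^bsub>S\<^esub>" by (simp add: B R.bracket_alternating h0)
  qed
qed

lemma poisson_iso_trans:
  assumes "h \<in> poisson_iso K R S" "g \<in> poisson_iso K S T" shows "g \<circ> h \<in> poisson_iso K R T"
  using assms poisson_isoD(7)[OF assms(1)]
  by (auto simp: poisson_iso_def intro: ring_iso_set_trans)

lemma poisson_isomorphic_trans:
  assumes "poisson_isomorphic K R S" "poisson_isomorphic K S T" shows "poisson_isomorphic K R T"
  using assms poisson_iso_trans unfolding poisson_isomorphic_def by blast

text \<open>Stated for rings with closed operations, since that much is all that is established of
  polynomial algebras below.\<close>

lemma poisson_iso_sym:
  assumes h: "h \<in> poisson_iso K R S" and "ring R"
    and sm: "\<And>r a. \<lbrakk>r \<in> carrier K; a \<in> carrier R\<rbrakk> \<Longrightarrow> r \<odot>\<^bsub>R\<^esub> a \<in> carrier R"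
    and br: "\<And>a b. \<lbrakk>a \<in> carrier R; b \<in> carrier R\<rbrakk> \<Longrightarrow> bracket R a b \<in> carrier R"
  shows "inv_into (carrier R) h \<in> poisson_iso K S R"
proof -
  interpret R: ring R by fact
  let ?g = "inv_into (carrier R) h"
  note D = poisson_isoD[OF h]
  have g: "\<And>y. y \<in> carrier S \<Longrightarrow> ?g y \<in> carrier R \<and> h (?g y) = y"
    using D(5) by (metis f_inv_into_f inv_into_into)
  have gh: "\<And>x. x \<in> carrier R \<Longrightarrow> ?g (h x) = x" using D(4) by simp
  have "?g (r \<odot>\<^bsub>S\<^esub> a) = r \<odot>\<^bsub>R\<^esub> ?g a" if "r \<in> carrier K" "a \<in> carrier S" for r a
    using gh[of "r \<odot>\<^bsub>R\<^esub> ?g a"] D(10)[of r "?g a"] g[of a] sm that by simp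
  moreover have "?g (bracket S a b) = bracket R (?g a) (?g b)" if "a \<in> carrier S" "b \<in> carrier S" for a b
    using gh[of "bracket R (?g a) (?g b)"] D(11)[of "?g a" "?g b"] g[of a] g[of b] br that by simp
  ultimately show ?thesis
    using ring_iso_inv_into[OF assms(2) D(1)] by (simp add: poisson_iso_def)
qed

lemma poisson_algebra_iso_sym:
  assumes "h \<in> poisson_iso K R S" "poisson_algebra K R"
  shows "inv_into (carrier R) h \<in> poisson_iso K S R"
proof -
  interpret R: poisson_algebra K R by fact
  show ?thesis by (rule poisson_iso_sym[OF assms(1)]) (auto simp: R.bracket_closed R.ring_axioms)
qed

definition transport :: "('a \<Rightarrow> 'b) \<Rightarrow> ('k, 'a, 'x) poisson_alg_scheme \<Rightarrow> ('k, 'b) poisson_alg" where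
  "transport e R = (let g = inv_into (carrier R) e in \<lparr>
     carrier = e ` carrier R,
     monoid.mult = (\<lambda>x y. e (g x \<otimes>\<^bsub>R\<^esub> g y)),
     monoid.one = e \<one>\<^bsub>R\<^esub>,
     ring.zero = e \<zero>\<^bsub>R\<^esub>,
     ring.add = (\<lambda>x y. e (g x \<oplus>\<^bsub>R\<^esub> g y)),
     module.smult = (\<lambda>r x. e (r \<odot>\<^bsub>R\<^esub> g x)),
     bracket = (\<lambda>x y. e (bracket R (g x) (g y)))\<rparr>)"

lemma transport_iso:
  assumes "inj_on e (carrier R)"
  shows "e \<in> poisson_iso K R (transport e R)" and "e \<zero>\<^bsub>R\<^esub> = \<zero>\<^bsub>transport e R\<^esub>"
  using assms
  by (auto simp: poisson_iso_def transport_def Let_def bij_betw_def intro!: ring_iso_memI)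

section \<open>Embedding polynomials into an infinite type\<close>

text \<open>Iterating an injective pairing encodes the lists of each fixed length; pairing the code with the
  length separates the lengths.\<close>

lemma inj_list_into_infinite:
  assumes "infinite (UNIV :: 'u set)"
  shows "\<exists>f :: 'u list \<Rightarrow> 'u. inj f"
proof -
  have "|UNIV \<times> UNIV :: ('u \<times> 'u) set| =o |UNIV :: 'u set|"
    by (rule card_of_Times_same_infinite[OF assms])
  then obtain c :: "'u \<times> 'u \<Rightarrow> 'u" where c: "inj c"
    by (metis UNIV_Times_UNIV bij_betw_def card_of_ordIso)
  obtain \<nu> :: "nat \<Rightarrow> 'u" where \<nu>: "inj \<nu>"
    using infinite_countable_subset[OF assms] by blast
  define enc where "enc = (\<lambda>xs. foldr (\<lambda>x y. c (x, y)) xs (\<nu> 0))"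
  have "xs = ys" if "length xs = length ys" "enc xs = enc ys" for xs ys
    using that by (induction xs ys rule: list_induct2) (auto simp: enc_def dest: injD[OF c])
  then have "inj (\<lambda>xs. c (\<nu> (length xs), enc xs))"
    by (intro injI) (auto dest!: injD[OF c] injD[OF \<nu>])
  then show ?thesis by blast
qed

text \<open>A polynomial is determined by the list of its coefficients up to a bound.\<close>

lemma inj_up_into_infinite:
  assumes "infinite (UNIV :: 'u set)"
  shows "\<exists>e :: (nat \<Rightarrow> 'u) \<Rightarrow> 'u. inj_on e (up R)"
proof -
  obtain f :: "'u list \<Rightarrow> 'u" where f: "inj f" using inj_list_into_infinite[OF assms] by blast
  define n where "n p = (SOME n. bound \<zero>\<^bsub>R\<^esub> n p)" for p :: "nat \<Rightarrow> 'u"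
  have n: "bound \<zero>\<^bsub>R\<^esub> (n p) p" if "p \<in> up R" for p
    using that someI_ex[of "\<lambda>n. bound \<zero>\<^bsub>R\<^esub> n p"] unfolding n_def up_def by blast
  have "inj_on (\<lambda>p. f (map p [0..<Suc (n p)])) (up R)"
  proof (rule inj_onI)
    fix p q assume p: "p \<in> up R" and q: "q \<in> up R"
      and "f (map p [0..<Suc (n p)]) = f (map q [0..<Suc (n q)])"
    then have eq: "map p [0..<Suc (n p)] = map q [0..<Suc (n q)]" using f by (simp only: inj_eq)
    then have nn: "n p = n q" using map_eq_imp_length_eq by fastforce
    show "p = q"
    proof
      fix i show "p i = q i"
      proof (cases "i \<le> n p")
        case True
        then have "i \<in> set [0..<Suc (n p)]" by auto
        with eq nn show ?thesis by (metis map_eq_conv)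
      next
        case False
        with n[OF p] n[OF q] nn show ?thesis by (auto simp: bound_def)
      qed
    qed
  qed
  then show ?thesis by blast
qed

section \<open>Polynomials in one variable\<close>

lemma UP_carrier: "carrier (UP R) = up R"
  by (simp add: UP_def)

lemma UP_add: "\<lbrakk>p \<in> up R; q \<in> up R\<rbrakk> \<Longrightarrow> p \<oplus>\<^bsub>UP R\<^esub> q = (\<lambda>i. p i \<oplus>\<^bsub>R\<^esub> q i)"
  by (simp add: UP_def)

lemma UP_mult:
  "\<lbrakk>p \<in> up R; q \<in> up R\<rbrakk> \<Longrightarrow> p \<otimes>\<^bsub>UP R\<^esub> q = (\<lambda>n. \<Oplus>\<^bsub>R\<^esub> i\<in>{..n}. p i \<otimes>\<^bsub>R\<^esub> q (n - i))"
  by (simp add: UP_def)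

lemma UP_zero: "\<zero>\<^bsub>UP R\<^esub> = (\<lambda>i. \<zero>\<^bsub>R\<^esub>)"
  by (simp add: UP_def)

lemma UP_one: "\<one>\<^bsub>UP R\<^esub> = (\<lambda>i. if i = 0 then \<one>\<^bsub>R\<^esub> else \<zero>\<^bsub>R\<^esub>)"
  by (simp add: UP_def)

lemma UP_monom: "a \<in> carrier R \<Longrightarrow> up_ring.monom (UP R) a n = (\<lambda>i. if i = n then a else \<zero>\<^bsub>R\<^esub>)"
  by (simp add: UP_def)

lemma UP_coeff: "p \<in> up R \<Longrightarrow> up_ring.coeff (UP R) p n = p n"
  by (simp add: UP_def)

lemma UP_cringI: "cring R \<Longrightarrow> UP_cring R"
  by (simp add: UP_cring_def)

abbreviation cst :: "('a, 'm) ring_scheme \<Rightarrow> 'a \<Rightarrow> nat \<Rightarrow> 'a" where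
  "cst R a \<equiv> up_ring.monom (UP R) a 0"

abbreviation indet :: "('a, 'm) ring_scheme \<Rightarrow> nat \<Rightarrow> 'a" where
  "indet R \<equiv> up_ring.monom (UP R) \<one>\<^bsub>R\<^esub> (Suc 0)"

lemma UP_ring_hom_zeroth_coeff:
  assumes "cring R" shows "(\<lambda>p. p 0) \<in> ring_hom (UP R) R"
proof -
  interpret cring R by fact
  show ?thesis
    by (rule ring_hom_memI) (auto simp: UP_carrier UP_add UP_mult UP_one mem_upD)
qed

lemma UP_induct [consumes 2, case_names monom add]:
  assumes "cring R" and p: "p \<in> carrier (UP R)"
    and mon: "\<And>a n. a \<in> carrier R \<Longrightarrow> Q (up_ring.monom (UP R) a n)"
    and add: "\<And>p q. \<lbrakk>p \<in> carrier (UP R); q \<in> carrier (UP R); Q p; Q q\<rbrakk> \<Longrightarrow> Q (p \<oplus>\<^bsub>UP R\<^esub> q)"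
  shows "Q p"
proof -
  interpret UP_cring R "UP R" by (simp_all add: UP_cringI assms(1))
  note c = mem_upD[OF p[unfolded UP_carrier]]
  have *: "Q (\<Oplus>\<^bsub>UP R\<^esub> i\<in>{..k}. up_ring.monom (UP R) (p i) i)" for k
  proof (induction k)
    case (Suc k)
    have "(\<Oplus>\<^bsub>UP R\<^esub> i\<in>{..k}. up_ring.monom (UP R) (p i) i) \<in> carrier (UP R)"
      using c by (intro P.finsum_closed) auto
    moreover have "up_ring.monom (UP R) (p (Suc k)) (Suc k) \<in> carrier (UP R)"
      using c by auto
    moreover have "(\<Oplus>\<^bsub>UP R\<^esub> i\<in>{..Suc k}. up_ring.monom (UP R) (p i) i) =
      up_ring.monom (UP R) (p (Suc k)) (Suc k) \<oplus>\<^bsub>UP R\<^esub> (\<Oplus>\<^bsub>UP R\<^esub> i\<in>{..k}. up_ring.monom (UP R) (p i) i)"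
      using c by (intro P.finsum_Suc) auto
    ultimately show ?case using mon[OF c] Suc add by simp
  qed (use mon[OF c] c in simp)
  have "(\<Oplus>\<^bsub>UP R\<^esub> i\<in>{..deg R p}. up_ring.monom (UP R) (p i) i) = p"
    using up_repr[of p] p by (simp add: UP_carrier UP_coeff)
  with *[of "deg R p"] show ?thesis by simp
qed

lemma UP_split:
  assumes "cring R" "p \<in> up R"
  shows "\<exists>q\<in>up R. p = cst R (p 0) \<oplus>\<^bsub>UP R\<^esub> indet R \<otimes>\<^bsub>UP R\<^esub> q"
proof -
  interpret UP_cring R "UP R" by (simp_all add: UP_cringI assms(1))
  show ?thesis
    using assms(1,2) unfolding UP_carrier[symmetric]
  proof (induction rule: UP_induct)
    case (monom a n)
    show ?case
    proof (cases n)
      case 0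
      have "\<zero>\<^bsub>UP R\<^esub> \<in> carrier (UP R)" by simp
      moreover have "up_ring.monom (UP R) a n 0 = a" using 0 monom by (simp add: UP_monom[of a])
      ultimately show ?thesis using 0 monom by (intro bexI[of _ "\<zero>\<^bsub>UP R\<^esub>"]) auto
    next
      case (Suc m)
      have "cst R (up_ring.monom (UP R) a n 0) = \<zero>\<^bsub>UP R\<^esub>" using Suc monom by (simp add: UP_monom[of a])
      moreover have "up_ring.monom (UP R) a n = indet R \<otimes>\<^bsub>UP R\<^esub> up_ring.monom (UP R) a m"
        using monom Suc monom_mult[of "\<one>\<^bsub>R\<^esub>" a "Suc 0" m] by simp
      ultimately show ?thesis using monom by (intro bexI[of _ "up_ring.monom (UP R) a m"]) auto
    qed
  next
    case (add p q)
    from add.IH(1) obtain p' where p': "p' \<in> carrier (UP R)" "p = cst R (p 0) \<oplus>\<^bsub>UP R\<^esub> indet R \<otimes>\<^bsub>UP R\<^esub> p'"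
      by (rule bexE)
    from add.IH(2) obtain q' where q': "q' \<in> carrier (UP R)" "q = cst R (q 0) \<oplus>\<^bsub>UP R\<^esub> indet R \<otimes>\<^bsub>UP R\<^esub> q'"
      by (rule bexE)
    note * = p'(1) q'(1) p'(2) q'(2)
    have c: "p 0 \<in> carrier R" "q 0 \<in> carrier R" using add.hyps by (auto simp: mem_upD UP_carrier)
    have "p \<oplus>\<^bsub>UP R\<^esub> q = (cst R (p 0) \<oplus>\<^bsub>UP R\<^esub> indet R \<otimes>\<^bsub>UP R\<^esub> p') \<oplus>\<^bsub>UP R\<^esub> (cst R (q 0) \<oplus>\<^bsub>UP R\<^esub> indet R \<otimes>\<^bsub>UP R\<^esub> q')"
      by (rule arg_cong2[OF *(3,4)])
    also have "\<dots> = cst R (p 0 \<oplus>\<^bsub>R\<^esub> q 0) \<oplus>\<^bsub>UP R\<^esub> indet R \<otimes>\<^bsub>UP R\<^esub> (p' \<oplus>\<^bsub>UP R\<^esub> q')"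
      using *(1,2) c by (simp add: P.r_distr P.a_ac)
    finally have e: "p \<oplus>\<^bsub>UP R\<^esub> q = cst R (p 0 \<oplus>\<^bsub>R\<^esub> q 0) \<oplus>\<^bsub>UP R\<^esub> indet R \<otimes>\<^bsub>UP R\<^esub> (p' \<oplus>\<^bsub>UP R\<^esub> q')" .
    have "(p \<oplus>\<^bsub>UP R\<^esub> q) 0 = p 0 \<oplus>\<^bsub>R\<^esub> q 0" using add.hyps by (simp add: UP_add UP_carrier)
    with e have "p \<oplus>\<^bsub>UP R\<^esub> q = cst R ((p \<oplus>\<^bsub>UP R\<^esub> q) 0) \<oplus>\<^bsub>UP R\<^esub> indet R \<otimes>\<^bsub>UP R\<^esub> (p' \<oplus>\<^bsub>UP R\<^esub> q')"
      by (simp only:)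
    moreover have "p' \<oplus>\<^bsub>UP R\<^esub> q' \<in> carrier (UP R)" using *(1,2) by simp
    ultimately show ?case by (rule bexI)
  qed
qed

text \<open>At the degree of the last summand the coefficients of all others are zero, so nothing
  cancels there.\<close>

lemma deg_finsum_dominant:
  fixes m :: nat
  assumes "cring R" and s: "\<And>j. j \<le> m \<Longrightarrow> s j \<in> carrier (UP R)"
    and lt: "\<And>j. j < m \<Longrightarrow> deg R (s j) < deg R (s m)"
  shows "deg R (s m) \<le> deg R (\<Oplus>\<^bsub>UP R\<^esub> j\<in>{..m}. s j)"
proof (cases "deg R (s m) = 0")
  case False
  interpret UP_cring R "UP R" by (simp_all add: UP_cringI assms(1))
  let ?d = "deg R (s m)"
  have "up_ring.coeff (UP R) (\<Oplus>\<^bsub>UP R\<^esub> j\<in>{..m}. s j) ?d = (\<Oplus>\<^bsub>R\<^esub> j\<in>{..m}. up_ring.coeff (UP R) (s j) ?d)"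
    using s by (intro coeff_finsum) auto
  also have "\<dots> = (\<Oplus>\<^bsub>R\<^esub> j\<in>{..m}. if m = j then up_ring.coeff (UP R) (s j) ?d else \<zero>\<^bsub>R\<^esub>)"
    using s lt by (intro R.finsum_cong') (auto intro!: deg_aboveD)
  also have "\<dots> = up_ring.coeff (UP R) (s m) ?d"
    using s by (intro R.finsum_singleton) auto
  finally show ?thesis
    using s False lcoeff_nonzero_deg[of "s m"] by (intro deg_belowI) (auto intro!: P.finsum_closed)
qed simp

lemma deg_pow:
  assumes "domain R" "p \<in> carrier (UP R)" "p \<noteq> \<zero>\<^bsub>UP R\<^esub>"
  shows "deg R (p [^]\<^bsub>UP R\<^esub> j) = deg R p * (j :: nat)"
proof -
  interpret UP_domain R "UP R" by (simp_all add: UP_domain_def assms(1))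
  show ?thesis
  proof (induction j)
    case (Suc j)
    have "p [^]\<^bsub>UP R\<^esub> j \<noteq> \<zero>\<^bsub>UP R\<^esub>" using assms(2,3) by (induction j) (auto simp: integral_iff)
    then show ?case using Suc assms(2,3) deg_mult[of "p [^]\<^bsub>UP R\<^esub> j" p] by simp
  qed simp
qed

text \<open>Sums are defined through the carrier of their ring, so that passing to a subring changes them
  syntactically; by induction their values stay the same.\<close>

lemma finsum_carrier_update:
  assumes "ring R" "subring S R" "\<And>i. i \<in> I \<Longrightarrow> f i \<in> S"
  shows "finsum (R\<lparr>carrier := S\<rparr>) f I = finsum R f I"
proof -
  interpret R: ring R by fact
  interpret S: ring "R\<lparr>carrier := S\<rparr>" by (rule R.subring_is_ring[OF assms(2)])
  have sub: "S \<subseteq> carrier R" by (rule subringE(1)[OF assms(2)])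
  show ?thesis using assms(3)
  proof (induction I rule: infinite_finite_induct)
    case (infinite A)
    then show ?case by (simp add: finsum_def finprod_def)
  next
    case (insert x F)
    then have "f \<in> F \<rightarrow> carrier R" "f \<in> F \<rightarrow> S" "f x \<in> carrier R" using sub by auto
    with insert show ?case by (simp add: S.finsum_insert)
  qed simp
qed

lemma up_carrier_update:
  assumes "S \<subseteq> carrier R"
  shows "up (R\<lparr>carrier := S\<rparr>) = {p \<in> up R. range p \<subseteq> S}"
  using assms by (auto simp: up_def)

lemma UP_carrier_update:
  assumes "ring R" "subring S R"
  shows "\<And>p q. \<lbrakk>p \<in> up (R\<lparr>carrier := S\<rparr>); q \<in> up (R\<lparr>carrier := S\<rparr>)\<rbrakk> \<Longrightarrow>
      p \<oplus>\<^bsub>UP (R\<lparr>carrier := S\<rparr>)\<^esub> q = p \<oplus>\<^bsub>UP R\<^esub> q"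
    and "\<And>p q. \<lbrakk>p \<in> up (R\<lparr>carrier := S\<rparr>); q \<in> up (R\<lparr>carrier := S\<rparr>)\<rbrakk> \<Longrightarrow>
      p \<otimes>\<^bsub>UP (R\<lparr>carrier := S\<rparr>)\<^esub> q = p \<otimes>\<^bsub>UP R\<^esub> q"
    and "\<one>\<^bsub>UP (R\<lparr>carrier := S\<rparr>)\<^esub> = \<one>\<^bsub>UP R\<^esub>"
    and "\<And>a n. a \<in> S \<Longrightarrow> up_ring.monom (UP (R\<lparr>carrier := S\<rparr>)) a n = up_ring.monom (UP R) a n"
proof -
  have sub: "S \<subseteq> carrier R" by (rule subringE(1)[OF assms(2)])
  fix p q assume *: "p \<in> up (R\<lparr>carrier := S\<rparr>)" "q \<in> up (R\<lparr>carrier := S\<rparr>)"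
  then have **: "p \<in> up R" "q \<in> up R" "\<And>i. p i \<in> S" "\<And>i. q i \<in> S"
    using up_carrier_update[OF sub] by auto
  show "p \<oplus>\<^bsub>UP (R\<lparr>carrier := S\<rparr>)\<^esub> q = p \<oplus>\<^bsub>UP R\<^esub> q"
    using * ** by (simp add: UP_add)
  show "p \<otimes>\<^bsub>UP (R\<lparr>carrier := S\<rparr>)\<^esub> q = p \<otimes>\<^bsub>UP R\<^esub> q"
    using * ** subringE(6)[OF assms(2)] by (simp add: UP_mult finsum_carrier_update[OF assms])
next
  show "\<one>\<^bsub>UP (R\<lparr>carrier := S\<rparr>)\<^esub> = \<one>\<^bsub>UP R\<^esub>" by (simp add: UP_one cong: if_cong)
next
  fix a n assume "a \<in> S"
  moreover from this have "a \<in> carrier R" using subringE(1)[OF assms(2)] by blast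
  ultimately show "up_ring.monom (UP (R\<lparr>carrier := S\<rparr>)) a n = up_ring.monom (UP R) a n"
    by (simp add: UP_monom cong: if_cong)
qed

section \<open>Polynomial algebras\<close>

text \<open>The polynomials of \<^const>\<open>UP\<close> as a Poisson algebra over the base ring: the scalar
  multiplication of \<^const>\<open>UP\<close> is by coefficients.\<close>

definition upa :: "('k, 'a, 'x) poisson_alg_scheme \<Rightarrow> ('k, nat \<Rightarrow> 'a) poisson_alg" where
  "upa A = \<lparr>
     carrier = carrier (UP A),
     monoid.mult = monoid.mult (UP A),
     monoid.one = monoid.one (UP A),
     ring.zero = ring.zero (UP A),
     ring.add = ring.add (UP A),
     module.smult = (\<lambda>r p i. r \<odot>\<^bsub>A\<^esub> p i),
     bracket = (\<lambda>p q n. \<Oplus>\<^bsub>A\<^esub> i\<in>{..n}. bracket A (p i) (q (n - i)))\<rparr>"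

lemma upa_simps [simp]:
  "carrier (upa A) = up A" "monoid.mult (upa A) = monoid.mult (UP A)"
  "monoid.one (upa A) = monoid.one (UP A)" "ring.zero (upa A) = ring.zero (UP A)"
  "ring.add (upa A) = ring.add (UP A)"
  "r \<odot>\<^bsub>upa A\<^esub> p = (\<lambda>i. r \<odot>\<^bsub>A\<^esub> p i)"
  "bracket (upa A) p q = (\<lambda>n. \<Oplus>\<^bsub>A\<^esub> i\<in>{..n}. bracket A (p i) (q (n - i)))"
  by (simp_all add: upa_def UP_carrier)

lemma ring_iso_UP_upa: "id \<in> ring_iso (UP A) (upa A)"
  by (rule ring_iso_memI) (simp_all add: UP_carrier)

lemma cring_upa:
  assumes "cring A" shows "cring (upa A)"
proof -
  interpret UP_cring A "UP A" by (simp_all add: UP_cringI assms)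
  have "cring ((upa A)\<lparr>zero := id \<zero>\<^bsub>UP A\<^esub>\<rparr>)"
    by (rule P.ring_iso_imp_img_cring[OF ring_iso_UP_upa])
  then show ?thesis by (simp add: upa_def)
qed

lemma domain_upa:
  assumes "domain A" shows "domain (upa A)"
proof -
  interpret UP_domain A "UP A" by (simp_all add: UP_domain_def assms)
  have "domain ((upa A)\<lparr>zero := id \<zero>\<^bsub>UP A\<^esub>\<rparr>)"
    by (rule domain.ring_iso_imp_img_domain[OF UP_domain ring_iso_UP_upa])
  then show ?thesis by (simp add: upa_def)
qed

lemma up_smult_base_closed:
  assumes "algebra K A" "r \<in> carrier K" "p \<in> up A" shows "(\<lambda>i. r \<odot>\<^bsub>A\<^esub> p i) \<in> up A"
proof -
  interpret algebra K A by fact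
  show ?thesis using assms(2,3) by (fastforce simp: up_def bound_def)
qed

lemma algebra_upa:
  assumes "algebra K A" shows "algebra K (upa A)"
proof -
  interpret algebra K A by fact
  interpret U: cring "upa A" by (rule cring_upa[OF M_cring])
  note [simp] = up_smult_base_closed[OF assms] mem_upD
  show ?thesis
  proof (rule algebraI)
    fix a p q assume a: "a \<in> carrier K" and p: "p \<in> carrier (upa A)" and q: "q \<in> carrier (upa A)"
    show "a \<odot>\<^bsub>upa A\<^esub> (p \<oplus>\<^bsub>upa A\<^esub> q) = a \<odot>\<^bsub>upa A\<^esub> p \<oplus>\<^bsub>upa A\<^esub> a \<odot>\<^bsub>upa A\<^esub> q"
      using a p q by (simp add: UP_add smult_r_distr)
    have "a \<odot>\<^bsub>A\<^esub> (\<Oplus>\<^bsub>A\<^esub> i\<in>I. f i) = (\<Oplus>\<^bsub>A\<^esub> i\<in>I. a \<odot>\<^bsub>A\<^esub> f i)" if "f \<in> I \<rightarrow> carrier A" for f and I :: "nat set"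
      using that a by (induction I rule: infinite_finite_induct)
        (auto simp: smult_r_distr Pi_def)
    then show "(a \<odot>\<^bsub>upa A\<^esub> p) \<otimes>\<^bsub>upa A\<^esub> q = a \<odot>\<^bsub>upa A\<^esub> (p \<otimes>\<^bsub>upa A\<^esub> q)"
      using a p q by (simp add: UP_mult smult_assoc2)
  qed (simp_all add: R_cring U.cring_axioms UP_add smult_l_distr smult_assoc1)
qed

subsection \<open>Comparison with multiset-indexed polynomials\<close>

text \<open>In one variable \<open>t\<^sub>0\<close> the monomials are the multisets \<open>t\<^sub>0\<^sup>n\<close>, and \<open>n\<close> is the size.\<close>

definition mset_poly :: "('a, 'm) ring_scheme \<Rightarrow> (nat \<Rightarrow> 'a) \<Rightarrow> nat multiset \<Rightarrow> 'a" where
  "mset_poly A q M = (if set_mset M \<subseteq> {0} then q (size M) else \<zero>\<^bsub>A\<^esub>)"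

lemma mset_poly_replicate [simp]: "mset_poly A q (replicate_mset n 0) = q n"
  by (simp add: mset_poly_def)

lemma submsets_replicate: "{N. N \<subseteq># replicate_mset n x} = (\<lambda>i. replicate_mset i x) ` {..n}"
proof (intro equalityI subsetI)
  fix N assume N: "N \<in> {N. N \<subseteq># replicate_mset n x}"
  then have "set_mset N \<subseteq> {x}" by (auto dest!: set_mset_mono split: if_splits)
  then have "N = replicate_mset (size N) x" by (rule set_mset_subset_singletonD)
  moreover have "size N \<le> n" using N size_mset_mono by fastforce
  ultimately show "N \<in> (\<lambda>i. replicate_mset i x) ` {..n}" by (intro image_eqI) auto
qed (auto intro: replicate_mset_msubseteq_iff[THEN iffD2])

text \<open>A submultiset of \<open>t\<^sub>0\<^sup>n\<close> is \<open>t\<^sub>0\<^sup>i\<close> with \<open>i \<le> n\<close>; on any other monomial every summand of the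
  convolution has a factor zero. The product and the bracket are both instances.\<close>

lemma mset_poly_convolution:
  assumes "ring A" "p \<in> up A" "q \<in> up A"
    and cl: "\<And>a b. \<lbrakk>a \<in> carrier A; b \<in> carrier A\<rbrakk> \<Longrightarrow> f a b \<in> carrier A"
    and z: "\<And>a. a \<in> carrier A \<Longrightarrow> f \<zero>\<^bsub>A\<^esub> a = \<zero>\<^bsub>A\<^esub>" "\<And>a. a \<in> carrier A \<Longrightarrow> f a \<zero>\<^bsub>A\<^esub> = \<zero>\<^bsub>A\<^esub>"
  shows "(\<Oplus>\<^bsub>A\<^esub> N\<in>{N. N \<subseteq># M}. f (mset_poly A p N) (mset_poly A q (M - N)))
       = mset_poly A (\<lambda>n. \<Oplus>\<^bsub>A\<^esub> i\<in>{..n}. f (p i) (q (n - i))) M"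
proof -
  interpret ring A by fact
  have c: "mset_poly A p N \<in> carrier A" "mset_poly A q N \<in> carrier A" for N
    using assms(2,3) by (auto simp: mset_poly_def)
  show ?thesis
  proof (cases "set_mset M \<subseteq> {0}")
    case True
    obtain n where M: "M = replicate_mset n 0"
      using set_mset_subset_singletonD[OF True] by (rule that)
    have "inj_on (\<lambda>i. replicate_mset i (0::nat)) {..n}"
      by (rule inj_on_inverseI[where g = size]) simp
    then have "(\<Oplus>\<^bsub>A\<^esub> N\<in>{N. N \<subseteq># M}. f (mset_poly A p N) (mset_poly A q (M - N)))
      = (\<Oplus>\<^bsub>A\<^esub> i\<in>{..n}. f (mset_poly A p (replicate_mset i 0)) (mset_poly A q (M - replicate_mset i 0)))"
      unfolding M submsets_replicate using c cl by (subst finsum_reindex) auto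
    also have "\<dots> = (\<Oplus>\<^bsub>A\<^esub> i\<in>{..n}. f (p i) (q (n - i)))"
    proof (rule finsum_cong')
      fix i assume i: "i \<in> {..n}"
      then have "M = replicate_mset i 0 + replicate_mset (n - i) 0"
        by (simp add: M multiset_eq_iff)
      then show "f (mset_poly A p (replicate_mset i 0)) (mset_poly A q (M - replicate_mset i 0)) = f (p i) (q (n - i))"
        by simp
    qed (use assms(2,3) cl in \<open>auto simp: mem_upD\<close>)
    finally show ?thesis by (simp add: M)
  next
    case False
    have "f (mset_poly A p N) (mset_poly A q (M - N)) = \<zero>\<^bsub>A\<^esub>" if "N \<subseteq># M" for N
    proof -
      have "set_mset M = set_mset N \<union> set_mset (M - N)"
        using that by (metis set_mset_union subset_mset.add_diff_inverse)
      with False have "\<not> set_mset N \<subseteq> {0} \<or> \<not> set_mset (M - N) \<subseteq> {0}" by auto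
      then have "mset_poly A p N = \<zero>\<^bsub>A\<^esub> \<or> mset_poly A q (M - N) = \<zero>\<^bsub>A\<^esub>"
        unfolding mset_poly_def by presburger
      then show ?thesis using z(1)[OF c(2)] z(2)[OF c(1)] by metis
    qed
    then have "(\<Oplus>\<^bsub>A\<^esub> N\<in>{N. N \<subseteq># M}. f (mset_poly A p N) (mset_poly A q (M - N))) = \<zero>\<^bsub>A\<^esub>"
      by (intro add.finprod_one_eqI) auto
    then show ?thesis using False by (simp add: mset_poly_def)
  qed
qed

lemma mset_poly_bij:
  "bij_betw (mset_poly A) (up A) (mpoly_carrier A 1)"
proof (rule bij_betw_imageI)
  show "inj_on (mset_poly A) (up A)"
  proof (rule inj_onI)
    fix p q assume "mset_poly A p = mset_poly A q"
    then have "mset_poly A p (replicate_mset n 0) = mset_poly A q (replicate_mset n 0)" for n by simp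
    then show "p = q" by (simp add: fun_eq_iff)
  qed
  show "mset_poly A ` up A = mpoly_carrier A 1"
  proof (intro equalityI subsetI)
    fix P assume "P \<in> mset_poly A ` up A"
    then obtain q where q: "q \<in> up A" "P = mset_poly A q" by blast
    then obtain n where n: "\<And>m. m > n \<Longrightarrow> q m = \<zero>\<^bsub>A\<^esub>" by (auto simp: up_def bound_def)
    have "{M. P M \<noteq> \<zero>\<^bsub>A\<^esub>} \<subseteq> (\<lambda>i. replicate_mset i 0) ` {..n}"
    proof
      fix M assume "M \<in> {M. P M \<noteq> \<zero>\<^bsub>A\<^esub>}"
      then have *: "set_mset M \<subseteq> {0}" "q (size M) \<noteq> \<zero>\<^bsub>A\<^esub>" by (auto simp: q mset_poly_def split: if_splits)
      then have "size M \<le> n" using n by (meson not_le)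
      then show "M \<in> (\<lambda>i. replicate_mset i 0) ` {..n}"
        using set_mset_subset_singletonD[OF *(1)] by (intro image_eqI[where x = "size M"]) auto
    qed
    then have "finite {M. P M \<noteq> \<zero>\<^bsub>A\<^esub>}" by (rule finite_subset) simp
    moreover have "\<zero>\<^bsub>A\<^esub> \<in> carrier A" using n[of "Suc n"] q(1) by (metis lessI mem_upD)
    ultimately show "P \<in> mpoly_carrier A 1"
      using q by (auto simp: mpoly_carrier_def mset_poly_def mem_upD split: if_splits)
  next
    fix P assume P: "P \<in> mpoly_carrier A 1"
    define q where "q n = P (replicate_mset n 0)" for n
    have "finite (size ` {M. P M \<noteq> \<zero>\<^bsub>A\<^esub>})" using P by (simp add: mpoly_carrier_def)
    then obtain n where n: "\<And>M. P M \<noteq> \<zero>\<^bsub>A\<^esub> \<Longrightarrow> size M \<le> n"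
      by (auto simp: finite_nat_set_iff_bounded_le)
    have "bound \<zero>\<^bsub>A\<^esub> n q"
    proof
      fix m assume "n < m"
      then show "q m = \<zero>\<^bsub>A\<^esub>" using n[of "replicate_mset m 0"] by (auto simp: q_def)
    qed
    then have "q \<in> up A" using P by (auto simp: up_def q_def mpoly_carrier_def)
    moreover have "P = mset_poly A q"
    proof
      fix M show "P M = mset_poly A q M"
      proof (cases "set_mset M \<subseteq> {0}")
        case True
        then have "mset_poly A q M = P (replicate_mset (size M) 0)" by (simp add: mset_poly_def q_def)
        then show ?thesis unfolding set_mset_subset_singletonD[OF True, symmetric] by (rule sym)
      next
        case False
        then have "\<not> set_mset M \<subseteq> {..<1}" by auto
        with P have "P M = \<zero>\<^bsub>A\<^esub>" unfolding mpoly_carrier_def by blast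
        with False show ?thesis by (simp add: mset_poly_def)
      qed
    qed
    ultimately show "P \<in> mset_poly A ` up A" by blast
  qed
qed

lemma (in poisson_algebra) bracket_zero [simp]:
  assumes "a \<in> carrier A"
  shows "bracket A \<zero>\<^bsub>A\<^esub> a = \<zero>\<^bsub>A\<^esub>" and "bracket A a \<zero>\<^bsub>A\<^esub> = \<zero>\<^bsub>A\<^esub>"
  using bracket_smult_left[of "\<zero>" a a] bracket_smult_right[of "\<zero>" a a] assms bracket_closed[of a a] by auto

lemma mset_poly_zero: "mset_poly A (\<lambda>i. \<zero>\<^bsub>A\<^esub>) = (\<lambda>M. \<zero>\<^bsub>A\<^esub>)"
  by (auto simp: mset_poly_def)

lemma mset_poly_iso:
  assumes "poisson_algebra K A"
  shows "mset_poly A \<in> poisson_iso K (upa A) (poly_ext A 1)"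
proof -
  interpret poisson_algebra K A by fact
  have r: "ring A" using M_cring by (simp add: cring_def)
  have "mset_poly A \<in> ring_iso (upa A) (poly_ext A 1)"
  proof (rule ring_iso_memI)
    fix p q assume pq: "p \<in> carrier (upa A)" "q \<in> carrier (upa A)"
    then show "mset_poly A (p \<otimes>\<^bsub>upa A\<^esub> q) = mset_poly A p \<otimes>\<^bsub>poly_ext A 1\<^esub> mset_poly A q"
      using mset_poly_convolution[OF r, of p q "monoid.mult A"]
      by (simp add: poly_ext_def UP_mult fun_eq_iff)
    show "mset_poly A (p \<oplus>\<^bsub>upa A\<^esub> q) = mset_poly A p \<oplus>\<^bsub>poly_ext A 1\<^esub> mset_poly A q"
      using pq by (auto simp: poly_ext_def UP_add mset_poly_def)
  next
    show "mset_poly A \<one>\<^bsub>upa A\<^esub> = \<one>\<^bsub>poly_ext A 1\<^esub>"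
      by (auto simp: poly_ext_def UP_one mset_poly_def)
  qed (use mset_poly_bij[of A] in \<open>auto simp: poly_ext_def bij_betw_def\<close>)
  moreover have "mset_poly A (bracket (upa A) p q) = bracket (poly_ext A 1) (mset_poly A p) (mset_poly A q)"
    if "p \<in> carrier (upa A)" "q \<in> carrier (upa A)" for p q
    using that mset_poly_convolution[OF r, of p q "bracket A"]
    by (simp add: poly_ext_def fun_eq_iff bracket_closed)
  moreover have "mset_poly A (r \<odot>\<^bsub>upa A\<^esub> p) = r \<odot>\<^bsub>poly_ext A 1\<^esub> mset_poly A p"
    if "r \<in> carrier K" for r p
    using that by (simp add: poly_ext_def mset_poly_def fun_eq_iff)
  ultimately show ?thesis by (simp add: poisson_iso_def)
qed

section \<open>Discriminant ideals under isomorphisms\<close>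

text \<open>Carrying both directions of an isomorphism makes its hypotheses symmetric, so that every
  inclusion between images proved below also yields the opposite one.\<close>

locale ring_iso_pair = R: ring R + S: ring S
  for R :: "('a, 'm) ring_scheme" (structure) and S :: "('b, 'n) ring_scheme" (structure) +
  fixes h :: "'a \<Rightarrow> 'b" and g :: "'b \<Rightarrow> 'a"
  assumes h_hom: "h \<in> ring_hom R S" and g_hom: "g \<in> ring_hom S R"
    and gh: "\<And>x. x \<in> carrier R \<Longrightarrow> g (h x) = x"
    and hg: "\<And>y. y \<in> carrier S \<Longrightarrow> h (g y) = y"
begin

lemma h_closed: "x \<in> carrier R \<Longrightarrow> h x \<in> carrier S" and g_closed: "y \<in> carrier S \<Longrightarrow> g y \<in> carrier R"
  using h_hom g_hom by (auto simp: ring_hom_def)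

lemma swap: "ring_iso_pair S R g h"
  by unfold_locales (simp_all add: h_hom g_hom gh hg)

lemma image_eq_vimage:
  assumes "I \<subseteq> carrier R" shows "h ` I = {y \<in> carrier S. g y \<in> I}"
proof (intro equalityI subsetI)
  fix y assume "y \<in> {y \<in> carrier S. g y \<in> I}"
  then show "y \<in> h ` I" by (intro image_eqI[of _ _ "g y"]) (auto simp: hg)
qed (use assms in \<open>auto simp: h_closed gh subset_iff\<close>)

lemma ideal_image:
  assumes "ideal I R" shows "ideal (h ` I) S"
proof -
  interpret ring_hom_ring S R g
    by (intro ring_hom_ringI2 S.ring_axioms R.ring_axioms g_hom)
  have "I \<subseteq> carrier R" by (rule additive_subgroup.a_subset[OF ideal.axioms(1)[OF assms]])
  then show ?thesis using ideal_vimage[OF assms] by (simp add: image_eq_vimage)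
qed

lemma image_image_g: "J \<subseteq> carrier S \<Longrightarrow> h ` g ` J = J"
  by (auto simp: image_image hg subset_iff cong: image_cong_simp)

lemma image_image_h: "I \<subseteq> carrier R \<Longrightarrow> g ` h ` I = I"
  by (auto simp: image_image gh subset_iff cong: image_cong_simp)

lemma image_h_carrier: "h ` carrier R = carrier S"
  by (auto simp: image_eq_vimage g_closed)

lemma maximalideal_image:
  assumes "maximalideal m R" shows "maximalideal (h ` m) S"
proof -
  interpret swap: ring_iso_pair S R g h by (rule swap)
  interpret maximalideal m R by fact
  show ?thesis
  proof (rule maximalidealI)
    show "ideal (h ` m) S" by (rule ideal_image[OF is_ideal])
    show "carrier S \<noteq> h ` m"
      using I_notcarr a_subset by (metis image_image_h swap.image_h_carrier)
    fix J assume J: "ideal J S" "h ` m \<subseteq> J" "J \<subseteq> carrier S"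
    have "m \<subseteq> g ` J" using J(2) image_image_h[OF a_subset] by (metis image_mono)
    moreover have "g ` J \<subseteq> carrier R" using J(3) g_closed by blast
    ultimately have "g ` J = m \<or> g ` J = carrier R"
      using I_maximal[OF swap.ideal_image[OF J(1)]] by blast
    then show "J = h ` m \<or> J = carrier S"
      using image_image_g[OF J(3)] image_h_carrier by metis
  qed
qed

lemma genideal_image_subset:
  assumes "V \<subseteq> carrier R" shows "h ` (Idl\<^bsub>R\<^esub> V) \<subseteq> Idl\<^bsub>S\<^esub> (h ` V)"
proof -
  interpret swap: ring_iso_pair S R g h by (rule swap)
  have "h ` (Idl\<^bsub>R\<^esub> V) \<subseteq> J" if J: "ideal J S" "h ` V \<subseteq> J" for J
  proof -
    have Jc: "J \<subseteq> carrier S" by (rule additive_subgroup.a_subset[OF ideal.axioms(1)[OF J(1)]])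
    have "V \<subseteq> g ` J" using J(2) image_image_h[OF assms] by (metis image_mono)
    then have "Idl\<^bsub>R\<^esub> V \<subseteq> g ` J" using swap.ideal_image[OF J(1)] by (auto simp: genideal_def)
    then show ?thesis using image_image_g[OF Jc] by (metis image_mono)
  qed
  then show ?thesis unfolding genideal_def[of S] by blast
qed

lemma genideal_image:
  assumes "V \<subseteq> carrier R" shows "h ` (Idl\<^bsub>R\<^esub> V) = Idl\<^bsub>S\<^esub> (h ` V)"
proof
  interpret swap: ring_iso_pair S R g h by (rule swap)
  have hX: "h ` V \<subseteq> carrier S" using assms h_closed by blast
  have "g ` (Idl\<^bsub>S\<^esub> (h ` V)) \<subseteq> Idl\<^bsub>R\<^esub> V"
    using swap.genideal_image_subset[OF hX] image_image_h[OF assms] by simp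
  moreover have "Idl\<^bsub>S\<^esub> (h ` V) \<subseteq> carrier S"
    using S.oneideal hX by (auto simp: genideal_def)
  ultimately show "Idl\<^bsub>S\<^esub> (h ` V) \<subseteq> h ` (Idl\<^bsub>R\<^esub> V)"
    using image_image_g by (metis image_mono)
qed (rule genideal_image_subset[OF assms])

end

locale poisson_iso_pair = ring_iso_pair R S h g
  for K :: "('k, 'm) ring_scheme"
    and R :: "('k, 'a, 'x) poisson_alg_scheme" (structure)
    and S :: "('k, 'b, 'y) poisson_alg_scheme" (structure)
    and h g +
  assumes h_iso: "h \<in> poisson_iso K R S" and g_iso: "g \<in> poisson_iso K S R"
    and smult_closed_R: "\<And>r a. \<lbrakk>r \<in> carrier K; a \<in> carrier R\<rbrakk> \<Longrightarrow> r \<odot>\<^bsub>R\<^esub> a \<in> carrier R"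
    and smult_closed_S: "\<And>r a. \<lbrakk>r \<in> carrier K; a \<in> carrier S\<rbrakk> \<Longrightarrow> r \<odot>\<^bsub>S\<^esub> a \<in> carrier S"
    and bracket_closed_R: "\<And>a b. \<lbrakk>a \<in> carrier R; b \<in> carrier R\<rbrakk> \<Longrightarrow> bracket R a b \<in> carrier R"
    and bracket_closed_S: "\<And>a b. \<lbrakk>a \<in> carrier S; b \<in> carrier S\<rbrakk> \<Longrightarrow> bracket S a b \<in> carrier S"

lemma poisson_iso_pairI:
  assumes h: "h \<in> poisson_iso K R S" and R: "ring R" and h0: "h \<zero>\<^bsub>R\<^esub> = \<zero>\<^bsub>S\<^esub>"
    and sm: "\<And>r a. \<lbrakk>r \<in> carrier K; a \<in> carrier R\<rbrakk> \<Longrightarrow> r \<odot>\<^bsub>R\<^esub> a \<in> carrier R"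
    and br: "\<And>a b. \<lbrakk>a \<in> carrier R; b \<in> carrier R\<rbrakk> \<Longrightarrow> bracket R a b \<in> carrier R"
  shows "poisson_iso_pair K R S h (inv_into (carrier R) h)"
proof -
  note D = poisson_isoD[OF h]
  have g: "inv_into (carrier R) h \<in> poisson_iso K S R" by (rule poisson_iso_sym[OF h R sm br])
  interpret R: ring R by fact
  have "ring (S\<lparr>zero := h \<zero>\<^bsub>R\<^esub>\<rparr>)" by (rule R.ring_iso_imp_img_ring[OF D(1)])
  then interpret S: ring S by (simp add: h0)
  have sur: "\<exists>x\<in>carrier R. y = h x" if "y \<in> carrier S" for y using that D(5) by auto
  show ?thesis
  proof
    fix r a assume "r \<in> carrier K" "a \<in> carrier S"
    then show "r \<odot>\<^bsub>S\<^esub> a \<in> carrier S" using sur[of a] D(10) D(7)[OF sm] by metis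
  next
    fix a b assume "a \<in> carrier S" "b \<in> carrier S"
    then show "bracket S a b \<in> carrier S" using sur[of a] sur[of b] D(11) D(7)[OF br] by metis
  next
    show "inv_into (carrier R) h (h x) = x" if "x \<in> carrier R" for x using D(4) that by simp
    show "h (inv_into (carrier R) h y) = y" if "y \<in> carrier S" for y
      using D(5) that by (metis f_inv_into_f)
  qed (use h g sm br poisson_isoD(2) in auto)
qed

context poisson_iso_pair
begin

lemma swap_poisson: "poisson_iso_pair K S R g h"
  by (intro poisson_iso_pair.intro poisson_iso_pair_axioms.intro swap)
    (simp_all add: h_iso g_iso smult_closed_R smult_closed_S bracket_closed_R bracket_closed_S)

lemma h_zero: "h \<zero>\<^bsub>R\<^esub> = \<zero>\<^bsub>S\<^esub>"
  by (rule ring_hom_zero[OF h_hom R.ring_axioms S.ring_axioms])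

lemma center_closed:
  assumes "z \<in> poisson_center R" shows "h z \<in> poisson_center S"
proof -
  have "bracket S (h z) y = \<zero>\<^bsub>S\<^esub>" if "y \<in> carrier S" for y
    using poisson_isoD(11)[OF h_iso, of z "g y"] assms that g_closed[OF that] hg[OF that] h_zero
    by (simp add: poisson_center_def)
  then show ?thesis using assms h_closed by (simp add: poisson_center_def)
qed

lemma ring_iso_pair_center:
  assumes "ring (center_alg R)" shows "ring_iso_pair (center_alg R) (center_alg S) h g"
proof -
  interpret swap: poisson_iso_pair K S R g h by (rule swap_poisson)
  have sub: "poisson_center R \<subseteq> carrier R" "poisson_center S \<subseteq> carrier S"
    by (auto simp: poisson_center_def)
  have hh: "h \<in> ring_hom (center_alg R) (center_alg S)"
    using sub poisson_isoD(6,8,9)[OF h_iso] center_closed by (intro ring_hom_memI) (auto simp: subset_iff)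
  have gg: "g \<in> ring_hom (center_alg S) (center_alg R)"
    using sub poisson_isoD(6,8,9)[OF g_iso] swap.center_closed by (intro ring_hom_memI) (auto simp: subset_iff)
  have im: "h ` poisson_center R = poisson_center S"
  proof (intro equalityI subsetI)
    fix y assume "y \<in> poisson_center S"
    then show "y \<in> h ` poisson_center R"
      using sub swap.center_closed by (intro image_eqI[of _ _ "g y"]) (auto simp: hg)
  qed (use center_closed in auto)
  have "ring ((center_alg S)\<lparr>carrier := h ` carrier (center_alg R), zero := h \<zero>\<^bsub>center_alg R\<^esub>\<rparr>)"
    by (rule ring.ring_hom_imp_img_ring[OF assms hh])
  then have "ring (center_alg S)" by (simp add: im h_zero)
  with assms show ?thesis
    using sub hh gg gh hg by (auto intro!: ring_iso_pair.intro ring_iso_pair_axioms.intro)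
qed

lemma coset_image:
  assumes "I \<subseteq> carrier R" "a \<in> carrier R"
  shows "h ` (I +>\<^bsub>R\<^esub> a) = h ` I +>\<^bsub>S\<^esub> h a"
proof -
  have "h ` (I +>\<^bsub>R\<^esub> a) = (\<Union>x\<in>I. {h (x \<oplus>\<^bsub>R\<^esub> a)})" unfolding a_r_coset_def' by blast
  also have "\<dots> = (\<Union>x\<in>I. {h x \<oplus>\<^bsub>S\<^esub> h a})"
    using assms by (intro SUP_cong) (auto simp: poisson_isoD(8)[OF h_iso])
  also have "\<dots> = h ` I +>\<^bsub>S\<^esub> h a" unfolding a_r_coset_def' by blast
  finally show ?thesis .
qed

text \<open>The operations of the quotient are unions over representatives, which \<open>h\<close> maps to each
  other.\<close>

lemma poisson_quot_iso:
  assumes I: "I \<subseteq> carrier R"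
  shows "poisson_isomorphic K (poisson_quot R I) (poisson_quot S (h ` I))"
proof -
  note D = poisson_isoD[OF h_iso]
  have sub: "U \<subseteq> carrier R" if "U \<in> a_rcosets\<^bsub>R\<^esub> I" for U
    using that I by (auto simp: A_RCOSETS_def' a_r_coset_def')
  have UN2: "h ` (\<Union>a\<in>U. \<Union>b\<in>V. F a b) = (\<Union>a\<in>h ` U. \<Union>b\<in>h ` V. G a b)"
    if "\<And>a b. \<lbrakk>a \<in> U; b \<in> V\<rbrakk> \<Longrightarrow> h ` F a b = G (h a) (h b)" for U V F G
    using that by (simp add: image_UN)
  have UN1: "h ` (\<Union>a\<in>U. F a) = (\<Union>a\<in>h ` U. G a)"
    if "\<And>a. a \<in> U \<Longrightarrow> h ` F a = G (h a)" for U F G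
    using that by (simp add: image_UN)
  have car: "(`) h ` (a_rcosets\<^bsub>R\<^esub> I) = a_rcosets\<^bsub>S\<^esub> (h ` I)"
  proof -
    have "(`) h ` (a_rcosets\<^bsub>R\<^esub> I) = (\<lambda>a. h ` I +>\<^bsub>S\<^esub> h a) ` carrier R"
    proof -
      have "a_rcosets\<^bsub>R\<^esub> I = (\<lambda>a. I +>\<^bsub>R\<^esub> a) ` carrier R" by (auto simp: A_RCOSETS_def')
      then show ?thesis using coset_image[OF I] by (simp add: image_image)
    qed
    also have "\<dots> = (\<lambda>b. h ` I +>\<^bsub>S\<^esub> b) ` h ` carrier R" by (simp add: image_image)
    finally show ?thesis by (auto simp: A_RCOSETS_def' image_h_carrier)
  qed
  have "(`) h \<in> poisson_iso K (poisson_quot R I) (poisson_quot S (h ` I))"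
    unfolding poisson_iso_def
  proof (intro CollectI conjI ballI ring_iso_memI)
    fix U assume "U \<in> carrier (poisson_quot R I)"
    then have U: "U \<in> a_rcosets\<^bsub>R\<^esub> I" by (simp add: poisson_quot_def FactRing_def)
    then show "h ` U \<in> carrier (poisson_quot S (h ` I))"
      using car by (auto simp: poisson_quot_def FactRing_def)
    show "h ` (r \<odot>\<^bsub>poisson_quot R I\<^esub> U) = r \<odot>\<^bsub>poisson_quot S (h ` I)\<^esub> h ` U" if "r \<in> carrier K" for r
      unfolding poisson_quot_def module.simps
      by (rule UN1) (use that sub[OF U] in \<open>auto simp: coset_image[OF I] smult_closed_R D(10) subset_iff\<close>)
    fix V assume "V \<in> carrier (poisson_quot R I)"
    then have V: "V \<in> a_rcosets\<^bsub>R\<^esub> I" by (simp add: poisson_quot_def FactRing_def)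
    note s = sub[OF U] sub[OF V]
    show "h ` (U \<otimes>\<^bsub>poisson_quot R I\<^esub> V) = h ` U \<otimes>\<^bsub>poisson_quot S (h ` I)\<^esub> h ` V"
      unfolding poisson_quot_def FactRing_def monoid.simps rcoset_mult_def
      by (rule UN2) (use s in \<open>auto simp: coset_image[OF I] D(9) subset_iff\<close>)
    show "h ` (U \<oplus>\<^bsub>poisson_quot R I\<^esub> V) = h ` U \<oplus>\<^bsub>poisson_quot S (h ` I)\<^esub> h ` V"
      unfolding poisson_quot_def FactRing_def ring.simps set_add_def'
      by (rule UN2) (use s in \<open>auto simp: D(8) subset_iff\<close>)
    show "h ` bracket (poisson_quot R I) U V = bracket (poisson_quot S (h ` I)) (h ` U) (h ` V)"
      unfolding poisson_quot_def poisson_alg.simps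
      by (rule UN2) (use s in \<open>auto simp: coset_image[OF I] bracket_closed_R D(11) subset_iff\<close>)
  next
    show "h ` \<one>\<^bsub>poisson_quot R I\<^esub> = \<one>\<^bsub>poisson_quot S (h ` I)\<^esub>"
      by (simp add: poisson_quot_def FactRing_def coset_image[OF I] D(6))
  next
    have "inj_on ((`) h) (a_rcosets\<^bsub>R\<^esub> I)"
      by (rule inj_on_subset[OF inj_on_image_Pow[OF D(4)]]) (use sub in auto)
    then show "bij_betw ((`) h) (carrier (poisson_quot R I)) (carrier (poisson_quot S (h ` I)))"
      using car by (simp add: poisson_quot_def FactRing_def bij_betw_def)
  qed
  then show ?thesis by (auto simp: poisson_isomorphic_def)
qed

text \<open>The map \<open>h\<close> carries maximal ideals of the centers to each other, together with the ideals
  that they generate and the quotients by these. A property of \<open>S/h(m)S\<close> therefore passes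
  back to \<open>R/mR\<close>.\<close>

lemma D_locus_image:
  assumes m: "m \<in> D_locus K P R" shows "h ` m \<in> D_locus K P S"
proof -
  interpret swap: poisson_iso_pair K S R g h by (rule swap_poisson)
  have max: "maximalideal m (center_alg R)" and no: "\<not> has_property K P (poisson_quot R (Idl\<^bsub>R\<^esub> m))"
    using m by (auto simp: D_locus_def L_locus_def max_spec_def)
  interpret m: maximalideal m "center_alg R" by fact
  interpret C: ring_iso_pair "center_alg R" "center_alg S" h g
    by (rule ring_iso_pair_center[OF m.ring_axioms])
  have mR: "m \<subseteq> carrier R" using m.a_subset by (auto simp: poisson_center_def)
  have hm: "h ` m \<subseteq> carrier S" using mR h_closed by blast
  have "Idl\<^bsub>S\<^esub> (h ` m) \<subseteq> carrier S"
    using S.oneideal hm by (auto simp: genideal_def)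
  then have "poisson_isomorphic K (poisson_quot S (Idl\<^bsub>S\<^esub> (h ` m))) (poisson_quot R (g ` (Idl\<^bsub>S\<^esub> (h ` m))))"
    by (rule swap.poisson_quot_iso)
  also have "g ` (Idl\<^bsub>S\<^esub> (h ` m)) = Idl\<^bsub>R\<^esub> m"
    using swap.genideal_image[OF hm] image_image_h[OF mR] by simp
  finally have "\<not> has_property K P (poisson_quot S (Idl\<^bsub>S\<^esub> (h ` m)))"
    using no poisson_isomorphic_trans unfolding has_property_def by blast
  moreover have "maximalideal (h ` m) (center_alg S)" by (rule C.maximalideal_image[OF max])
  ultimately show ?thesis by (simp add: D_locus_def L_locus_def max_spec_def)
qed

lemma disc_ideal_g:
  assumes z: "z \<in> disc_ideal K P S" shows "g z \<in> disc_ideal K P R"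
proof -
  interpret swap: poisson_iso_pair K S R g h by (rule swap_poisson)
  have "g z \<in> m" if "m \<in> D_locus K P R" for m
  proof -
    have "maximalideal m (center_alg R)" using that by (auto simp: D_locus_def max_spec_def)
    then have "m \<subseteq> carrier (center_alg R)"
      using additive_subgroup.a_subset ideal.axioms(1) maximalideal.axioms(1) by blast
    then have "m \<subseteq> carrier R" by (auto simp: poisson_center_def)
    moreover have "z \<in> h ` m" using z D_locus_image[OF that] by (auto simp: disc_ideal_def)
    ultimately show ?thesis using gh by auto
  qed
  with z show ?thesis using swap.center_closed by (auto simp: disc_ideal_def)
qed

end

lemma (in poisson_iso_pair) disc_ideal_h_iff:
  assumes "z \<in> carrier R"
  shows "h z \<in> disc_ideal K P S \<longleftrightarrow> z \<in> disc_ideal K P R"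
proof -
  interpret swap: poisson_iso_pair K S R g h by (rule swap_poisson)
  show ?thesis using disc_ideal_g[of "h z"] swap.disc_ideal_g[of z] gh[OF assms] by auto
qed

section \<open>The Poisson center of a polynomial algebra\<close>

context poisson_algebra
begin

lemma bracket_anti:
  assumes "a \<in> carrier A" "b \<in> carrier A" shows "bracket A a b = \<ominus>\<^bsub>A\<^esub> bracket A b a"
proof -
  have "bracket A (a \<oplus>\<^bsub>A\<^esub> b) (a \<oplus>\<^bsub>A\<^esub> b) = bracket A a b \<oplus>\<^bsub>A\<^esub> bracket A b a"
    using assms bracket_closed[of b a] bracket_closed[of a b] bracket_add_left[of a b "a \<oplus>\<^bsub>A\<^esub> b"]
      bracket_add_right[of a a b] bracket_add_right[of b a b]
    by (simp add: bracket_alternating[of a] bracket_alternating[of b])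
  then have "bracket A a b \<oplus>\<^bsub>A\<^esub> bracket A b a = \<zero>\<^bsub>A\<^esub>"
    using bracket_alternating[of "a \<oplus>\<^bsub>A\<^esub> b"] assms by simp
  then show ?thesis using assms by (simp add: M.minus_equality bracket_closed)
qed

lemma bracket_swap_zero:
  assumes "a \<in> carrier A" "b \<in> carrier A" "bracket A a b = \<zero>\<^bsub>A\<^esub>"
  shows "bracket A b a = \<zero>\<^bsub>A\<^esub>"
  using bracket_anti[of b a] assms by simp

lemma poisson_center_iff:
  "z \<in> poisson_center A \<longleftrightarrow> z \<in> carrier A \<and> (\<forall>a\<in>carrier A. bracket A a z = \<zero>\<^bsub>A\<^esub>)"
  using bracket_swap_zero by (auto simp: poisson_center_def)

lemma poisson_center_smult:
  assumes "r \<in> carrier K" "z \<in> poisson_center A" shows "r \<odot>\<^bsub>A\<^esub> z \<in> poisson_center A"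
  using assms by (simp add: poisson_center_def bracket_smult_left)

lemma poisson_center_subring: "subring (poisson_center A) A"
proof -
  have one: "bracket A a \<one>\<^bsub>A\<^esub> = \<zero>\<^bsub>A\<^esub>" if "a \<in> carrier A" for a
    using bracket_leibniz[OF that one_closed one_closed] bracket_closed[OF that one_closed] that
    by simp
  show ?thesis
  proof (rule subringI)
  show "\<one>\<^bsub>A\<^esub> \<in> poisson_center A" using one by (simp add: poisson_center_iff)
  fix z w assume z: "z \<in> poisson_center A" and w: "w \<in> poisson_center A"
  show "\<ominus>\<^bsub>A\<^esub> z \<in> poisson_center A"
    using poisson_center_smult[OF _ z, of "\<ominus> \<one>"] z by (simp add: smult_l_minus poisson_center_def)
  show "z \<oplus>\<^bsub>A\<^esub> w \<in> poisson_center A"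
    using z w by (simp add: poisson_center_def bracket_add_left)
  show "z \<otimes>\<^bsub>A\<^esub> w \<in> poisson_center A"
    using z w by (simp add: poisson_center_iff bracket_leibniz)
  qed (auto simp: poisson_center_def)
qed

lemma poisson_center_subset: "poisson_center A \<subseteq> carrier A"
  by (auto simp: poisson_center_def)

lemma algebra_center: "algebra K (center_alg A)"
proof -
  have "cring (center_alg A)"
    by (rule subcring_iff[OF poisson_center_subset, THEN iffD1])
      (rule subcringI'[OF poisson_center_subring])
  then show ?thesis
    using poisson_center_subset
    by (intro algebraI) (auto simp: R_cring poisson_center_smult smult_l_distr smult_r_distr smult_assoc1 smult_assoc2 subset_iff)
qed

lemma up_center: "up (center_alg A) = {p \<in> up A. range p \<subseteq> poisson_center A}"
  by (rule up_carrier_update[OF poisson_center_subset])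

text \<open>The variable is central, and the bracket with a constant acts coefficientwise.\<close>

lemma poisson_center_upa: "poisson_center (upa A) = up (center_alg A)"
proof (intro equalityI subsetI)
  fix p assume p: "p \<in> poisson_center (upa A)"
  then have pc: "p \<in> up A" by (simp add: poisson_center_def)
  have "p n \<in> poisson_center A" for n
  proof -
    have "bracket A (p n) a = \<zero>\<^bsub>A\<^esub>" if a: "a \<in> carrier A" for a
    proof -
      interpret UP_cring A "UP A" by (simp_all add: UP_cringI M_cring)
      have "cst A a \<in> up A" using a UP_carrier monom_closed by metis
      then have "(\<Oplus>\<^bsub>A\<^esub> i\<in>{..n}. bracket A (p i) (cst A a (n - i))) = \<zero>\<^bsub>A\<^esub>"
        using p by (simp add: poisson_center_def UP_zero fun_eq_iff)
      moreover have "(\<Oplus>\<^bsub>A\<^esub> i\<in>{..n}. bracket A (p i) (cst A a (n - i)))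
        = (\<Oplus>\<^bsub>A\<^esub> i\<in>{..n}. if n = i then bracket A (p i) a else \<zero>\<^bsub>A\<^esub>)"
        using pc a by (intro M.finsum_cong') (auto simp: UP_monom mem_upD bracket_closed)
      moreover have "\<dots> = bracket A (p n) a"
        using pc a by (intro M.finsum_singleton) (auto simp: mem_upD bracket_closed)
      ultimately show ?thesis by simp
    qed
    then show ?thesis using pc by (simp add: poisson_center_def mem_upD)
  qed
  then show "p \<in> up (center_alg A)" using pc by (auto simp: up_center)
next
  fix p assume p: "p \<in> up (center_alg A)"
  then have "bracket A (p i) a = \<zero>\<^bsub>A\<^esub>" if "a \<in> carrier A" for i a
    using that p by (auto simp: up_center) (auto simp: poisson_center_def)
  then have "bracket (upa A) p q = \<zero>\<^bsub>upa A\<^esub>" if "q \<in> up A" for q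
    using that by (simp add: UP_zero mem_upD)
  moreover have "p \<in> up A" using p by (simp add: up_center)
  ultimately show "p \<in> poisson_center (upa A)" by (simp add: poisson_center_def)
qed

lemma bracket_upa_closed:
  assumes p: "p \<in> up A" and q: "q \<in> up A" shows "bracket (upa A) p q \<in> up A"
proof -
  obtain n where n: "\<And>i. i > n \<Longrightarrow> p i = \<zero>\<^bsub>A\<^esub>" using p by (auto simp: up_def bound_def)
  obtain m where m: "\<And>i. i > m \<Longrightarrow> q i = \<zero>\<^bsub>A\<^esub>" using q by (auto simp: up_def bound_def)
  have "bracket (upa A) p q k = \<zero>\<^bsub>A\<^esub>" if "k > n + m" for k
  proof -
    have "bracket A (p i) (q (k - i)) = \<zero>\<^bsub>A\<^esub>" for i
    proof (cases "i > n")
      case False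
      with that have "k - i > m" by linarith
      with p show ?thesis by (simp add: m mem_upD)
    qed (use q in \<open>simp add: n mem_upD\<close>)
    then show ?thesis by simp
  qed
  then have "bound \<zero>\<^bsub>A\<^esub> (n + m) (bracket (upa A) p q)" by blast
  moreover have "bracket (upa A) p q k \<in> carrier A" for k
    using p q by (auto intro!: M.finsum_closed simp: mem_upD bracket_closed)
  ultimately show ?thesis by blast
qed

lemma poisson_iso_pair_upa:
  fixes S :: "('k, 'b, 'y) poisson_alg_scheme"
  assumes "h \<in> poisson_iso K (upa A) S" "h \<zero>\<^bsub>upa A\<^esub> = \<zero>\<^bsub>S\<^esub>"
  shows "poisson_iso_pair K (upa A) S h (inv_into (up A) h)"
proof -
  interpret U: cring "upa A" by (rule cring_upa[OF M_cring])
  have "poisson_iso_pair K (upa A) S h (inv_into (carrier (upa A)) h)"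
  proof (rule poisson_iso_pairI)
    show "h \<in> poisson_iso K (upa A) S" by fact
    show "ring (upa A)" by (rule U.ring_axioms)
    show "h \<zero>\<^bsub>upa A\<^esub> = \<zero>\<^bsub>S\<^esub>" by fact
  qed (use bracket_upa_closed up_smult_base_closed[OF algebra_axioms] in auto)
  then show ?thesis by simp
qed

end

text \<open>Stability is a statement about \<^const>\<open>poly_ext\<close>; invariance of discriminant ideals moves it
  to \<^const>\<open>upa\<close>.\<close>

lemma disc_ideal_upa:
  fixes A :: "('k, 'u) poisson_alg" and P :: "('k, 'u) poisson_alg \<Rightarrow> bool"
  assumes "poisson_algebra K A" "affine_alg K (center_alg A)" "stable_property K P"
  shows "disc_ideal K P (upa A) = {p \<in> up A. range p \<subseteq> disc_ideal K P A}"
proof -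
  interpret poisson_algebra K A by fact
  let ?e = "mset_poly A"
  interpret pair: poisson_iso_pair K "upa A" "poly_ext A 1" ?e "inv_into (up A) ?e"
    by (rule poisson_iso_pair_upa[OF mset_poly_iso[OF assms(1)]])
      (simp add: UP_zero mset_poly_zero poly_ext_def)
  have st: "disc_ideal K P (poly_ext A 1) = {p \<in> mpoly_carrier A 1. range p \<subseteq> disc_ideal K P A}"
    using assms unfolding stable_property_def by blast
  have "p \<in> disc_ideal K P (upa A) \<longleftrightarrow> range p \<subseteq> disc_ideal K P A" if p: "p \<in> up A" for p
  proof -
    obtain n where n: "p n = \<zero>\<^bsub>A\<^esub>" using p by (auto simp: up_def bound_def)
    have sub: "range p \<subseteq> range (?e p)"
    proof
      fix x assume "x \<in> range p"
      then obtain i where "x = p i" by blast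
      then have "x = ?e p (replicate_mset i 0)" by simp
      then show "x \<in> range (?e p)" by blast
    qed
    have "?e p M \<in> range p" for M by (simp add: mset_poly_def n[symmetric])
    with sub have "range (?e p) = range p" by blast
    moreover have "?e p \<in> mpoly_carrier A 1" using mset_poly_bij[of A] p by (auto simp: bij_betw_def)
    ultimately show ?thesis using pair.disc_ideal_h_iff[of p P] p st by simp
  qed
  moreover have "disc_ideal K P (upa A) \<subseteq> up A" by (auto simp: disc_ideal_def poisson_center_def)
  ultimately show ?thesis by blast
qed

section \<open>Filtrations and their associated graded rings\<close>

text \<open>A filtration extended by zero to negative indices: then \<open>F\<^sub>i\<^sub>-\<^sub>1\<close> makes sense for all \<open>i\<close>,
  and so do the indices \<open>i - \<alpha>j\<close> of the coefficients of a polynomial.\<close>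

definition fext :: "('a, 'm) ring_scheme \<Rightarrow> (nat \<Rightarrow> 'a set) \<Rightarrow> int \<Rightarrow> 'a set" where
  "fext A F z = (if z < 0 then {\<zero>\<^bsub>A\<^esub>} else F (nat z))"

text \<open>A nonzero element has degree \<open>y\<close> if it lies in \<open>F\<^sub>y\<close> but not in \<open>F\<^sub>y\<^sub>-\<^sub>1\<close>. So this says
  that \<open>deg (a b) = deg a + deg b\<close>, which is the form in which the graded ring being a domain
  is used and transported.\<close>

definition degree_additive :: "('a, 'm) ring_scheme \<Rightarrow> (nat \<Rightarrow> 'a set) \<Rightarrow> bool" where
  "degree_additive A F \<longleftrightarrow> (\<forall>y z a b. a \<in> fext A F y - fext A F (y - 1) \<longrightarrow>
     b \<in> fext A F z - fext A F (z - 1) \<longrightarrow> a \<otimes>\<^bsub>A\<^esub> b \<notin> fext A F (y + z - 1))"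

lemma filt_pred_fext: "filt_pred A F i = fext A F (int i - 1)"
  by (auto simp: filt_pred_def fext_def nat_diff_distrib)

lemma fext_nat [simp]: "fext A F (int i) = F i"
  by (simp add: fext_def)

locale filtered_algebra = algebra K A
  for K :: "('k, 'm) ring_scheme" (structure) and A :: "('k, 'a, 'x) module_scheme" (structure) +
  fixes F :: "nat \<Rightarrow> 'a set"
  assumes filt: "filtration K A F"
begin

lemma F_sub: "F i \<subseteq> carrier A" using filt by (auto simp: filtration_def)

lemma F_submodule: "submodule (F i) K A" using filt by (auto simp: filtration_def)

lemma F_mono: "i \<le> j \<Longrightarrow> F i \<subseteq> F j"
proof (rule lift_Suc_mono_le[of F])
  show "F n \<subseteq> F (Suc n)" for n using filt unfolding filtration_def by blast
qed

lemma fext_sub: "fext A F z \<subseteq> carrier A" using F_sub by (auto simp: fext_def)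

lemma fext_mono: "y \<le> z \<Longrightarrow> fext A F y \<subseteq> fext A F z"
  using F_mono[of "nat y" "nat z"] submoduleE(2,5)[OF F_submodule] F_submodule
  by (auto simp: fext_def submodule_def subgroup_def)

lemma fext_submodule: "submodule (fext A F z) K A"
  using F_submodule by (auto simp: fext_def intro!: submoduleI)

lemma fext_zero: "\<zero>\<^bsub>A\<^esub> \<in> fext A F z"
  using fext_submodule[of z] by (auto simp: submodule_def subgroup_def)

lemma fext_add: "\<lbrakk>a \<in> fext A F z; b \<in> fext A F z\<rbrakk> \<Longrightarrow> a \<oplus>\<^bsub>A\<^esub> b \<in> fext A F z"
  using submoduleE(5)[OF fext_submodule] .

lemma fext_uminus: "a \<in> fext A F z \<Longrightarrow> \<ominus>\<^bsub>A\<^esub> a \<in> fext A F z"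
  using submoduleE(3)[OF fext_submodule] .

lemma fext_minus: "\<lbrakk>a \<in> fext A F z; b \<in> fext A F z\<rbrakk> \<Longrightarrow> a \<ominus>\<^bsub>A\<^esub> b \<in> fext A F z"
  by (simp add: a_minus_def fext_add fext_uminus)

lemma fext_smult: "\<lbrakk>r \<in> carrier K; a \<in> fext A F z\<rbrakk> \<Longrightarrow> r \<odot>\<^bsub>A\<^esub> a \<in> fext A F z"
  using submoduleE(4)[OF fext_submodule] .

lemma fext_closed: "a \<in> fext A F z \<Longrightarrow> a \<in> carrier A"
  using fext_sub by blast

lemma fext_mult: "\<lbrakk>a \<in> fext A F y; b \<in> fext A F z\<rbrakk> \<Longrightarrow> a \<otimes>\<^bsub>A\<^esub> b \<in> fext A F (y + z)"
proof -
  assume a: "a \<in> fext A F y" and b: "b \<in> fext A F z"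
  show ?thesis
  proof (cases "y < 0 \<or> z < 0")
    case True
    then have "a \<otimes>\<^bsub>A\<^esub> b = \<zero>\<^bsub>A\<^esub>" using a b F_sub[THEN subsetD] by (auto simp: fext_def split: if_splits)
    then show ?thesis by (simp add: fext_zero)
  next
    case False
    then show ?thesis using a b filt by (auto simp: fext_def filtration_def nat_add_distrib)
  qed
qed

lemma fext_finsum: "(\<And>i. i \<in> I \<Longrightarrow> f i \<in> fext A F z) \<Longrightarrow> (\<Oplus>\<^bsub>A\<^esub> i\<in>I. f i) \<in> fext A F z"
proof (induction I rule: infinite_finite_induct)
  case (insert x I)
  then show ?case using fext_closed by (subst finsum_insert) (auto intro!: fext_add)
qed (auto simp: fext_zero)

lemma fext_sum_iff:
  assumes "a \<in> fext A F z" "b \<in> carrier A" shows "b \<oplus>\<^bsub>A\<^esub> a \<in> fext A F z \<longleftrightarrow> b \<in> fext A F z"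
proof
  assume "b \<oplus>\<^bsub>A\<^esub> a \<in> fext A F z"
  then have "(b \<oplus>\<^bsub>A\<^esub> a) \<ominus>\<^bsub>A\<^esub> a \<in> fext A F z" using assms fext_minus by blast
  moreover have "(b \<oplus>\<^bsub>A\<^esub> a) \<ominus>\<^bsub>A\<^esub> a = b"
    using assms(2) fext_closed[OF assms(1)] by (simp add: a_minus_def a_assoc r_neg)
  ultimately show "b \<in> fext A F z" by simp
qed (use assms fext_add in auto)

lemma exhaustive: "a \<in> carrier A \<Longrightarrow> \<exists>i. a \<in> F i"
  using filt by (auto simp: filtration_def)

lemma filt_deg_in: "a \<in> carrier A \<Longrightarrow> a \<in> F (filt_deg F a)"
  unfolding filt_deg_def using exhaustive by (metis LeastI)

lemma filt_deg_le: "a \<in> F i \<Longrightarrow> filt_deg F a \<le> i"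
  unfolding filt_deg_def by (rule Least_le)

subsection \<open>The graded ring as a quotient of the Rees ring\<close>

abbreviation gr :: "(nat \<Rightarrow> 'a set) ring" where "gr \<equiv> assoc_graded A F"

abbreviation Pr :: "nat \<Rightarrow> 'a set" where "Pr i \<equiv> fext A F (int i - 1)"

lemma gr_simps:
  "carrier gr = {g. (\<forall>i. \<exists>x\<in>F i. g i = Pr i +>\<^bsub>A\<^esub> x) \<and> finite {i. g i \<noteq> Pr i}}"
  "\<one>\<^bsub>gr\<^esub> = (\<lambda>i. Pr i +>\<^bsub>A\<^esub> (if i = 0 then \<one>\<^bsub>A\<^esub> else \<zero>\<^bsub>A\<^esub>))"
  "\<zero>\<^bsub>gr\<^esub> = Pr"
  "g \<oplus>\<^bsub>gr\<^esub> h = (\<lambda>i. g i <+>\<^bsub>A\<^esub> h i)"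
  by (simp_all add: assoc_graded_def filt_pred_fext fun_eq_iff)

lemma Pr_subgroup: "subgroup (Pr i) (add_monoid A)"
  using fext_submodule by (auto simp: submodule_def)

lemma Pr_abelian_subgroup: "abelian_subgroup (Pr i) A"
  by (rule abelian_subgroupI3) (auto simp: additive_subgroup_def Pr_subgroup is_abelian_group)

lemma Pr_coset_eq_iff:
  assumes "x \<in> carrier A" shows "Pr i +>\<^bsub>A\<^esub> x = Pr i \<longleftrightarrow> x \<in> Pr i"
  using a_coset_join1[OF _ assms Pr_subgroup] a_coset_join2[OF assms Pr_subgroup] by blast

text \<open>The convolution product of cosets may be computed on any representatives, because
  \<open>F\<^sub>l\<^sub>-\<^sub>1 F\<^sub>k\<^sub>-\<^sub>l\<close> and \<open>F\<^sub>l F\<^sub>k\<^sub>-\<^sub>l\<^sub>-\<^sub>1\<close> lie in \<open>F\<^sub>k\<^sub>-\<^sub>1\<close>.\<close>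

lemma gr_mult:
  assumes a: "\<And>i. a i \<in> F i" and b: "\<And>i. b i \<in> F i"
  shows "((\<lambda>i. Pr i +>\<^bsub>A\<^esub> a i) \<otimes>\<^bsub>gr\<^esub> (\<lambda>i. Pr i +>\<^bsub>A\<^esub> b i)) k
    = Pr k +>\<^bsub>A\<^esub> (\<Oplus>\<^bsub>A\<^esub> i\<in>{..k}. a i \<otimes>\<^bsub>A\<^esub> b (k - i))"
proof -
  have ac: "a i \<in> carrier A" "b i \<in> carrier A" for i using a b F_sub by blast+
  have rep: "c \<in> F i \<and> c \<ominus>\<^bsub>A\<^esub> x \<in> Pr i" if c: "c \<in> Pr i +>\<^bsub>A\<^esub> x" and x: "x \<in> F i" for c x i
  proof -
    obtain p where p: "p \<in> Pr i" "c = p \<oplus>\<^bsub>A\<^esub> x" using c by (auto simp: a_r_coset_def')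
    have "p \<in> F i" using p(1) fext_mono[of "int i - 1" "int i"] by auto
    then have "c \<in> F i" using p(2) x fext_add[of p "int i" x] by simp
    moreover have "c \<ominus>\<^bsub>A\<^esub> x = p"
      using fext_closed[OF p(1)] F_sub[THEN subsetD, OF x] p(2) by (simp add: a_minus_def a_assoc r_neg)
    ultimately show ?thesis using p(1) by simp
  qed
  have "Pr k +>\<^bsub>A\<^esub> (\<Oplus>\<^bsub>A\<^esub> i\<in>{..k}. a' i \<otimes>\<^bsub>A\<^esub> b' (k - i)) = Pr k +>\<^bsub>A\<^esub> (\<Oplus>\<^bsub>A\<^esub> i\<in>{..k}. a i \<otimes>\<^bsub>A\<^esub> b (k - i))"
    if *: "\<forall>i\<le>k. a' i \<in> Pr i +>\<^bsub>A\<^esub> a i \<and> b' i \<in> Pr i +>\<^bsub>A\<^esub> b i" for a' b'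
  proof -
    have a': "a' i \<in> F i" "a' i \<ominus>\<^bsub>A\<^esub> a i \<in> Pr i" "b' i \<in> F i" "b' i \<ominus>\<^bsub>A\<^esub> b i \<in> Pr i"
      "a' i \<in> carrier A" "b' i \<in> carrier A" if "i \<le> k" for i
      using rep[of "a' i" i "a i"] rep[of "b' i" i "b i"] * that a b F_sub by blast+
    define c where "c i = a' i \<otimes>\<^bsub>A\<^esub> b' (k - i) \<ominus>\<^bsub>A\<^esub> a i \<otimes>\<^bsub>A\<^esub> b (k - i)" for i
    have c: "c i \<in> Pr k" if "i \<le> k" for i
    proof -
      have m: "k - i \<le> k" by simp
      have "c i = (a' i \<ominus>\<^bsub>A\<^esub> a i) \<otimes>\<^bsub>A\<^esub> b' (k - i) \<oplus>\<^bsub>A\<^esub> a i \<otimes>\<^bsub>A\<^esub> (b' (k - i) \<ominus>\<^bsub>A\<^esub> b (k - i))"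
        unfolding c_def using a'(5)[OF that] a'(6)[OF m] ac by algebra
      moreover have "(a' i \<ominus>\<^bsub>A\<^esub> a i) \<otimes>\<^bsub>A\<^esub> b' (k - i) \<in> Pr k"
        using fext_mult[OF a'(2)[OF that], of "b' (k - i)" "int (k - i)", unfolded fext_nat, OF a'(3)[OF m]] that
        by (simp add: of_nat_diff)
      moreover have "a i \<otimes>\<^bsub>A\<^esub> (b' (k - i) \<ominus>\<^bsub>A\<^esub> b (k - i)) \<in> Pr k"
        using fext_mult[of "a i" "int i", OF _ a'(4)[OF m]] a that by (simp add: of_nat_diff)
      ultimately show ?thesis by (simp add: fext_add)
    qed
    have cc: "c i \<in> carrier A" if "i \<le> k" for i using fext_closed[OF c[OF that]] .
    have e: "a' i \<otimes>\<^bsub>A\<^esub> b' (k - i) = c i \<oplus>\<^bsub>A\<^esub> a i \<otimes>\<^bsub>A\<^esub> b (k - i)" if "i \<le> k" for i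
      unfolding c_def using a'(5)[OF that] a'(6)[of "k - i"] ac by (simp add: a_minus_def a_assoc l_neg)
    have "(\<Oplus>\<^bsub>A\<^esub> i\<in>{..k}. a' i \<otimes>\<^bsub>A\<^esub> b' (k - i)) = (\<Oplus>\<^bsub>A\<^esub> i\<in>{..k}. c i \<oplus>\<^bsub>A\<^esub> a i \<otimes>\<^bsub>A\<^esub> b (k - i))"
      using cc ac by (intro finsum_cong') (auto simp: e)
    also have "\<dots> = (\<Oplus>\<^bsub>A\<^esub> i\<in>{..k}. c i) \<oplus>\<^bsub>A\<^esub> (\<Oplus>\<^bsub>A\<^esub> i\<in>{..k}. a i \<otimes>\<^bsub>A\<^esub> b (k - i))"
      using cc ac by (intro finsum_addf) auto
    finally have "(\<Oplus>\<^bsub>A\<^esub> i\<in>{..k}. a' i \<otimes>\<^bsub>A\<^esub> b' (k - i)) \<in> Pr k +>\<^bsub>A\<^esub> (\<Oplus>\<^bsub>A\<^esub> i\<in>{..k}. a i \<otimes>\<^bsub>A\<^esub> b (k - i))"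
      using fext_finsum[of "{..k}" c "int k - 1"] c by (auto simp: a_r_coset_def')
    then show ?thesis
      using ac by (intro a_repr_independence[symmetric] Pr_subgroup) (auto intro!: finsum_closed)
  qed
  moreover have "x \<in> Pr i +>\<^bsub>A\<^esub> x" if "x \<in> carrier A" for x i
    using a_coset_join2 that fext_zero[of "int i - 1"] l_zero[OF that] by (force simp: a_r_coset_def')
  ultimately have "{Pr k +>\<^bsub>A\<^esub> (\<Oplus>\<^bsub>A\<^esub> i\<in>{..k}. a' i \<otimes>\<^bsub>A\<^esub> b' (k - i)) | a' b'.
      \<forall>i\<le>k. a' i \<in> Pr i +>\<^bsub>A\<^esub> a i \<and> b' i \<in> Pr i +>\<^bsub>A\<^esub> b i}
    = {Pr k +>\<^bsub>A\<^esub> (\<Oplus>\<^bsub>A\<^esub> i\<in>{..k}. a i \<otimes>\<^bsub>A\<^esub> b (k - i))}"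
    using ac by blast
  then show ?thesis by (simp add: assoc_graded_def filt_pred_fext)
qed

text \<open>Choosing zero to represent the zero coset makes the family of representatives a polynomial.\<close>

lemma gr_rep:
  assumes "g \<in> carrier gr"
  obtains a where "\<And>i. a i \<in> F i" "g = (\<lambda>i. Pr i +>\<^bsub>A\<^esub> a i)" "\<And>i. g i = Pr i \<Longrightarrow> a i = \<zero>\<^bsub>A\<^esub>"
    "a \<in> up A"
proof -
  have "\<exists>x. x \<in> F i \<and> g i = Pr i +>\<^bsub>A\<^esub> x \<and> (g i = Pr i \<longrightarrow> x = \<zero>\<^bsub>A\<^esub>)" for i
  proof (cases "g i = Pr i")
    case True
    then show ?thesis
      using fext_zero[of "int i"] a_coset_add_zero[OF fext_sub] by (intro exI[of _ "\<zero>\<^bsub>A\<^esub>"]) auto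
  next
    case False
    then show ?thesis using assms by (auto simp: gr_simps)
  qed
  then obtain a where a: "\<And>i. a i \<in> F i" "\<And>i. g i = Pr i +>\<^bsub>A\<^esub> a i" "\<And>i. g i = Pr i \<Longrightarrow> a i = \<zero>\<^bsub>A\<^esub>"
    by metis
  obtain n where n: "\<And>i. g i \<noteq> Pr i \<Longrightarrow> i \<le> n"
    using assms by (auto simp: gr_simps finite_nat_set_iff_bounded_le)
  have "bound \<zero>\<^bsub>A\<^esub> n a" using n a(3) by (metis bound.intro not_le)
  then have "a \<in> up A" using a(1) F_sub by blast
  with a show ?thesis by (intro that[of a]) auto
qed

text \<open>The Rees ring \<open>\<Oplus>\<^sub>i F\<^sub>i t\<^sup>i\<close> inside \<open>A[t]\<close>. The graded ring is its image under
  taking cosets in each degree, and so inherits the axioms of a commutative ring.\<close>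

definition rees :: "(nat \<Rightarrow> 'a) set" where
  "rees = {a \<in> up A. \<forall>i. a i \<in> F i}"

lemma cring_rees: "cring ((UP A)\<lparr>carrier := rees\<rparr>)"
proof -
  interpret U: UP_cring A "UP A" by (simp_all add: UP_cringI M_cring)
  have sub: "rees \<subseteq> carrier (UP A)" by (auto simp: rees_def UP_carrier)
  have "subring rees (UP A)"
  proof (rule U.P.subringI[OF sub])
    show "\<one>\<^bsub>UP A\<^esub> \<in> rees"
      using filt fext_zero[of "int _"] U.UP_one_closed
      by (auto simp: rees_def UP_one UP_carrier filtration_def)
    fix a b assume a: "a \<in> rees" and b: "b \<in> rees"
    have ac: "a \<in> up A" "b \<in> up A" "\<And>i. a i \<in> F i" "\<And>i. b i \<in> F i" using a b by (auto simp: rees_def)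
    have "\<ominus>\<^bsub>UP A\<^esub> a \<in> up A" using ac(1) U.UP_a_inv_closed[of a] by (simp add: UP_carrier)
    then have "(\<ominus>\<^bsub>UP A\<^esub> a) i = \<ominus>\<^bsub>A\<^esub> a i" for i
      using U.coeff_a_inv[of a i] ac(1) by (simp only: UP_carrier UP_coeff)
    then show "\<ominus>\<^bsub>UP A\<^esub> a \<in> rees"
      using ac fext_uminus[of _ "int _"] U.UP_a_inv_closed[of a] by (simp add: rees_def UP_carrier)
    show "a \<oplus>\<^bsub>UP A\<^esub> b \<in> rees"
      using ac fext_add[of _ "int _"] U.UP_a_closed[of a b] by (simp add: rees_def UP_carrier UP_add)
    have "a i \<otimes>\<^bsub>A\<^esub> b (k - i) \<in> F k" if "i \<le> k" for i k
    proof -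
      have "a i \<otimes>\<^bsub>A\<^esub> b (k - i) \<in> fext A F (int i + int (k - i))"
        by (rule fext_mult) (simp_all only: fext_nat ac)
      then show ?thesis using that by (simp add: of_nat_diff)
    qed
    then have "(a \<otimes>\<^bsub>UP A\<^esub> b) k \<in> F k" for k
      using fext_finsum[of "{..k}" _ "int k"] ac by (simp add: UP_mult)
    then show "a \<otimes>\<^bsub>UP A\<^esub> b \<in> rees"
      using ac U.UP_mult_closed[of a b] by (simp add: rees_def UP_carrier)
  qed
  then have "subcring rees (UP A)" by (rule U.P.subcringI')
  then show ?thesis using U.P.subcring_iff[OF sub] by blast
qed

lemma gr_hom: "(\<lambda>a i. Pr i +>\<^bsub>A\<^esub> a i) \<in> ring_hom ((UP A)\<lparr>carrier := rees\<rparr>) gr"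
proof (rule ring_hom_memI)
  fix a assume "a \<in> carrier ((UP A)\<lparr>carrier := rees\<rparr>)"
  then have a: "a \<in> up A" "\<And>i. a i \<in> F i" by (auto simp: rees_def)
  obtain n where "\<And>i. i > n \<Longrightarrow> a i = \<zero>\<^bsub>A\<^esub>" using a(1) by (auto simp: up_def bound_def)
  then have "{i. Pr i +>\<^bsub>A\<^esub> a i \<noteq> Pr i} \<subseteq> {..n}"
    using a_coset_add_zero[OF fext_sub] by (auto simp: not_le[symmetric])
  then have "finite {i. Pr i +>\<^bsub>A\<^esub> a i \<noteq> Pr i}" by (rule finite_subset) simp
  then show "(\<lambda>i. Pr i +>\<^bsub>A\<^esub> a i) \<in> carrier gr"
    using a(2) by (auto simp: gr_simps)
  fix b assume "b \<in> carrier ((UP A)\<lparr>carrier := rees\<rparr>)"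
  then have b: "b \<in> up A" "\<And>i. b i \<in> F i" by (auto simp: rees_def)
  show "(\<lambda>i. Pr i +>\<^bsub>A\<^esub> (a \<otimes>\<^bsub>(UP A)\<lparr>carrier := rees\<rparr>\<^esub> b) i)
    = (\<lambda>i. Pr i +>\<^bsub>A\<^esub> a i) \<otimes>\<^bsub>gr\<^esub> (\<lambda>i. Pr i +>\<^bsub>A\<^esub> b i)"
    using a b by (simp add: fun_eq_iff gr_mult UP_mult)
  show "(\<lambda>i. Pr i +>\<^bsub>A\<^esub> (a \<oplus>\<^bsub>(UP A)\<lparr>carrier := rees\<rparr>\<^esub> b) i)
    = (\<lambda>i. Pr i +>\<^bsub>A\<^esub> a i) \<oplus>\<^bsub>gr\<^esub> (\<lambda>i. Pr i +>\<^bsub>A\<^esub> b i)"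
    using a b by (simp add: fun_eq_iff gr_simps UP_add mem_upD abelian_subgroup.a_rcos_sum[OF Pr_abelian_subgroup])
qed (simp add: gr_simps UP_one)

lemma cring_gr: "cring gr"
proof -
  let ?R = "(UP A)\<lparr>carrier := rees\<rparr>" and ?h = "\<lambda>a i. Pr i +>\<^bsub>A\<^esub> a i"
  interpret Q: cring ?R by (rule cring_rees)
  have im: "?h ` rees = carrier gr"
  proof (intro equalityI subsetI)
    fix g assume "g \<in> carrier gr"
    then obtain a where "\<And>i. a i \<in> F i" "g = ?h a" "a \<in> up A" by (rule gr_rep) blast
    then show "g \<in> ?h ` rees" by (auto simp: rees_def)
  qed (use ring_hom_memE(1)[OF gr_hom] in auto)
  have z: "?h \<zero>\<^bsub>?R\<^esub> = \<zero>\<^bsub>gr\<^esub>" using a_coset_add_zero[OF fext_sub] by (simp add: UP_zero gr_simps)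
  have "ring (gr\<lparr>carrier := ?h ` carrier ?R, zero := ?h \<zero>\<^bsub>?R\<^esub>\<rparr>)"
    by (rule Q.ring_hom_imp_img_ring[OF gr_hom])
  then have "ring gr" using im z by simp
  then interpret G: ring gr .
  show ?thesis
  proof (intro cring.intro comm_monoid.intro comm_monoid_axioms.intro G.ring_axioms G.monoid_axioms)
    fix g h assume "g \<in> carrier gr" "h \<in> carrier gr"
    then obtain a b where "a \<in> rees" "g = ?h a" "b \<in> rees" "h = ?h b"
      unfolding im[symmetric] by blast
    then show "g \<otimes>\<^bsub>gr\<^esub> h = h \<otimes>\<^bsub>gr\<^esub> g"
      using ring_hom_memE(2)[OF gr_hom, of a b] ring_hom_memE(2)[OF gr_hom, of b a] Q.m_comm[of a b] by simp
  qed
qed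

text \<open>The product of the symbols of \<open>a\<close> and \<open>b\<close> is the class of \<open>a b\<close> in degree
  \<open>i + j\<close>, hence zero exactly if the degree of \<open>a b\<close> is smaller than \<open>i + j\<close>.\<close>

lemma degree_additive_if_domain_gr:
  assumes "domain gr" shows "degree_additive A F"
  unfolding degree_additive_def
proof (intro allI impI)
  interpret G: "domain" gr by fact
  fix y z a b assume a: "a \<in> fext A F y - fext A F (y - 1)" and b: "b \<in> fext A F z - fext A F (z - 1)"
  have "y \<ge> 0" "z \<ge> 0" using a b by (auto simp: fext_def split: if_splits)
  then obtain i j where ij: "y = int i" "z = int j" using nonneg_int_cases by metis
  have aF: "a \<in> F i" "a \<notin> Pr i" "b \<in> F j" "b \<notin> Pr j" using a b ij by auto
  have ac: "a \<in> carrier A" "b \<in> carrier A" using aF F_sub by blast+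
  define s where "s i a l = (if l = i then a else \<zero>\<^bsub>A\<^esub>)" for i l :: nat and a
  let ?h = "\<lambda>a i. Pr i +>\<^bsub>A\<^esub> a i"
  have sr: "s i a \<in> rees" if "a \<in> F i" for i a
    using that F_sub[THEN subsetD] fext_zero[of "int _"] by (auto simp: rees_def s_def up_def bound_def intro!: exI[of _ i])
  have ne: "?h (s i a) \<noteq> \<zero>\<^bsub>gr\<^esub>" if "a \<in> F i" "a \<notin> Pr i" for i a
  proof
    assume "?h (s i a) = \<zero>\<^bsub>gr\<^esub>"
    from fun_cong[OF this, of i] have "Pr i +>\<^bsub>A\<^esub> a = Pr i" by (simp add: s_def gr_simps)
    then show False using that F_sub Pr_coset_eq_iff by blast
  qed
  have cl: "?h (s i a) \<in> carrier gr" "?h (s j b) \<in> carrier gr"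
    using ring_hom_memE(1)[OF gr_hom] sr[OF aF(1)] sr[OF aF(3)] by auto
  show "a \<otimes>\<^bsub>A\<^esub> b \<notin> fext A F (y + z - 1)"
  proof
    assume ab: "a \<otimes>\<^bsub>A\<^esub> b \<in> fext A F (y + z - 1)"
    have "(?h (s i a) \<otimes>\<^bsub>gr\<^esub> ?h (s j b)) k = Pr k" for k
    proof -
      have sF: "s i a l \<in> F l" "s j b l \<in> F l" for l using sr aF by (auto simp: rees_def)
      have "s i a l \<otimes>\<^bsub>A\<^esub> s j b (k - l) \<in> Pr k" if "l \<le> k" for l
        using that ab ac ij fext_zero by (auto simp: s_def of_nat_diff)
      then have "(\<Oplus>\<^bsub>A\<^esub> l\<in>{..k}. s i a l \<otimes>\<^bsub>A\<^esub> s j b (k - l)) \<in> Pr k" by (intro fext_finsum) auto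
      then show ?thesis using gr_mult[OF sF, of k] Pr_coset_eq_iff fext_closed by metis
    qed
    then have "?h (s i a) \<otimes>\<^bsub>gr\<^esub> ?h (s j b) = \<zero>\<^bsub>gr\<^esub>" by (simp add: gr_simps fun_eq_iff)
    then show False using G.integral[OF _ cl] ne[OF aF(1,2)] ne[OF aF(3,4)] by blast
  qed
qed

text \<open>Conversely, in the product of two nonzero elements of \<^const>\<open>assoc_graded\<close> only the product
  of the two components of highest degree contributes to the sum of these degrees.\<close>

lemma domain_gr_if_degree_additive:
  assumes da: "degree_additive A F" and one: "\<one>\<^bsub>A\<^esub> \<noteq> \<zero>\<^bsub>A\<^esub>"
  shows "domain gr"
proof (rule domain.intro[OF cring_gr], rule domain_axioms.intro)
  let ?h = "\<lambda>a i. Pr i +>\<^bsub>A\<^esub> a i"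
  show "\<one>\<^bsub>gr\<^esub> \<noteq> \<zero>\<^bsub>gr\<^esub>"
  proof
    assume "\<one>\<^bsub>gr\<^esub> = \<zero>\<^bsub>gr\<^esub>"
    from fun_cong[OF this, of 0] have "Pr 0 +>\<^bsub>A\<^esub> \<one>\<^bsub>A\<^esub> = Pr 0" by (simp add: gr_simps)
    then have "\<one>\<^bsub>A\<^esub> \<in> Pr 0" using Pr_coset_eq_iff one_closed by blast
    then show False using one by (simp add: fext_def)
  qed
  fix g h assume gh: "g \<otimes>\<^bsub>gr\<^esub> h = \<zero>\<^bsub>gr\<^esub>" and g: "g \<in> carrier gr" and h: "h \<in> carrier gr"
  have top: "\<exists>a i. (\<forall>l. a l \<in> F l) \<and> g = ?h a \<and> a i \<notin> Pr i \<and> (\<forall>l>i. a l = \<zero>\<^bsub>A\<^esub>)"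
    if g: "g \<in> carrier gr" and "g \<noteq> \<zero>\<^bsub>gr\<^esub>" for g
  proof -
    from g obtain a where a: "\<And>i. a i \<in> F i" "g = ?h a" "\<And>i. g i = Pr i \<Longrightarrow> a i = \<zero>\<^bsub>A\<^esub>"
      by (rule gr_rep) blast
    let ?I = "{i. g i \<noteq> Pr i}"
    have I: "finite ?I" "?I \<noteq> {}" using that by (auto simp: gr_simps fun_eq_iff)
    have "Max ?I \<in> ?I" by (rule Max_in[OF I])
    then have "a (Max ?I) \<notin> Pr (Max ?I)"
      using Pr_coset_eq_iff[of "a (Max ?I)" "Max ?I"] a(1)[of "Max ?I"] F_sub a(2) by auto
    moreover have "a l = \<zero>\<^bsub>A\<^esub>" if "l > Max ?I" for l
      using a(3)[of l] Max_ge[OF I(1), of l] that by fastforce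
    ultimately show ?thesis using a by blast
  qed
  show "g = \<zero>\<^bsub>gr\<^esub> \<or> h = \<zero>\<^bsub>gr\<^esub>"
  proof (rule ccontr)
    assume "\<not> (g = \<zero>\<^bsub>gr\<^esub> \<or> h = \<zero>\<^bsub>gr\<^esub>)"
    then have ne: "g \<noteq> \<zero>\<^bsub>gr\<^esub>" "h \<noteq> \<zero>\<^bsub>gr\<^esub>" by auto
    from top[OF g ne(1)] obtain a i where a': "\<forall>l. a l \<in> F l" "g = ?h a" "a i \<notin> Pr i" "\<forall>l>i. a l = \<zero>\<^bsub>A\<^esub>"
      by (elim exE conjE) (rule that)
    from top[OF h ne(2)] obtain b j where b': "\<forall>l. b l \<in> F l" "h = ?h b" "b j \<notin> Pr j" "\<forall>l>j. b l = \<zero>\<^bsub>A\<^esub>"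
      by (elim exE conjE) (rule that)
    note a = a'(1)[rule_format] a'(2,3) a'(4)[rule_format]
      and b = b'(1)[rule_format] b'(2,3) b'(4)[rule_format]
    have ac: "a l \<in> carrier A" "b l \<in> carrier A" for l using a(1) b(1) F_sub by blast+
    have "(\<Oplus>\<^bsub>A\<^esub> l\<in>{..i + j}. a l \<otimes>\<^bsub>A\<^esub> b (i + j - l)) = (\<Oplus>\<^bsub>A\<^esub> l\<in>{..i + j}. if i = l then a l \<otimes>\<^bsub>A\<^esub> b (i + j - l) else \<zero>\<^bsub>A\<^esub>)"
    proof (rule finsum_cong')
      fix l assume l: "l \<in> {..i + j}"
      show "a l \<otimes>\<^bsub>A\<^esub> b (i + j - l) = (if i = l then a l \<otimes>\<^bsub>A\<^esub> b (i + j - l) else \<zero>\<^bsub>A\<^esub>)"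
        using a(4)[of l] b(4)[of "i + j - l"] ac by (cases "i < l"; cases "i = l") auto
    qed (auto simp: ac)
    also have "\<dots> = a i \<otimes>\<^bsub>A\<^esub> b j"
      using ac finsum_singleton[of i "{..i + j}" "\<lambda>l. a l \<otimes>\<^bsub>A\<^esub> b (i + j - l)"] by simp
    finally have "(g \<otimes>\<^bsub>gr\<^esub> h) (i + j) = Pr (i + j) +>\<^bsub>A\<^esub> (a i \<otimes>\<^bsub>A\<^esub> b j)"
      unfolding a(2) b(2) using gr_mult[OF a(1) b(1)] by simp
    then have "a i \<otimes>\<^bsub>A\<^esub> b j \<in> Pr (i + j)"
      using gh Pr_coset_eq_iff[of "a i \<otimes>\<^bsub>A\<^esub> b j" "i + j"] ac by (simp add: gr_simps)
    moreover have "a i \<otimes>\<^bsub>A\<^esub> b j \<notin> fext A F (int i + int j - 1)"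
    proof -
      have "a i \<in> fext A F (int i) - Pr i" "b j \<in> fext A F (int j) - Pr j" using a(1,3) b(1,3) by simp_all
      then show ?thesis using da unfolding degree_additive_def by blast
    qed
    ultimately show False by simp
  qed
qed

end

section \<open>Filtering polynomials by weighted degree\<close>

text \<open>The variable has weight \<open>\<alpha>\<close>: the term \<open>a t\<^sup>j\<close> has degree \<open>deg a + \<alpha> j\<close>.\<close>

definition poly_filt :: "('a, 'm) ring_scheme \<Rightarrow> (nat \<Rightarrow> 'a set) \<Rightarrow> nat \<Rightarrow> nat \<Rightarrow> (nat \<Rightarrow> 'a) set" where
  "poly_filt A F \<alpha> k = {p \<in> up A. \<forall>j. p j \<in> fext A F (int k - int \<alpha> * int j)}"

context filtered_algebra
begin

lemma poly_filt_const:
  assumes "a \<in> carrier A" shows "cst A a \<in> poly_filt A F \<alpha> k \<longleftrightarrow> a \<in> F k"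
proof -
  interpret U: UP_cring A "UP A" by (simp_all add: UP_cringI M_cring)
  have "cst A a \<in> up A" using assms U.monom_closed by (metis UP_carrier)
  then show ?thesis using assms fext_zero by (force simp: poly_filt_def UP_monom)
qed

lemma fext_poly_filt:
  assumes "\<alpha> > 0"
  shows "fext (UP A) (poly_filt A F \<alpha>) z = {p \<in> up A. \<forall>j. p j \<in> fext A F (z - int \<alpha> * int j)}"
proof (cases "z < 0")
  case True
  interpret U: UP_cring A "UP A" by (simp_all add: UP_cringI M_cring)
  have neg: "z - int \<alpha> * int j < 0" for j using True by (smt (verit) mult_nonneg_nonneg of_nat_0_le_iff)
  have "\<zero>\<^bsub>UP A\<^esub> \<in> up A" using U.UP_zero_closed by (simp add: UP_carrier)
  with True neg show ?thesis by (auto simp: fext_def UP_zero)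
next
  case False
  then show ?thesis by (simp add: fext_def poly_filt_def)
qed

end

locale filtered_upa = filtered_algebra K A F
  for K :: "('k, 'm) ring_scheme" (structure) and A :: "('k, 'a, 'x) poisson_alg_scheme" (structure) and F +
  fixes \<alpha> :: nat
  assumes \<alpha>: "\<alpha> > 0"
begin

sublocale U: UP_cring A "UP A" by (simp_all add: UP_cringI M_cring)

sublocale T: algebra K "upa A" by (rule algebra_upa[OF algebra_axioms])

lemma filtration_poly_filt: "filtration K (upa A) (poly_filt A F \<alpha>)"
  unfolding filtration_def
proof (intro conjI allI ballI)
  let ?G = "poly_filt A F \<alpha>"
  fix i
  show "submodule (?G i) K (upa A)"
  proof (rule T.submoduleI)
    show "?G i \<subseteq> carrier (upa A)" by (auto simp: poly_filt_def)
    show "\<zero>\<^bsub>upa A\<^esub> \<in> ?G i"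
      using U.UP_zero_closed fext_zero by (simp add: poly_filt_def UP_carrier) (simp add: UP_zero fext_zero)
    fix p q assume p: "p \<in> ?G i" and q: "q \<in> ?G i"
    show add: "p \<oplus>\<^bsub>upa A\<^esub> q \<in> ?G i"
      using p q fext_add U.UP_a_closed[of p q] by (simp add: poly_filt_def UP_add UP_carrier)
    show sm: "r \<odot>\<^bsub>upa A\<^esub> p \<in> ?G i" if "r \<in> carrier K" for r
      using p that fext_smult up_smult_base_closed[OF algebra_axioms that] by (simp add: poly_filt_def)
    have "\<ominus>\<^bsub>upa A\<^esub> p = (\<ominus> \<one>) \<odot>\<^bsub>upa A\<^esub> p"
      using T.smult_l_minus[of "\<one>" p] p by (simp add: poly_filt_def del: upa_simps(6))
    then show "\<ominus>\<^bsub>upa A\<^esub> p \<in> ?G i" using sm[of "\<ominus> \<one>"] by simp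
  qed
  show "?G i \<subseteq> ?G (Suc i)"
  proof -
    have "fext A F (int i - int \<alpha> * int j) \<subseteq> fext A F (int (Suc i) - int \<alpha> * int j)" for j
      by (rule fext_mono) simp
    then show ?thesis unfolding poly_filt_def by blast
  qed
  show "\<one>\<^bsub>upa A\<^esub> \<in> ?G 0"
  proof -
    have "\<one>\<^bsub>A\<^esub> \<in> F 0" using filt by (simp add: filtration_def)
    then have "cst A \<one>\<^bsub>A\<^esub> \<in> ?G 0" using poly_filt_const one_closed by blast
    then show ?thesis by simp
  qed
  fix j p q assume p: "p \<in> ?G i" and q: "q \<in> ?G j"
  have pq: "p \<in> up A" "q \<in> up A" using p q by (auto simp: poly_filt_def)
  have "p l \<otimes>\<^bsub>A\<^esub> q (k - l) \<in> fext A F (int (i + j) - int \<alpha> * int k)" if "l \<le> k" for l k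
  proof -
    have "p l \<otimes>\<^bsub>A\<^esub> q (k - l) \<in> fext A F ((int i - int \<alpha> * int l) + (int j - int \<alpha> * int (k - l)))"
      using p q by (intro fext_mult) (auto simp: poly_filt_def)
    moreover have "(int i - int \<alpha> * int l) + (int j - int \<alpha> * int (k - l)) = int (i + j) - int \<alpha> * int k"
      using that by (simp add: of_nat_diff algebra_simps)
    ultimately show ?thesis by simp
  qed
  then have "(p \<otimes>\<^bsub>upa A\<^esub> q) k \<in> fext A F (int (i + j) - int \<alpha> * int k)" for k
    using pq by (auto simp: UP_mult intro!: fext_finsum)
  then show "p \<otimes>\<^bsub>upa A\<^esub> q \<in> ?G (i + j)"
    using pq U.UP_mult_closed[of p q] by (simp add: poly_filt_def UP_carrier)
next
  let ?G = "poly_filt A F \<alpha>"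
  show "(\<Union>i. ?G i) = carrier (upa A)"
  proof (intro equalityI subsetI)
    fix p assume "p \<in> carrier (upa A)"
    then have p: "p \<in> up A" by simp
    then obtain n where n: "\<And>i. i > n \<Longrightarrow> p i = \<zero>\<^bsub>A\<^esub>" by (auto simp: up_def bound_def)
    have "\<forall>i. \<exists>k. p i \<in> F k" using exhaustive mem_upD[OF p] by blast
    from choice[OF this] obtain d where d: "\<forall>i. p i \<in> F (d i)" ..
    let ?k = "Max (d ` {..n}) + \<alpha> * n"
    have "p j \<in> fext A F (int ?k - int \<alpha> * int j)" for j
    proof (cases "j \<le> n")
      case True
      then have "d j \<le> Max (d ` {..n})" "\<alpha> * j \<le> \<alpha> * n" by auto
      then have "d j + \<alpha> * j \<le> ?k" by linarith
      then have "int (d j + \<alpha> * j) \<le> int ?k" by (simp only: of_nat_le_iff)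
      then have "int (d j) \<le> int ?k - int \<alpha> * int j" by simp
      from fext_mono[OF this] show ?thesis
        by (rule subsetD) (simp only: fext_nat d)
    next
      case False
      then show ?thesis by (simp add: n fext_zero)
    qed
    then have "p \<in> ?G ?k" using p by (simp add: poly_filt_def)
    then show "p \<in> (\<Union>i. ?G i)" by blast
  qed (auto simp: poly_filt_def)
qed

text \<open>The coefficient of \<open>p q\<close> at \<open>l + m\<close>, where \<open>l\<close> and \<open>m\<close> are the largest exponents at which
  \<open>p\<close> and \<open>q\<close> attain their weighted degrees, is \<open>p\<^sub>l q\<^sub>m\<close> up to terms of smaller degree.\<close>

lemma degree_additive_poly_filt:
  assumes da: "degree_additive A F"
  shows "degree_additive (UP A) (poly_filt A F \<alpha>)"
  unfolding degree_additive_def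
proof (intro allI impI)
  let ?G = "fext (UP A) (poly_filt A F \<alpha>)"
  let ?w = "\<lambda>z j. fext A F (z - int \<alpha> * int j)"
  note G = fext_poly_filt[OF \<alpha>]
  fix y z p q assume p: "p \<in> ?G y - ?G (y - 1)" and q: "q \<in> ?G z - ?G (z - 1)"
  have top: "\<exists>l. p l \<notin> ?w (y - 1) l \<and> (\<forall>j>l. p j \<in> ?w (y - 1) j)"
    if p: "p \<in> ?G y - ?G (y - 1)" for p y
  proof -
    let ?I = "{j. p j \<notin> ?w (y - 1) j}"
    have pu: "p \<in> up A" using p by (auto simp: G)
    then obtain n where n: "\<And>i. i > n \<Longrightarrow> p i = \<zero>\<^bsub>A\<^esub>" by (auto simp: up_def bound_def)
    have "?I \<subseteq> {..n}"
    proof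
      fix j assume "j \<in> ?I"
      then have "p j \<noteq> \<zero>\<^bsub>A\<^esub>" using fext_zero by force
      then show "j \<in> {..n}" using n by (meson atMost_iff not_le)
    qed
    then have I: "finite ?I" by (rule finite_subset) simp
    have ne: "?I \<noteq> {}" using p by (auto simp: G)
    show ?thesis using Max_in[OF I ne] Max_ge[OF I] by (intro exI[of _ "Max ?I"]) (auto simp: not_less[symmetric])
  qed
  obtain l where l: "p l \<notin> ?w (y - 1) l" "\<And>j. j > l \<Longrightarrow> p j \<in> ?w (y - 1) j" using top[OF p] by blast
  obtain m where m: "q m \<notin> ?w (z - 1) m" "\<And>j. j > m \<Longrightarrow> q j \<in> ?w (z - 1) j" using top[OF q] by blast
  have pq: "p \<in> up A" "q \<in> up A" "\<And>j. p j \<in> ?w y j" "\<And>j. q j \<in> ?w z j" using p q by (auto simp: G)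
  have c: "p j \<in> carrier A" "q j \<in> carrier A" for j using pq by (auto simp: mem_upD)
  let ?t = "y + z - 1 - int \<alpha> * int (l + m)"
  have "p l \<otimes>\<^bsub>A\<^esub> q m \<notin> fext A F ((y - int \<alpha> * int l) + (z - int \<alpha> * int m) - 1)"
  proof -
    have e: "y - 1 - int \<alpha> * int l = y - int \<alpha> * int l - 1" "z - 1 - int \<alpha> * int m = z - int \<alpha> * int m - 1"
      by simp_all
    have "p l \<in> fext A F (y - int \<alpha> * int l) - fext A F (y - int \<alpha> * int l - 1)"
      using pq(3) l(1)[unfolded e] by (rule DiffI)
    moreover have "q m \<in> fext A F (z - int \<alpha> * int m) - fext A F (z - int \<alpha> * int m - 1)"
      using pq(4) m(1)[unfolded e] by (rule DiffI)
    ultimately show ?thesis using da unfolding degree_additive_def by blast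
  qed
  then have no: "p l \<otimes>\<^bsub>A\<^esub> q m \<notin> fext A F ?t" by (simp add: algebra_simps)
  have small: "p j \<otimes>\<^bsub>A\<^esub> q (l + m - j) \<in> fext A F ?t" if j: "j \<le> l + m" "j \<noteq> l" for j
  proof (cases "j > l")
    case True
    have "p j \<otimes>\<^bsub>A\<^esub> q (l + m - j) \<in> fext A F ((y - 1 - int \<alpha> * int j) + (z - int \<alpha> * int (l + m - j)))"
      by (rule fext_mult[OF l(2)[OF True] pq(4)])
    then show ?thesis using j by (simp add: of_nat_diff algebra_simps)
  next
    case False
    then have "l + m - j > m" using j by linarith
    then have "p j \<otimes>\<^bsub>A\<^esub> q (l + m - j) \<in> fext A F ((y - int \<alpha> * int j) + (z - 1 - int \<alpha> * int (l + m - j)))"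
      by (intro fext_mult pq(3) m(2))
    then show ?thesis using j by (simp add: of_nat_diff algebra_simps)
  qed
  have "(p \<otimes>\<^bsub>UP A\<^esub> q) (l + m) = (\<Oplus>\<^bsub>A\<^esub> j\<in>insert l ({..l + m} - {l}). p j \<otimes>\<^bsub>A\<^esub> q (l + m - j))"
    using pq(1,2) by (simp add: UP_mult insert_absorb)
  also have "\<dots> = p l \<otimes>\<^bsub>A\<^esub> q m \<oplus>\<^bsub>A\<^esub> (\<Oplus>\<^bsub>A\<^esub> j\<in>{..l + m} - {l}. p j \<otimes>\<^bsub>A\<^esub> q (l + m - j))"
    using c by (subst finsum_insert) auto
  also have "\<dots> \<notin> fext A F ?t"
    using no small c fext_finsum[of "{..l + m} - {l}" "\<lambda>j. p j \<otimes>\<^bsub>A\<^esub> q (l + m - j)" ?t]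
    by (subst fext_sum_iff) auto
  finally have "(p \<otimes>\<^bsub>UP A\<^esub> q) (l + m) \<notin> ?w (y + z - 1) (l + m)" .
  then show "p \<otimes>\<^bsub>UP A\<^esub> q \<notin> ?G (y + z - 1)" unfolding G by blast
qed

lemma filt_deg_cst:
  assumes "a \<in> carrier A" shows "filt_deg (poly_filt A F \<alpha>) (cst A a) = filt_deg F a"
  unfolding filt_deg_def using poly_filt_const[OF assms] by simp

lemma filt_deg_zeroth_le:
  assumes "p \<in> up A" shows "filt_deg F (p 0) \<le> filt_deg (poly_filt A F \<alpha>) p"
proof -
  interpret G: filtered_algebra K "upa A" "poly_filt A F \<alpha>"
    by (intro filtered_algebra.intro filtered_algebra_axioms.intro filtration_poly_filt T.algebra_axioms)
  have "p \<in> poly_filt A F \<alpha> (filt_deg (poly_filt A F \<alpha>) p)" using G.filt_deg_in[of p] assms by simp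
  then have "p 0 \<in> fext A F (int (filt_deg (poly_filt A F \<alpha>) p) - int \<alpha> * int 0)"
    unfolding poly_filt_def by blast
  then show ?thesis using filt_deg_le by simp
qed

lemma filt_deg_nonconst_ge:
  assumes "p \<in> up A" "p j \<noteq> \<zero>\<^bsub>A\<^esub>" "j > 0" shows "\<alpha> \<le> filt_deg (poly_filt A F \<alpha>) p"
proof -
  interpret G: filtered_algebra K "upa A" "poly_filt A F \<alpha>"
    by (intro filtered_algebra.intro filtered_algebra_axioms.intro filtration_poly_filt T.algebra_axioms)
  let ?d = "filt_deg (poly_filt A F \<alpha>) p"
  have "p \<in> poly_filt A F \<alpha> ?d" using G.filt_deg_in[of p] assms by simp
  then have "p j \<in> fext A F (int ?d - int \<alpha> * int j)" unfolding poly_filt_def by blast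
  then have "int ?d - int \<alpha> * int j \<ge> 0" using assms(2) by (auto simp: fext_def split: if_splits)
  then have "int \<alpha> * int j \<le> int ?d" by simp
  then have "\<alpha> * j \<le> ?d" by (metis of_nat_le_iff of_nat_mult)
  then show ?thesis using assms(3) by (metis One_nat_def Suc_leI le_trans mult.right_neutral mult_le_mono2)
qed

end

section \<open>Transport of filtrations\<close>

lemma filtration_alg_iso:
  assumes "algebra K R" and h: "h \<in> alg_iso K R S" and F: "filtration K R F"
  shows "filtration K S (\<lambda>i. h ` F i)"
proof -
  interpret R: filtered_algebra K R F
    by (intro filtered_algebra.intro filtered_algebra_axioms.intro assms)
  interpret S: algebra K S by (rule algebra_alg_iso[OF assms(1) h])
  note D = alg_isoD[OF h]
  have inF: "\<And>i x. x \<in> F i \<Longrightarrow> x \<in> carrier R" using R.F_sub by blast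
  have sm: "submodule (h ` F i) K S" for i
  proof (rule S.submoduleI)
    show "h ` F i \<subseteq> carrier S" using inF D(8) by blast
    show "\<zero>\<^bsub>S\<^esub> \<in> h ` F i" using R.fext_zero[of "int i"] D(6) by (metis fext_nat image_eqI)
    fix a b assume "a \<in> h ` F i" "b \<in> h ` F i"
    then obtain x y where xy: "x \<in> F i" "a = h x" "y \<in> F i" "b = h y" by blast
    show "a \<oplus>\<^bsub>S\<^esub> b \<in> h ` F i"
      using xy inF D(9)[of x y] R.fext_add[of x "int i" y] by (intro image_eqI[of _ _ "x \<oplus>\<^bsub>R\<^esub> y"]) auto
    show smc: "r \<odot>\<^bsub>S\<^esub> a \<in> h ` F i" if "r \<in> carrier K" for r
      using xy inF D(11)[of r x] R.fext_smult[of r x "int i"] that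
      by (intro image_eqI[of _ _ "r \<odot>\<^bsub>R\<^esub> x"]) auto
    have "\<ominus>\<^bsub>S\<^esub> a = (\<ominus>\<^bsub>K\<^esub> \<one>\<^bsub>K\<^esub>) \<odot>\<^bsub>S\<^esub> a"
      using S.smult_l_minus[of "\<one>\<^bsub>K\<^esub>" a] xy D(8) inF by simp
    then show "\<ominus>\<^bsub>S\<^esub> a \<in> h ` F i" using smc[of "\<ominus>\<^bsub>K\<^esub> \<one>\<^bsub>K\<^esub>"] by simp
  qed
  have un: "(\<Union>i. h ` F i) = carrier S"
    using F D(5) by (metis filtration_def image_UN)
  have mu: "a \<otimes>\<^bsub>S\<^esub> b \<in> h ` F (i + j)" if ab: "a \<in> h ` F i" "b \<in> h ` F j" for i j a b
  proof -
    obtain x y where xy: "x \<in> F i" "a = h x" "y \<in> F j" "b = h y" using ab by blast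
    then have "x \<otimes>\<^bsub>R\<^esub> y \<in> F (i + j)" using F by (auto simp: filtration_def)
    then show ?thesis using xy inF D(10)[of x y] by (intro image_eqI[of _ _ "x \<otimes>\<^bsub>R\<^esub> y"]) auto
  qed
  have "\<one>\<^bsub>S\<^esub> \<in> h ` F 0" using F D(7) by (metis filtration_def image_eqI)
  moreover have "h ` F i \<subseteq> h ` F (Suc i)" for i using F by (auto simp: filtration_def)
  ultimately show ?thesis using sm un mu by (simp add: filtration_def)
qed

lemma degree_additive_alg_iso:
  assumes "algebra K R" and h: "h \<in> alg_iso K R S" and F: "filtration K R F"
    and da: "degree_additive R F"
  shows "degree_additive S (\<lambda>i. h ` F i)"
proof -
  interpret R: filtered_algebra K R F
    by (intro filtered_algebra.intro filtered_algebra_axioms.intro assms)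
  note D = alg_isoD[OF h]
  have e: "fext S (\<lambda>i. h ` F i) z = h ` fext R F z" for z by (simp add: fext_def D(6))
  have inj: "h x \<in> h ` fext R F z \<longleftrightarrow> x \<in> fext R F z" if "x \<in> carrier R" for x z
    using that D(4) R.fext_sub by (auto simp: inj_on_def subset_iff)
  show ?thesis unfolding degree_additive_def e
  proof (intro allI impI)
    fix y z a b assume "a \<in> h ` fext R F y - h ` fext R F (y - 1)" "b \<in> h ` fext R F z - h ` fext R F (z - 1)"
    then obtain u v where "u \<in> fext R F y - fext R F (y - 1)" "a = h u"
      "v \<in> fext R F z - fext R F (z - 1)" "b = h v" by blast
    moreover from this have "u \<in> carrier R" "v \<in> carrier R" using R.fext_closed by auto
    ultimately show "a \<otimes>\<^bsub>S\<^esub> b \<notin> h ` fext R F (y + z - 1)"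
      using da D(10)[of u v] inj[of "u \<otimes>\<^bsub>R\<^esub> v"] by (auto simp: degree_additive_def)
  qed
qed

lemma filt_deg_image:
  assumes "inj_on h (carrier R)" "\<And>i. F i \<subseteq> carrier R" "a \<in> carrier R"
  shows "filt_deg (\<lambda>i. h ` F i) (h a) = filt_deg F a"
proof -
  have "h a \<in> h ` F i \<longleftrightarrow> a \<in> F i" for i
    using inj_on_image_mem_iff[OF assms(1) assms(3) assms(2)] by blast
  then show ?thesis by (simp add: filt_deg_def)
qed

section \<open>Algebra homomorphisms\<close>

definition alg_hom ::
  "('k, 'm) ring_scheme \<Rightarrow> ('k, 'a, 'x) module_scheme \<Rightarrow> ('k, 'b, 'y) module_scheme \<Rightarrow> ('a \<Rightarrow> 'b) set"
  where
  "alg_hom K R S = {h. h \<in> ring_hom R S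
     \<and> (\<forall>r\<in>carrier K. \<forall>a\<in>carrier R. h (r \<odot>\<^bsub>R\<^esub> a) = r \<odot>\<^bsub>S\<^esub> h a)}"

lemma alg_homD:
  assumes "h \<in> alg_hom K R S"
  shows "h \<in> ring_hom R S" and "h \<one>\<^bsub>R\<^esub> = \<one>\<^bsub>S\<^esub>"
    and "\<And>x. x \<in> carrier R \<Longrightarrow> h x \<in> carrier S"
    and "\<And>x y. \<lbrakk>x \<in> carrier R; y \<in> carrier R\<rbrakk> \<Longrightarrow> h (x \<oplus>\<^bsub>R\<^esub> y) = h x \<oplus>\<^bsub>S\<^esub> h y"
    and "\<And>x y. \<lbrakk>x \<in> carrier R; y \<in> carrier R\<rbrakk> \<Longrightarrow> h (x \<otimes>\<^bsub>R\<^esub> y) = h x \<otimes>\<^bsub>S\<^esub> h y"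
    and "\<And>r x. \<lbrakk>r \<in> carrier K; x \<in> carrier R\<rbrakk> \<Longrightarrow> h (r \<odot>\<^bsub>R\<^esub> x) = r \<odot>\<^bsub>S\<^esub> h x"
  using assms by (auto simp: alg_hom_def ring_hom_def)

lemma alg_hom_comp:
  assumes "h \<in> alg_hom K R S" "g \<in> alg_hom K S T" shows "(\<lambda>x. g (h x)) \<in> alg_hom K R T"
  using ring_hom_trans[OF alg_homD(1)[OF assms(1)] alg_homD(1)[OF assms(2)]]
  by (simp add: alg_hom_def comp_def alg_homD(3,6)[OF assms(1)] alg_homD(6)[OF assms(2)])

lemma alg_iso_alg_hom: "h \<in> alg_iso K R S \<Longrightarrow> h \<in> alg_hom K R S"
  by (simp add: alg_hom_def alg_iso_def ring_iso_def)

lemma alg_hom_inv: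
  assumes "algebra K R" and h: "h \<in> alg_iso K R S"
  shows "inv_into (carrier R) h \<in> alg_hom K S R"
proof -
  interpret R: algebra K R by fact
  let ?g = "inv_into (carrier R) h"
  note D = alg_isoD[OF h]
  have "ring R" using R.M_cring by (simp add: cring_def)
  then have "?g \<in> ring_hom S R" using ring_iso_inv_into[OF _ D(1)] by (simp add: ring_iso_def)
  moreover have "?g (r \<odot>\<^bsub>S\<^esub> a) = r \<odot>\<^bsub>R\<^esub> ?g a" if "r \<in> carrier K" "a \<in> carrier S" for r a
  proof -
    have "a \<in> h ` carrier R" using D(5) that(2) by simp
    from inv_into_into[OF this] f_inv_into_f[OF this] show ?thesis using inv_into_f_f[OF D(4), of "r \<odot>\<^bsub>R\<^esub> ?g a"] D(11)[of r "?g a"] that by simp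
  qed
  ultimately show ?thesis by (simp add: alg_hom_def)
qed

lemma alg_hom_lincomb:
  assumes "algebra K R" "algebra K S" and h: "h \<in> alg_hom K R S"
    and "finite I" "\<And>i. i \<in> I \<Longrightarrow> c i \<in> carrier K" "\<And>i. i \<in> I \<Longrightarrow> y i \<in> carrier R"
  shows "h (\<Oplus>\<^bsub>R\<^esub> i\<in>I. c i \<odot>\<^bsub>R\<^esub> y i) = (\<Oplus>\<^bsub>S\<^esub> i\<in>I. c i \<odot>\<^bsub>S\<^esub> h (y i))"
proof -
  interpret R: algebra K R by fact
  interpret S: algebra K S by fact
  note D = alg_homD[OF h]
  have z: "h \<zero>\<^bsub>R\<^esub> = \<zero>\<^bsub>S\<^esub>"
    using ring_hom_zero[OF D(1)] R.M_cring S.M_cring by (simp add: cring_def)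
  show ?thesis using assms(4-6)
  proof (induction I rule: finite_induct)
    case (insert i I)
    have "(\<lambda>i. c i \<odot>\<^bsub>R\<^esub> y i) \<in> I \<rightarrow> carrier R" "c i \<odot>\<^bsub>R\<^esub> y i \<in> carrier R"
      "(\<lambda>i. c i \<odot>\<^bsub>S\<^esub> h (y i)) \<in> I \<rightarrow> carrier S" "c i \<odot>\<^bsub>S\<^esub> h (y i) \<in> carrier S"
      using insert.prems D(3) by auto
    moreover from this have "(\<Oplus>\<^bsub>R\<^esub> i\<in>I. c i \<odot>\<^bsub>R\<^esub> y i) \<in> carrier R" by (intro R.M.finsum_closed)
    ultimately show ?case
      using insert D(4,6) by (simp add: R.M.finsum_insert S.M.finsum_insert)
  qed (simp add: z)
qed

lemma alg_hom_mpoly_eval: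
  assumes "algebra K R" "algebra K S" and h: "h \<in> alg_hom K R S"
    and x: "x ` {..<n} \<subseteq> carrier R" and p: "p \<in> mpoly_carrier K n"
  shows "h (mpoly_eval K R x p) = mpoly_eval K S (\<lambda>i. h (x i)) p"
proof -
  interpret R: algebra K R by fact
  interpret S: algebra K S by fact
  interpret R: cring R by (rule R.M_cring)
  interpret S: cring S by (rule S.M_cring)
  interpret h: ring_hom_cring R S h
    by (rule ring_hom_cringI[OF R.M_cring S.M_cring alg_homD(1)[OF h]])
  let ?I = "{M. p M \<noteq> \<zero>\<^bsub>K\<^esub>}"
  have I: "finite ?I" "\<And>M. p M \<in> carrier K" "\<And>M. M \<in> ?I \<Longrightarrow> set_mset M \<subseteq> {..<n}"
    using p by (auto simp: mpoly_carrier_def)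
  have pr: "(\<Otimes>\<^bsub>R\<^esub> i\<in>J. x i [^]\<^bsub>R\<^esub> count M i) \<in> carrier R \<and>
      h (\<Otimes>\<^bsub>R\<^esub> i\<in>J. x i [^]\<^bsub>R\<^esub> count M i) = (\<Otimes>\<^bsub>S\<^esub> i\<in>J. h (x i) [^]\<^bsub>S\<^esub> count M i)"
    if "finite J" "J \<subseteq> {..<n}" for J M
    using that
  proof (induction J rule: finite_induct)
    case (insert i J)
    have "x i \<in> carrier R" "\<And>j. j \<in> J \<Longrightarrow> x j \<in> carrier R" using insert.prems x by auto
    moreover from this have "(\<lambda>i. x i [^]\<^bsub>R\<^esub> count M i) \<in> J \<rightarrow> carrier R"
      "(\<lambda>i. h (x i) [^]\<^bsub>S\<^esub> count M i) \<in> J \<rightarrow> carrier S" by auto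
    ultimately show ?case using insert by simp
  qed simp
  have "h (mpoly_eval K R x p)
    = (\<Oplus>\<^bsub>S\<^esub> M\<in>?I. p M \<odot>\<^bsub>S\<^esub> h (\<Otimes>\<^bsub>R\<^esub> i\<in>set_mset M. x i [^]\<^bsub>R\<^esub> count M i))"
    unfolding mpoly_eval_def
    by (rule alg_hom_lincomb[OF assms(1-3) I(1)]) (use I(2,3) pr in auto)
  also have "\<dots> = mpoly_eval K S (\<lambda>i. h (x i)) p"
    unfolding mpoly_eval_def
  proof (rule S.finsum_cong')
    fix M assume M: "M \<in> ?I"
    then show "p M \<odot>\<^bsub>S\<^esub> h (\<Otimes>\<^bsub>R\<^esub> i\<in>set_mset M. x i [^]\<^bsub>R\<^esub> count M i)
      = p M \<odot>\<^bsub>S\<^esub> (\<Otimes>\<^bsub>S\<^esub> i\<in>set_mset M. h (x i) [^]\<^bsub>S\<^esub> count M i)"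
      using pr[of "set_mset M" M] I(3) by simp
  next
    show "(\<lambda>M. p M \<odot>\<^bsub>S\<^esub> (\<Otimes>\<^bsub>S\<^esub> i\<in>set_mset M. h (x i) [^]\<^bsub>S\<^esub> count M i)) \<in> ?I \<rightarrow> carrier S"
    proof
      fix M assume M: "M \<in> ?I"
      have "h (\<Otimes>\<^bsub>R\<^esub> i\<in>set_mset M. x i [^]\<^bsub>R\<^esub> count M i) \<in> carrier S"
        using pr[of "set_mset M" M] I(3)[OF M] by (intro h.hom_closed) simp
      then have "(\<Otimes>\<^bsub>S\<^esub> i\<in>set_mset M. h (x i) [^]\<^bsub>S\<^esub> count M i) \<in> carrier S"
        using pr[of "set_mset M" M] I(3)[OF M] by simp
      then show "p M \<odot>\<^bsub>S\<^esub> (\<Otimes>\<^bsub>S\<^esub> i\<in>set_mset M. h (x i) [^]\<^bsub>S\<^esub> count M i) \<in> carrier S"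
        by (rule S.smult_closed[OF I(2)])
    qed
  qed simp
  finally show ?thesis .
qed

lemma indep_mod_scalars_pullback:
  assumes "algebra K R" "algebra K S" and h: "h \<in> alg_hom K R S"
    and y: "y ` {..<n} \<subseteq> carrier R" and ind: "indep_mod_scalars K S n x"
    and hy: "\<And>i. i < n \<Longrightarrow> h (y i) = x i"
  shows "indep_mod_scalars K R n y"
  unfolding indep_mod_scalars_def
proof (intro allI impI)
  interpret R: algebra K R by fact
  interpret R: cring R by (rule R.M_cring)
  fix c r i
  assume c: "c ` {..<n} \<subseteq> carrier K" and r: "r \<in> carrier K"
    and e: "(\<Oplus>\<^bsub>R\<^esub> i\<in>{..<n}. c i \<odot>\<^bsub>R\<^esub> y i) = r \<odot>\<^bsub>R\<^esub> \<one>\<^bsub>R\<^esub>" and i: "i < n"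
  interpret S: algebra K S by fact
  have "(\<Oplus>\<^bsub>S\<^esub> i\<in>{..<n}. c i \<odot>\<^bsub>S\<^esub> x i) = (\<Oplus>\<^bsub>S\<^esub> i\<in>{..<n}. c i \<odot>\<^bsub>S\<^esub> h (y i))"
    by (rule S.M.finsum_cong') (use c y alg_homD(3)[OF h] in \<open>auto simp: hy[symmetric]\<close>)
  also have "\<dots> = h (\<Oplus>\<^bsub>R\<^esub> i\<in>{..<n}. c i \<odot>\<^bsub>R\<^esub> y i)"
    by (rule alg_hom_lincomb[OF assms(1-3), symmetric]) (use c y in auto)
  also have "\<dots> = r \<odot>\<^bsub>S\<^esub> \<one>\<^bsub>S\<^esub>"
    unfolding e using alg_homD(2,6)[OF h] r by simp
  finally show "c i = \<zero>\<^bsub>K\<^esub>" using ind c r i unfolding indep_mod_scalars_def by blast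
qed

lemma ring_hom_upa: "ring_hom (upa R) S = ring_hom (UP R) S" "ring_hom S (upa R) = ring_hom S (UP R)"
  by (auto simp: ring_hom_def UP_carrier)

lemma alg_hom_cst:
  assumes "algebra K A" shows "(\<lambda>a. cst A a) \<in> alg_hom K A (upa A)"
proof -
  interpret A: algebra K A by fact
  interpret U: UP_cring A "UP A" by (simp_all add: UP_cringI A.M_cring)
  have "cst A (r \<odot>\<^bsub>A\<^esub> a) = (\<lambda>i. r \<odot>\<^bsub>A\<^esub> cst A a i)" if "r \<in> carrier K" "a \<in> carrier A" for r a
    using that by (auto simp: UP_monom)
  then show ?thesis using U.const_ring_hom by (simp add: alg_hom_def ring_hom_upa)
qed

lemma alg_hom_zeroth_coeff:
  assumes "algebra K A" shows "(\<lambda>p. p 0) \<in> alg_hom K (upa A) A"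
proof -
  interpret A: algebra K A by fact
  show ?thesis using UP_ring_hom_zeroth_coeff[OF A.M_cring] by (simp add: alg_hom_def ring_hom_upa)
qed

text \<open>Linearity over \<open>K\<close> can be tested on the scalar multiples of one.\<close>

lemma alg_homI_one:
  assumes "algebra K R" "algebra K S" and h: "h \<in> ring_hom R S"
    and one: "\<And>r. r \<in> carrier K \<Longrightarrow> h (r \<odot>\<^bsub>R\<^esub> \<one>\<^bsub>R\<^esub>) = r \<odot>\<^bsub>S\<^esub> \<one>\<^bsub>S\<^esub>"
  shows "h \<in> alg_hom K R S"
proof -
  interpret R: algebra K R by fact
  interpret S: algebra K S by fact
  interpret R: cring R by (rule R.M_cring)
  interpret S: cring S by (rule S.M_cring)
  have "h (r \<odot>\<^bsub>R\<^esub> a) = r \<odot>\<^bsub>S\<^esub> h a" if "r \<in> carrier K" "a \<in> carrier R" for r a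
  proof -
    have "h (r \<odot>\<^bsub>R\<^esub> a) = h ((r \<odot>\<^bsub>R\<^esub> \<one>\<^bsub>R\<^esub>) \<otimes>\<^bsub>R\<^esub> a)" using that by (simp add: R.smult_assoc2)
    also have "\<dots> = (r \<odot>\<^bsub>S\<^esub> \<one>\<^bsub>S\<^esub>) \<otimes>\<^bsub>S\<^esub> h a" using that one ring_hom_memE(2)[OF h] by simp
    also have "\<dots> = r \<odot>\<^bsub>S\<^esub> h a" using that ring_hom_memE(1)[OF h] by (simp add: S.smult_assoc2)
    finally show ?thesis .
  qed
  with h show ?thesis by (simp add: alg_hom_def)
qed

lemma generates_subalg:
  assumes "generates K A S" "subalg K A W" "S \<subseteq> W" shows "carrier A \<subseteq> W"
  using assms hull_minimal[of S W "subalg K A"] by (auto simp: generates_def)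

text \<open>Together with \<open>generates_subalg\<close>, the next two lemmas reduce statements about all elements of an
  algebra to statements about generators.\<close>

lemma subalg_vimage:
  assumes "algebra K R" "algebra K S" and h: "h \<in> alg_hom K R S" and W: "subalg K S W"
  shows "subalg K R {x \<in> carrier R. h x \<in> W}"
proof -
  interpret R: algebra K R by fact
  interpret S: algebra K S by fact
  note D = alg_homD[OF h]
  have sr: "subring W S" and sm: "submodule W K S" using W by (auto simp: subalg_def)
  have z: "h \<zero>\<^bsub>R\<^esub> = \<zero>\<^bsub>S\<^esub>"
    using ring_hom_zero[OF D(1)] R.M_cring S.M_cring by (simp add: cring_def)
  have neg: "h (\<ominus>\<^bsub>R\<^esub> x) = \<ominus>\<^bsub>S\<^esub> h x" if "x \<in> carrier R" for x
  proof -
    have "\<ominus>\<^bsub>R\<^esub> x = (\<ominus>\<^bsub>K\<^esub> \<one>\<^bsub>K\<^esub>) \<odot>\<^bsub>R\<^esub> x"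
      using R.smult_l_minus[of "\<one>\<^bsub>K\<^esub>" x] that by simp
    then have "h (\<ominus>\<^bsub>R\<^esub> x) = (\<ominus>\<^bsub>K\<^esub> \<one>\<^bsub>K\<^esub>) \<odot>\<^bsub>S\<^esub> h x"
      using D(6)[of "\<ominus>\<^bsub>K\<^esub> \<one>\<^bsub>K\<^esub>" x] that by simp
    then show ?thesis using S.smult_l_minus[of "\<one>\<^bsub>K\<^esub>" "h x"] D(3)[OF that] by simp
  qed
  note E = subringE[OF sr]
  have "subring {x \<in> carrier R. h x \<in> W} R"
    by (rule R.subringI) (auto simp: D E neg)
  moreover have "submodule {x \<in> carrier R. h x \<in> W} K R"
    by (rule R.submoduleI) (auto simp: D E neg z S.submoduleE[OF sm])
  ultimately show ?thesis by (simp add: subalg_def)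
qed

lemma subalg_image:
  assumes "algebra K R" "algebra K S" and h: "h \<in> alg_hom K R S"
  shows "subalg K S (h ` carrier R)"
proof -
  interpret R: algebra K R by fact
  interpret S: algebra K S by fact
  note D = alg_homD[OF h]
  let ?W = "h ` carrier R"
  have sub: "?W \<subseteq> carrier S" using D(3) by blast
  have one: "\<one>\<^bsub>S\<^esub> \<in> ?W" using D(2) R.one_closed by (metis image_eqI)
  have add: "a \<oplus>\<^bsub>S\<^esub> b \<in> ?W" "a \<otimes>\<^bsub>S\<^esub> b \<in> ?W" if "a \<in> ?W" "b \<in> ?W" for a b
    using that by (auto simp: D(4,5)[symmetric])
  have sm: "r \<odot>\<^bsub>S\<^esub> a \<in> ?W" if "r \<in> carrier K" "a \<in> ?W" for r a
    using that by (auto simp: D(6)[symmetric])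
  have neg: "\<ominus>\<^bsub>S\<^esub> a \<in> ?W" if "a \<in> ?W" for a
    using sm[of "\<ominus>\<^bsub>K\<^esub> \<one>\<^bsub>K\<^esub>" a] that subsetD[OF sub] S.smult_l_minus[of "\<one>\<^bsub>K\<^esub>" a] by simp
  have zero: "\<zero>\<^bsub>S\<^esub> \<in> ?W" using add(1)[OF one neg[OF one]] by (simp add: S.r_neg)
  have "subring ?W S" by (rule S.subringI[OF sub one neg add(2,1)])
  moreover have "submodule ?W K S" by (rule S.submoduleI[OF sub zero neg add(1) sm])
  ultimately show ?thesis by (simp add: subalg_def)
qed

section \<open>Perturbing the inverse of an isomorphism of polynomial rings\<close>

text \<open>Let \<open>\<psi>: D[t] \<rightarrow> C[t]\<close> be a homomorphism. Moving the image of \<open>t\<close> from \<open>\<psi>(t)\<close> to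
  \<open>\<psi>(t) + t\<^sup>N\<close> changes nothing on \<open>D\<close> and nothing modulo \<open>t\<^sup>N\<close>. But if \<open>\<psi>\<close> is
  injective and \<open>C\<close> is a domain, it makes the image of any given nonconstant polynomial
  nonconstant for some large \<open>N\<close>.\<close>

definition perturb ::
  "('b, 'n) ring_scheme \<Rightarrow> ('a, 'm) ring_scheme \<Rightarrow> ((nat \<Rightarrow> 'b) \<Rightarrow> nat \<Rightarrow> 'a) \<Rightarrow> nat \<Rightarrow> (nat \<Rightarrow> 'b) \<Rightarrow> nat \<Rightarrow> 'a"
  where
  "perturb D C \<psi> N = eval D (UP C) (\<lambda>b. \<psi> (cst D b)) (\<psi> (indet D) \<oplus>\<^bsub>UP C\<^esub> up_ring.monom (UP C) \<one>\<^bsub>C\<^esub> N)"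

locale up_hom = C: cring C + D: cring D
  for C :: "('a, 'm) ring_scheme" (structure) and D :: "('b, 'n) ring_scheme" (structure) +
  fixes \<psi> :: "(nat \<Rightarrow> 'b) \<Rightarrow> nat \<Rightarrow> 'a"
  assumes \<psi>: "\<psi> \<in> ring_hom (UP D) (UP C)"
begin

sublocale PC: UP_cring C "UP C" by (simp_all add: UP_cringI C.cring_axioms)
sublocale PD: UP_cring D "UP D" by (simp_all add: UP_cringI D.cring_axioms)

abbreviation \<sigma> :: "nat \<Rightarrow> nat \<Rightarrow> 'a" where
  "\<sigma> N \<equiv> \<psi> (indet D) \<oplus>\<^bsub>UP C\<^esub> up_ring.monom (UP C) \<one>\<^bsub>C\<^esub> N"

lemma \<psi>_closed: "p \<in> carrier (UP D) \<Longrightarrow> \<psi> p \<in> carrier (UP C)"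
  by (rule ring_hom_memE(1)[OF \<psi>])

lemma const_hom: "(\<lambda>b. \<psi> (cst D b)) \<in> ring_hom D (UP C)"
  using ring_hom_trans[OF PD.const_ring_hom \<psi>] by (simp add: comp_def)

lemma \<sigma>_closed: "\<sigma> N \<in> carrier (UP C)"
  using \<psi>_closed by simp

lemma univ: "UP_pre_univ_prop D (UP C) (\<lambda>b. \<psi> (cst D b))"
  by (rule UP_pre_univ_propI[OF D.cring_axioms PC.UP_cring const_hom])

lemma perturb_hom: "perturb D C \<psi> N \<in> ring_hom (UP D) (UP C)"
  unfolding perturb_def by (rule UP_pre_univ_prop.eval_ring_hom[OF univ \<sigma>_closed])

lemma perturb_const: "b \<in> carrier D \<Longrightarrow> perturb D C \<psi> N (cst D b) = \<psi> (cst D b)"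
  unfolding perturb_def by (rule UP_pre_univ_prop.eval_const[OF univ \<sigma>_closed])

lemma perturb_indet: "perturb D C \<psi> N (indet D) = \<sigma> N"
  using UP_pre_univ_prop.eval_monom1[OF univ \<sigma>_closed] by (simp add: perturb_def)

text \<open>Taking constant coefficients makes either side a homomorphism from \<open>D[t]\<close> to \<open>C\<close>. The two
  agree on \<open>D\<close>, and on \<open>t\<close> because \<open>t\<^sup>N\<close> has constant coefficient zero.\<close>

lemma perturb_zeroth:
  assumes "N > 0" "p \<in> carrier (UP D)"
  shows "perturb D C \<psi> N p 0 = \<psi> p 0"
proof -
  have z: "(\<lambda>p. p 0) \<in> ring_hom (UP C) C" by (rule UP_ring_hom_zeroth_coeff[OF C.cring_axioms])
  have g: "(\<lambda>b. \<psi> (cst D b) 0) \<in> ring_hom D C"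
    using ring_hom_trans[OF const_hom z] by (simp add: comp_def)
  interpret U: UP_pre_univ_prop D C "\<lambda>b. \<psi> (cst D b) 0" "UP D"
    by (simp_all add: UP_pre_univ_propI[OF D.cring_axioms C.cring_axioms g])
  have e1: "\<sigma> N 0 = \<psi> (indet D) 0"
  proof -
    have "\<psi> (indet D) \<in> carrier (UP C)" "up_ring.monom (UP C) \<one>\<^bsub>C\<^esub> N \<in> carrier (UP C)"
      by (simp_all add: \<psi>_closed)
    then have "\<psi> (indet D) \<in> up C" "up_ring.monom (UP C) \<one>\<^bsub>C\<^esub> N \<in> up C"
      by (simp_all only: UP_carrier)
    then show ?thesis using assms(1) by (simp add: UP_add UP_monom[of "\<one>\<^bsub>C\<^esub>"] mem_upD)
  qed
  have h: "(\<lambda>p. perturb D C \<psi> N p 0) \<in> ring_hom (UP D) C" "(\<lambda>p. \<psi> p 0) \<in> ring_hom (UP D) C"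
    using ring_hom_trans[OF perturb_hom z] ring_hom_trans[OF \<psi> z] by (simp_all add: comp_def)
  have c: "\<psi> (indet D) 0 \<in> carrier C"
  proof -
    have "\<psi> (indet D) \<in> carrier (UP C)" by (simp add: \<psi>_closed)
    then show ?thesis by (simp only: UP_carrier mem_upD)
  qed
  show ?thesis
  proof (rule U.UP_hom_unique[OF U.ring_homD[OF h(1)] _ _ U.ring_homD[OF h(2)] refl refl assms(2) c])
    show "perturb D C \<psi> N (indet D) 0 = \<psi> (indet D) 0" by (simp only: perturb_indet e1)
    show "perturb D C \<psi> N (cst D r) 0 = \<psi> (cst D r) 0" if "r \<in> carrier D" for r
      by (simp only: perturb_const[OF that])
  qed
qed

end

text \<open>Let \<open>m = deg p\<close> and let \<open>N\<close> exceed the degrees of \<open>\<psi>(t)\<close> and of all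
  \<open>\<psi>(p\<^sub>j)\<close>. The summand \<open>\<psi>(p\<^sub>m) (\<psi>(t) + t\<^sup>N)\<^sup>m\<close> of the image has degree at least
  \<open>N m\<close>, and the other summands have degree less than \<open>N (m - 1) + N = N m\<close>.\<close>

lemma perturb_nonconst:
  assumes dom: "domain C" and "cring D" and \<psi>: "\<psi> \<in> ring_hom (UP D) (UP C)"
    and inj: "inj_on \<psi> (carrier (UP D))"
    and p: "p \<in> carrier (UP D)" and deg: "deg D p > 0"
  shows "\<exists>N>0. deg C (perturb D C \<psi> N p) > 0"
proof -
  interpret D: cring D by fact
  interpret C: "domain" C by fact
  interpret up_hom C D \<psi> by (intro up_hom.intro up_hom_axioms.intro C.is_cring assms)
  interpret UC: UP_domain C "UP C" by (simp_all add: UP_domain_def dom)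
  let ?m = "deg D p" and ?g = "\<lambda>j. \<psi> (cst D (up_ring.coeff (UP D) p j))"
  have gc: "?g j \<in> carrier (UP C)" for j using p \<psi>_closed by simp
  let ?M = "Max (insert (deg C (\<psi> (indet D))) ((\<lambda>j. deg C (?g j)) ` {..?m}))"
  define N where "N = Suc ?M"
  have N: "deg C (\<psi> (indet D)) < N" "\<And>j. j \<le> ?m \<Longrightarrow> deg C (?g j) < N"
  proof -
    show "deg C (\<psi> (indet D)) < N" unfolding N_def less_Suc_eq_le by (rule Max_ge) simp_all
    show "deg C (?g j) < N" if "j \<le> ?m" for j
      unfolding N_def less_Suc_eq_le by (rule Max_ge) (use that in simp_all)
  qed
  have co: "up_ring.coeff (UP C) (\<sigma> N) N = \<one>\<^bsub>C\<^esub>"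
    using \<psi>_closed[of "indet D"] N(1) by (simp add: PC.deg_aboveD)
  have degs: "deg C (\<sigma> N) = N"
  proof (rule antisym)
    show "deg C (\<sigma> N) \<le> N"
    proof (rule PC.deg_aboveI)
      fix m assume "N < m"
      then show "up_ring.coeff (UP C) (\<sigma> N) m = \<zero>\<^bsub>C\<^esub>"
        using \<psi>_closed[of "indet D"] N(1) by (simp add: PC.deg_aboveD)
    qed (rule \<sigma>_closed)
    show "N \<le> deg C (\<sigma> N)" by (rule PC.deg_belowI) (simp_all add: co \<sigma>_closed del: PC.coeff_add)
  qed
  have "N > 0" by (simp add: N_def)
  then have snz: "\<sigma> N \<noteq> \<zero>\<^bsub>UP C\<^esub>" using degs PC.deg_zero by force
  have powc: "\<sigma> N [^]\<^bsub>UP C\<^esub> (j::nat) \<in> carrier (UP C)" for j using \<sigma>_closed by simp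
  have pow: "deg C (\<sigma> N [^]\<^bsub>UP C\<^esub> (j::nat)) = N * j" for j
    using deg_pow[OF dom \<sigma>_closed snz] degs by simp
  have pownz: "\<sigma> N [^]\<^bsub>UP C\<^esub> (j::nat) \<noteq> \<zero>\<^bsub>UP C\<^esub>" for j
    using \<sigma>_closed[of N] snz by (induction j) (auto simp: UC.integral_iff)
  let ?s = "\<lambda>j. ?g j \<otimes>\<^bsub>UP C\<^esub> \<sigma> N [^]\<^bsub>UP C\<^esub> j"
  have e: "perturb D C \<psi> N p = (\<Oplus>\<^bsub>UP C\<^esub> j\<in>{..?m}. ?s j)"
    unfolding perturb_def eval_def using p by simp
  have lead: "?g ?m \<noteq> \<zero>\<^bsub>UP C\<^esub>"
  proof
    assume "?g ?m = \<zero>\<^bsub>UP C\<^esub>"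
    also have "\<dots> = \<psi> \<zero>\<^bsub>UP D\<^esub>"
      using ring_hom_zero[OF \<psi> PD.UP_ring PC.UP_ring] by simp
    finally have "cst D (up_ring.coeff (UP D) p ?m) = \<zero>\<^bsub>UP D\<^esub>"
      using inj p by (auto dest: inj_onD)
    then have "cst D (up_ring.coeff (UP D) p ?m) = cst D \<zero>\<^bsub>D\<^esub>" by simp
    then have "up_ring.coeff (UP D) p ?m = \<zero>\<^bsub>D\<^esub>" using inj_onD[OF PD.monom_inj[of 0]] p by simp
    then show False using PD.lcoeff_nonzero_deg[OF _ p] deg by simp
  qed
  have top: "deg C (?s ?m) = deg C (?g ?m) + N * ?m"
    using UC.deg_mult[OF lead pownz gc powc] pow by simp
  have "deg C (?s j) < deg C (?s ?m)" if "j < ?m" for j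
  proof -
    have "deg C (?s j) \<le> deg C (?g j) + N * j" using PC.deg_mult_ring[OF gc powc] pow by metis
    also have "\<dots> < N * Suc j" using N(2)[of j] that by simp
    also have "\<dots> \<le> N * ?m" using that by (intro mult_le_mono2) simp
    finally show ?thesis using top by simp
  qed
  then have "deg C (?s ?m) \<le> deg C (perturb D C \<psi> N p)"
    unfolding e using gc powc by (intro deg_finsum_dominant C.is_cring) auto
  moreover have "deg C (?s ?m) > 0" using top \<open>N > 0\<close> deg by simp
  ultimately show ?thesis using \<open>N > 0\<close> by auto
qed

section \<open>Effective elements pin down the coefficient algebra\<close>

text \<open>It suffices to treat the generators \<open>x\<^sub>i\<close>. If \<open>\<phi>(x\<^sub>i)\<close> is not constant, then
  the elements \<open>y\<^sub>j = H(\<phi>(x\<^sub>j))\<close> of \<open>C[t]\<close>, with \<open>H\<close> a perturbation of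
  \<open>\<phi>\<inverse>\<close>, contradict the effectiveness of \<open>f\<close>: constant coefficients form a homomorphism
  that takes \<open>y\<^sub>j\<close> to \<open>x\<^sub>j\<close>, which gives the independence and the lower bounds on the
  degrees, while \<open>f(y) = H(\<phi>(f)) = f\<close>, since \<open>H\<close> and \<open>\<phi>\<inverse>\<close> agree on
  constants.\<close>

theorem effective_imp_constants:
  fixes C :: "('k, 'u) poisson_alg" and D :: "('k, 'b, 'y) poisson_alg_scheme"
  assumes inf: "infinite (UNIV :: 'u set)"
    and algC: "algebra K C" and dom: "domain C" and algD: "algebra K D"
    and \<phi>: "\<phi> \<in> alg_iso K (upa C) (upa D)"
    and eff: "effective K C f" and b: "b \<in> carrier D" "\<phi> (cst C f) = cst D b"
    and c: "c \<in> carrier C"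
  shows "\<exists>b'\<in>carrier D. \<phi> (cst C c) = cst D b'"
proof -
  interpret C: algebra K C by fact
  interpret D: algebra K D by fact
  interpret UC: UP_cring C "UP C" by (simp_all add: UP_cringI C.M_cring)
  interpret UD: UP_cring D "UP D" by (simp_all add: UP_cringI D.M_cring)
  have aC: "algebra K (upa C)" and aD: "algebra K (upa D)" by (rule algebra_upa; fact)+
  note P = alg_isoD[OF \<phi>, simplified]
  define \<psi> where "\<psi> = inv_into (up C) \<phi>"
  have \<psi>h: "\<psi> \<in> alg_hom K (upa D) (upa C)"
    using alg_hom_inv[OF aC \<phi>] by (simp add: \<psi>_def)
  have \<psi>\<phi>: "\<psi> (\<phi> p) = p" if "p \<in> up C" for p
    using P(4) that by (simp add: \<psi>_def)
  have \<psi>inj: "inj_on \<psi> (carrier (UP D))"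
    using inj_on_inv_into[of "carrier (UP D)" \<phi> "up C"] P(5) by (simp add: \<psi>_def UP_carrier)
  have \<psi>ring: "\<psi> \<in> ring_hom (UP D) (UP C)" using alg_homD(1)[OF \<psi>h] by (simp add: ring_hom_upa)
  interpret up_hom C D \<psi> by (intro up_hom.intro up_hom_axioms.intro C.M_cring D.M_cring \<psi>ring)
  note cstC = alg_hom_cst[OF algC] and cstD = alg_hom_cst[OF algD]
  have \<phi>h: "\<phi> \<in> alg_hom K (upa C) (upa D)" by (rule alg_iso_alg_hom[OF \<phi>])
  note \<phi>c = alg_hom_comp[OF cstC \<phi>h]
  from eff obtain n x F where f: "f \<in> carrier C" "f \<noteq> \<zero>\<^bsub>C\<^esub>"
    and gen: "generates K C (x ` {..<n})" and ind: "indep_mod_scalars K C n x"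
    and F: "filtration K C F" and grF: "domain (assoc_graded C F)"
    and test: "\<And>(T :: ('k, 'u) module) G y.
            algebra K T \<and> filtration K T G \<and> domain (assoc_graded T G)
            \<and> y ` {..<n} \<subseteq> carrier T \<and> indep_mod_scalars K T n y
            \<and> (\<forall>i<n. filt_deg G (y i) \<ge> filt_deg F (x i))
            \<and> (\<exists>i<n. filt_deg G (y i) > filt_deg F (x i))
            \<Longrightarrow> (\<exists>p\<in>mpoly_carrier K n. mpoly_eval K C x p = f
                  \<and> (mpoly_eval K T y p = \<zero>\<^bsub>T\<^esub>
                     \<or> filt_deg G (mpoly_eval K T y p) > filt_deg F f))"
    unfolding effective_def by metis
  have xc: "x ` {..<n} \<subseteq> carrier C" using gen by (simp add: generates_def)
  let ?W = "{c \<in> carrier C. \<phi> (cst C c) \<in> (\<lambda>b. cst D b) ` carrier D}"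
  have W: "subalg K C ?W"
    by (rule subalg_vimage[OF algC aD \<phi>c subalg_image[OF algD aD cstD]])
  have "x i \<in> ?W" if i: "i < n" for i
  proof (rule ccontr)
    assume no: "x i \<notin> ?W"
    let ?p = "\<phi> (cst C (x i))"
    have xi: "x i \<in> carrier C" using xc i by auto
    have p: "?p \<in> carrier (UP D)" using alg_homD(3)[OF \<phi>c xi] by (simp add: UP_carrier)
    have "deg D ?p > 0"
    proof (rule ccontr)
      assume "\<not> deg D ?p > 0"
      then have "?p = cst D (up_ring.coeff (UP D) ?p 0)" using UD.deg_zero_impl_monom[OF p] by simp
      then show False using no xi p UD.coeff_closed[of ?p 0] by auto
    qed
    then obtain N where N: "N > 0" "deg C (perturb D C \<psi> N ?p) > 0"
      using perturb_nonconst[OF dom D.M_cring \<psi>ring \<psi>inj p] by blast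
    let ?H = "perturb D C \<psi> N"
    have Hh: "?H \<in> alg_hom K (upa D) (upa C)"
    proof (rule alg_homI_one[OF aD aC])
      show "?H \<in> ring_hom (upa D) (upa C)" using perturb_hom by (simp add: ring_hom_upa)
      fix r assume r: "r \<in> carrier K"
      have "r \<odot>\<^bsub>upa D\<^esub> \<one>\<^bsub>upa D\<^esub> = cst D (r \<odot>\<^bsub>D\<^esub> \<one>\<^bsub>D\<^esub>)"
        using alg_homD(2,6)[OF cstD] r D.one_closed by metis
      moreover have "\<psi> (r \<odot>\<^bsub>upa D\<^esub> \<one>\<^bsub>upa D\<^esub>) = r \<odot>\<^bsub>upa C\<^esub> \<one>\<^bsub>upa C\<^esub>"
        using alg_homD(2,6)[OF \<psi>h] r UD.UP_one_closed by (simp add: UP_carrier del: upa_simps(6))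
      ultimately show "?H (r \<odot>\<^bsub>upa D\<^esub> \<one>\<^bsub>upa D\<^esub>) = r \<odot>\<^bsub>upa C\<^esub> \<one>\<^bsub>upa C\<^esub>"
        using perturb_const[of "r \<odot>\<^bsub>D\<^esub> \<one>\<^bsub>D\<^esub>" N] r by (simp del: upa_simps)
    qed
    note Y = alg_hom_comp[OF \<phi>c Hh]
    let ?Y = "\<lambda>a. ?H (\<phi> (cst C a))"
    have Y0: "?Y a 0 = a" if "a \<in> carrier C" for a
    proof -
      have "\<phi> (cst C a) \<in> carrier (UP D)" using alg_homD(3)[OF \<phi>c that] by (simp add: UP_carrier)
      moreover have "cst C a \<in> up C" using UC.monom_closed[OF that] by (simp add: UP_carrier)
      ultimately show ?thesis using perturb_zeroth[OF N(1)] \<psi>\<phi> that by (simp add: UP_monom)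
    qed
    \<comment> \<open>With this weight, merely involving the variable raises the degree above that of \<open>x\<^sub>i\<close>.\<close>
    define \<alpha> where "\<alpha> = Suc (filt_deg F (x i))"
    interpret FC: filtered_upa K C F \<alpha>
      by (intro filtered_upa.intro filtered_upa_axioms.intro filtered_algebra.intro
          filtered_algebra_axioms.intro algC F) (simp add: \<alpha>_def)
    let ?G = "poly_filt C F \<alpha>"
    obtain e :: "(nat \<Rightarrow> 'u) \<Rightarrow> 'u" where e: "inj_on e (up C)"
      using inj_up_into_infinite[OF inf] by blast
    \<comment> \<open>The test algebra is a copy of \<open>C[t]\<close> on the type \<open>'u\<close>.\<close>
    define T :: "('k, 'u) module" where "T = module.truncate (transport e (upa C))"
    have eT: "e \<in> alg_iso K (upa C) T"
    proof -
      have "e \<in> alg_iso K (upa C) (transport e (upa C))"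
        by (rule poisson_iso_alg_iso[OF transport_iso]) (simp_all add: e)
      then show ?thesis
        by (simp add: alg_iso_def ring_iso_def ring_hom_def T_def module.truncate_def del: upa_simps)
    qed
    have aT: "algebra K T" by (rule algebra_alg_iso[OF aC eT])
    define G where "G k = e ` ?G k" for k
    have Gfilt: "filtration K T G"
      unfolding G_def by (rule filtration_alg_iso[OF aC eT FC.filtration_poly_filt])
    have degG: "filt_deg G (e q) = filt_deg ?G q" if "q \<in> up C" for q
      unfolding G_def by (rule filt_deg_image[of _ "upa C"]) (use e that in \<open>auto simp: poly_filt_def\<close>)
    have "degree_additive (UP C) ?G"
      by (rule FC.degree_additive_poly_filt[OF FC.degree_additive_if_domain_gr[OF grF]])
    moreover have "fext (upa C) ?G = fext (UP C) ?G" by (simp add: fext_def fun_eq_iff)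
    ultimately have "degree_additive (upa C) ?G" by (simp add: degree_additive_def)
    then have "degree_additive T G"
      unfolding G_def by (rule degree_additive_alg_iso[OF aC eT FC.filtration_poly_filt])
    moreover interpret FT: filtered_algebra K T G
      by (intro filtered_algebra.intro filtered_algebra_axioms.intro aT Gfilt)
    have "\<one>\<^bsub>T\<^esub> \<noteq> \<zero>\<^bsub>T\<^esub>"
      using domain.one_not_zero[OF domain_alg_iso[OF domain_upa[OF dom] eT]] .
    ultimately have grT: "domain (assoc_graded T G)" by (rule FT.domain_gr_if_degree_additive)
    define y where "y j = e (?Y (x j))" for j
    have Yup: "?Y a \<in> up C" if "a \<in> carrier C" for a using alg_homD(3)[OF Y that] by simp
    have eh: "e \<in> alg_hom K (upa C) T" by (rule alg_iso_alg_hom[OF eT])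
    note Z = alg_hom_comp[OF Y eh]
    have yc: "y ` {..<n} \<subseteq> carrier T" using alg_homD(3)[OF Z] xc by (auto simp: y_def)
    have yi: "indep_mod_scalars K T n y"
    proof (rule indep_mod_scalars_pullback[OF aT algC _ yc ind])
      show "(\<lambda>t. inv_into (carrier (upa C)) e t 0) \<in> alg_hom K T C"
        by (rule alg_hom_comp[OF alg_hom_inv[OF aC eT] alg_hom_zeroth_coeff[OF algC]])
      show "inv_into (carrier (upa C)) e (y j) 0 = x j" if "j < n" for j
        using that xc Yup e Y0 by (auto simp: y_def)
    qed
    have ge: "filt_deg F (x j) \<le> filt_deg G (y j)" if "j < n" for j
      using FC.filt_deg_zeroth_le[OF Yup, of "x j"] Y0[of "x j"] xc that degG[OF Yup, of "x j"]
      by (auto simp: y_def)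
    have gt: "filt_deg F (x i) < filt_deg G (y i)"
    proof -
      have "?Y (x i) \<in> carrier (UP C)" using Yup[OF xi] by (simp add: UP_carrier)
      then have "up_ring.coeff (UP C) (?Y (x i)) (deg C (?Y (x i))) \<noteq> \<zero>\<^bsub>C\<^esub>"
        using UC.lcoeff_nonzero_deg N(2) by simp
      then have "?Y (x i) (deg C (?Y (x i))) \<noteq> \<zero>\<^bsub>C\<^esub>" using Yup[OF xi] by (simp add: UP_coeff)
      then have "\<alpha> \<le> filt_deg ?G (?Y (x i))" using FC.filt_deg_nonconst_ge[OF Yup[OF xi]] N(2) by blast
      then show ?thesis using degG[OF Yup[OF xi]] by (simp add: y_def \<alpha>_def)
    qed
    obtain q where q: "q \<in> mpoly_carrier K n" "mpoly_eval K C x q = f"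
      "mpoly_eval K T y q = \<zero>\<^bsub>T\<^esub> \<or> filt_deg G (mpoly_eval K T y q) > filt_deg F f"
      using test[of T G y] aT Gfilt grT yc yi ge gt i by blast
    have "mpoly_eval K T y q = e (?Y f)"
      using alg_hom_mpoly_eval[OF algC aT Z xc q(1)] q(2) by (simp add: y_def[abs_def])
    moreover have "?Y f = cst C f"
      using perturb_const[OF b(1)] b(2) \<psi>\<phi>[of "cst C f"] UC.monom_closed[OF f(1)]
      by (metis UP_carrier)
    ultimately have ev: "mpoly_eval K T y q = e (cst C f)" by simp
    have cf: "cst C f \<in> up C" using UC.monom_closed[OF f(1)] by (simp add: UP_carrier)
    have "e (cst C f) \<noteq> \<zero>\<^bsub>T\<^esub>"
    proof
      assume "e (cst C f) = \<zero>\<^bsub>T\<^esub>"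
      then have "e (cst C f) = e \<zero>\<^bsub>UP C\<^esub>" using alg_isoD(6)[OF eT] by simp
      then have "cst C f = \<zero>\<^bsub>UP C\<^esub>" using e cf UC.UP_zero_closed by (auto simp: UP_carrier dest: inj_onD)
      then have "cst C f 0 = \<zero>\<^bsub>C\<^esub>" by (simp add: UP_zero)
      then show False using f by (simp add: UP_monom)
    qed
    moreover have "filt_deg G (e (cst C f)) = filt_deg F f"
      using degG[OF cf] FC.filt_deg_cst[OF f(1)] by simp
    ultimately show False using q(3) ev by simp
  qed
  then have "carrier C \<subseteq> ?W" by (intro generates_subalg[OF gen W]) auto
  then show ?thesis using c by auto
qed

section \<open>Descending an isomorphism of polynomial algebras\<close>

lemma domain_coefficients:
  assumes "cring B" "domain (upa B)" shows "domain B"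
proof (rule domain.intro[OF assms(1)], rule domain_axioms.intro)
  interpret B: cring B by fact
  interpret U: UP_cring B "UP B" by (simp_all add: UP_cringI assms(1))
  interpret d: "domain" "upa B" by fact
  show "\<one>\<^bsub>B\<^esub> \<noteq> \<zero>\<^bsub>B\<^esub>" using d.one_not_zero by (auto simp: UP_one UP_zero)
  fix a b assume ab: "a \<otimes>\<^bsub>B\<^esub> b = \<zero>\<^bsub>B\<^esub>" "a \<in> carrier B" "b \<in> carrier B"
  have c: "cst B a \<in> carrier (upa B)" "cst B b \<in> carrier (upa B)"
    using U.monom_closed ab by (simp_all add: UP_carrier[symmetric])
  have "cst B a \<otimes>\<^bsub>upa B\<^esub> cst B b = \<zero>\<^bsub>upa B\<^esub>"
    using U.monom_mult[OF ab(2,3), of 0 0] ab(1) by simp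
  then have "cst B a = \<zero>\<^bsub>UP B\<^esub> \<or> cst B b = \<zero>\<^bsub>UP B\<^esub>" using d.integral[OF _ c] by simp
  then have "cst B a 0 = \<zero>\<^bsub>B\<^esub> \<or> cst B b 0 = \<zero>\<^bsub>B\<^esub>" by (auto simp: UP_zero)
  then show "a = \<zero>\<^bsub>B\<^esub> \<or> b = \<zero>\<^bsub>B\<^esub>" using ab by (simp add: UP_monom)
qed

text \<open>The map \<open>\<phi>\<close> followed by \<open>t \<mapsto> 0\<close> sends \<open>C[s]\<close> onto \<open>D\<close>, so the images of
  the variable \<open>s\<close> and of generators of \<open>C\<close> generate \<open>D\<close>.\<close>

lemma affine_alg_coefficients:
  assumes algC: "algebra K C" and algD: "algebra K D" and \<phi>: "\<phi> \<in> alg_iso K (upa C) (upa D)"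
    and "affine_alg K C"
  shows "affine_alg K D"
proof -
  interpret C: algebra K C by fact
  interpret D: algebra K D by fact
  interpret UC: UP_cring C "UP C" by (simp_all add: UP_cringI C.M_cring)
  interpret UD: UP_cring D "UP D" by (simp_all add: UP_cringI D.M_cring)
  have aC: "algebra K (upa C)" and aD: "algebra K (upa D)" by (rule algebra_upa; fact)+
  define \<pi> where "\<pi> p = \<phi> p 0" for p
  have \<pi>: "\<pi> \<in> alg_hom K (upa C) D"
    unfolding \<pi>_def by (rule alg_hom_comp[OF alg_iso_alg_hom[OF \<phi>] alg_hom_zeroth_coeff[OF algD]])
  have indet: "indet C \<in> carrier (upa C)" using UC.monom_closed[of "\<one>\<^bsub>C\<^esub>" "Suc 0"] by (simp add: UP_carrier)
  obtain S where S: "finite S" "generates K C S" using assms(4) by (auto simp: affine_alg_def)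
  have Sc: "S \<subseteq> carrier C" using S(2) by (simp add: generates_def)
  let ?S = "insert (\<pi> (indet C)) ((\<lambda>c. \<pi> (cst C c)) ` S)"
  have \<pi>c: "(\<lambda>c. \<pi> (cst C c)) \<in> alg_hom K C D" by (rule alg_hom_comp[OF alg_hom_cst[OF algC] \<pi>])
  have sub: "?S \<subseteq> carrier D" using alg_homD(3)[OF \<pi>c] alg_homD(3)[OF \<pi> indet] Sc by auto
  have "carrier D \<subseteq> W" if W: "subalg K D W" "?S \<subseteq> W" for W
  proof
    let ?V = "{p \<in> carrier (upa C). \<pi> p \<in> W}"
    have V: "subalg K (upa C) ?V" by (rule subalg_vimage[OF aC algD \<pi> W(1)])
    note VE = subringE[OF conjunct1[OF V[unfolded subalg_def]]]
    have "carrier C \<subseteq> {c \<in> carrier C. \<pi> (cst C c) \<in> W}"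
      by (rule generates_subalg[OF S(2) subalg_vimage[OF algC algD \<pi>c W(1)]]) (use W(2) Sc in auto)
    then have cst: "cst C c \<in> ?V" if "c \<in> carrier C" for c
      using that UC.monom_closed[of c 0] by (auto simp: UP_carrier)
    have ind: "indet C \<in> ?V" using indet W(2) by simp
    have "p \<in> ?V" if "p \<in> carrier (UP C)" for p
      using C.M_cring that
    proof (induction rule: UP_induct)
      case (monom a n)
      show ?case
      proof (induction n)
        case (Suc n)
        have "indet C \<otimes>\<^bsub>upa C\<^esub> up_ring.monom (UP C) a n \<in> ?V" by (rule VE(6)[OF ind Suc])
        moreover have "indet C \<otimes>\<^bsub>upa C\<^esub> up_ring.monom (UP C) a n = up_ring.monom (UP C) a (Suc n)"
          using UC.monom_mult[OF C.one_closed monom, of "Suc 0" n] monom by simp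
        ultimately show ?case by (simp only:)
      qed (rule cst[OF monom])
    next
      case (add p q)
      have "p \<oplus>\<^bsub>upa C\<^esub> q \<in> ?V" by (rule VE(7)[OF add.IH])
      then show ?case by (simp only: upa_simps(5))
    qed
    then have all: "\<pi> p \<in> W" if "p \<in> up C" for p using that by (auto simp: UP_carrier)
    fix b assume b: "b \<in> carrier D"
    then have "cst D b \<in> up D" using UD.monom_closed[OF b] by (simp add: UP_carrier)
    then obtain p where p: "p \<in> up C" "cst D b = \<phi> p"
      using alg_isoD(5)[OF \<phi>] unfolding upa_simps by blast
    have "\<pi> p = b" using p(2)[symmetric] b by (simp add: \<pi>_def UP_monom)
    then show "b \<in> W" using all[OF p(1)] by simp
  qed
  moreover have "subalg K D (carrier D)"
    using D.carrier_is_subring D.carrier_is_submodule by (simp add: subalg_def)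
  ultimately have "generates K D ?S"
    using sub by (auto simp: generates_def hull_def)
  moreover have "finite ?S" using S(1) by simp
  ultimately show ?thesis unfolding affine_alg_def by blast
qed

context poisson_algebra
begin

lemma bracket_mult_center:
  assumes a: "a \<in> carrier A" and b: "b \<in> carrier A" and z: "z \<in> poisson_center A" and w: "w \<in> poisson_center A"
  shows "bracket A (a \<otimes>\<^bsub>A\<^esub> z) (b \<otimes>\<^bsub>A\<^esub> w) = bracket A a b \<otimes>\<^bsub>A\<^esub> (z \<otimes>\<^bsub>A\<^esub> w)"
proof -
  have c: "z \<in> carrier A" "w \<in> carrier A" using z w by (auto simp: poisson_center_def)
  have r: "bracket A x (y \<otimes>\<^bsub>A\<^esub> u) = bracket A x y \<otimes>\<^bsub>A\<^esub> u"
    if "x \<in> carrier A" "y \<in> carrier A" "u \<in> poisson_center A" for x y u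
    using that by (simp add: bracket_leibniz poisson_center_iff bracket_closed)
  have "bracket A (a \<otimes>\<^bsub>A\<^esub> z) (b \<otimes>\<^bsub>A\<^esub> w) = bracket A (a \<otimes>\<^bsub>A\<^esub> z) b \<otimes>\<^bsub>A\<^esub> w"
    using r[of "a \<otimes>\<^bsub>A\<^esub> z" b w] a b c w by simp
  also have "bracket A (a \<otimes>\<^bsub>A\<^esub> z) b = \<ominus>\<^bsub>A\<^esub> (bracket A b a \<otimes>\<^bsub>A\<^esub> z)"
    using bracket_anti[of "a \<otimes>\<^bsub>A\<^esub> z" b] r[of b a z] a b c z by simp
  also have "\<dots> = bracket A a b \<otimes>\<^bsub>A\<^esub> z"
    using bracket_anti[OF a b] a b c by (simp add: l_minus bracket_closed)
  finally show ?thesis using a b c by (simp add: m_assoc bracket_closed)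
qed

lemma bracket_upa_monom:
  assumes a: "a \<in> carrier A" and b: "b \<in> carrier A"
  shows "bracket (upa A) (up_ring.monom (UP A) a i) (up_ring.monom (UP A) b j)
    = up_ring.monom (UP A) (bracket A a b) (i + j)"
proof
  fix n
  have "bracket (upa A) (up_ring.monom (UP A) a i) (up_ring.monom (UP A) b j) n
    = (\<Oplus>\<^bsub>A\<^esub> k\<in>{..n}. if i = k then (if n = i + j then bracket A a b else \<zero>\<^bsub>A\<^esub>) else \<zero>\<^bsub>A\<^esub>)"
    unfolding upa_simps by (rule M.finsum_cong') (use a b in \<open>auto simp: UP_monom bracket_closed\<close>)
  also have "\<dots> = (if n = i + j then bracket A a b else \<zero>\<^bsub>A\<^esub>)"
  proof (cases "i \<le> n")
    case True
    then show ?thesis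
      using a b M.finsum_singleton[of i "{..n}" "\<lambda>k. if n = i + j then bracket A a b else \<zero>\<^bsub>A\<^esub>"]
      by (simp add: bracket_closed)
  next
    case False
    then have "(\<Oplus>\<^bsub>A\<^esub> k\<in>{..n}. if i = k then (if n = i + j then bracket A a b else \<zero>\<^bsub>A\<^esub>) else \<zero>\<^bsub>A\<^esub>)
      = (\<Oplus>\<^bsub>A\<^esub> k\<in>{..n}. \<zero>\<^bsub>A\<^esub>)"
      by (intro M.finsum_cong') auto
    with False show ?thesis by simp
  qed
  also have "\<dots> = up_ring.monom (UP A) (bracket A a b) (i + j) n"
    using a b by (simp add: UP_monom bracket_closed)
  finally show "bracket (upa A) (up_ring.monom (UP A) a i) (up_ring.monom (UP A) b j) n
    = up_ring.monom (UP A) (bracket A a b) (i + j) n" .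
qed

lemma bracket_upa_add:
  assumes "p \<in> up A" "q \<in> up A" "r \<in> up A"
  shows "bracket (upa A) (p \<oplus>\<^bsub>UP A\<^esub> q) r = bracket (upa A) p r \<oplus>\<^bsub>UP A\<^esub> bracket (upa A) q r"
    and "bracket (upa A) r (p \<oplus>\<^bsub>UP A\<^esub> q) = bracket (upa A) r p \<oplus>\<^bsub>UP A\<^esub> bracket (upa A) r q"
proof -
  note cl = bracket_upa_closed[OF assms(1,3)] bracket_upa_closed[OF assms(2,3)]
    bracket_upa_closed[OF assms(3,1)] bracket_upa_closed[OF assms(3,2)]
  have f: "(\<lambda>i. bracket A (u i) (w (n - i))) \<in> {..n} \<rightarrow> carrier A" if "u \<in> up A" "w \<in> up A" for u w n
    using that by (auto simp: mem_upD bracket_closed)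
  show "bracket (upa A) (p \<oplus>\<^bsub>UP A\<^esub> q) r = bracket (upa A) p r \<oplus>\<^bsub>UP A\<^esub> bracket (upa A) q r"
    unfolding UP_add[OF cl(1,2)] UP_add[OF assms(1,2)] unfolding upa_simps
    using assms f by (simp add: bracket_add_left mem_upD M.finsum_addf)
  show "bracket (upa A) r (p \<oplus>\<^bsub>UP A\<^esub> q) = bracket (upa A) r p \<oplus>\<^bsub>UP A\<^esub> bracket (upa A) r q"
    unfolding UP_add[OF cl(3,4)] UP_add[OF assms(1,2)] unfolding upa_simps
    using assms f by (simp add: bracket_add_right mem_upD M.finsum_addf)
qed

text \<open>On monomials this is \<open>{a, b} v\<^sup>n\<^sup>+\<^sup>m = {a v\<^sup>n, b v\<^sup>m}\<close>, which needs \<open>v\<close> to be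
  central; both sides are biadditive.\<close>

lemma eval_center_bracket:
  assumes v: "v \<in> poisson_center A" and p: "p \<in> up A" and q: "q \<in> up A"
  shows "UnivPoly.eval A A id v (bracket (upa A) p q) = bracket A (UnivPoly.eval A A id v p) (UnivPoly.eval A A id v q)"
proof -
  interpret Pc: UP_cring A "UP A" by (simp_all add: UP_cringI M_cring)
  have vc: "v \<in> carrier A" using v by (simp add: poisson_center_def)
  interpret ev: UP_pre_univ_prop A A id "UP A"
    by (simp_all add: UP_pre_univ_propI[OF M_cring M_cring id_ring_hom])
  let ?ev = "UnivPoly.eval A A id v"
  have hom: "?ev \<in> ring_hom (UP A) A" by (rule ev.eval_ring_hom[OF vc])
  note H = ring_hom_memE[OF hom, unfolded UP_carrier]
  have vn: "v [^]\<^bsub>A\<^esub> (n::nat) \<in> poisson_center A" for n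
    using subringE(3,6)[OF poisson_center_subring] v by (induction n) auto
  have mon: "?ev (up_ring.monom (UP A) a n) = a \<otimes>\<^bsub>A\<^esub> v [^]\<^bsub>A\<^esub> n" if "a \<in> carrier A" for a n
    using ev.eval_monom[OF that vc] by simp
  have mcl: "up_ring.monom (UP A) a n \<in> up A" if "a \<in> carrier A" for a n
    using Pc.monom_closed[OF that] by (simp add: UP_carrier)
  have 1: "?ev (bracket (upa A) (up_ring.monom (UP A) a n) q) = bracket A (?ev (up_ring.monom (UP A) a n)) (?ev q)"
    if a: "a \<in> carrier A" and q: "q \<in> carrier (UP A)" for a n q
    using M_cring q
  proof (induction rule: UP_induct)
    case (monom b m)
    have "?ev (bracket (upa A) (up_ring.monom (UP A) a n) (up_ring.monom (UP A) b m))
      = bracket A a b \<otimes>\<^bsub>A\<^esub> v [^]\<^bsub>A\<^esub> (n + m)"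
      unfolding bracket_upa_monom[OF a monom] by (rule mon[OF bracket_closed[OF a monom]])
    also have "\<dots> = bracket A (a \<otimes>\<^bsub>A\<^esub> v [^]\<^bsub>A\<^esub> n) (b \<otimes>\<^bsub>A\<^esub> v [^]\<^bsub>A\<^esub> m)"
      unfolding bracket_mult_center[OF a monom vn vn] by (simp add: nat_pow_mult[OF vc])
    finally show ?case by (simp only: mon[OF a] mon[OF monom])
  next
    case (add q r)
    note c = add.hyps[unfolded UP_carrier] mcl[OF a, of n]
    show ?case
      unfolding bracket_upa_add(2)[OF c] H(3)[OF c(1,2)]
        H(3)[OF bracket_upa_closed[OF c(3,1)] bracket_upa_closed[OF c(3,2)]] add.IH
      by (rule bracket_add_right[OF H(1)[OF c(3)] H(1)[OF c(1)] H(1)[OF c(2)], symmetric])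
  qed
  have "p \<in> carrier (UP A)" using p by (simp add: UP_carrier)
  with M_cring show ?thesis
  proof (induction rule: UP_induct)
    case (monom a n)
    show ?case using 1[OF monom] q by (simp only: UP_carrier)
  next
    case (add p r)
    note c = add.hyps[unfolded UP_carrier] q
    show ?case
      unfolding bracket_upa_add(1)[OF c] H(3)[OF c(1,2)]
        H(3)[OF bracket_upa_closed[OF c(1,3)] bracket_upa_closed[OF c(2,3)]] add.IH
      by (rule bracket_add_left[OF H(1)[OF c(1)] H(1)[OF c(2)] H(1)[OF c(3)], symmetric])
  qed
qed

end

text \<open>Write \<open>s\<close> and \<open>t\<close> for the variables of \<open>A[s]\<close> and \<open>B[t]\<close>, and \<open>\<sigma> = \<phi>(s)\<close>. As
  \<open>s\<close> divides \<open>\<phi>\<inverse>(t) - \<tau>\<^sub>0\<close>, where \<open>\<tau>\<^sub>0\<close> is the constant coefficient,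
  \<open>t - v = \<sigma> \<rho>\<close> for the central element \<open>v = \<phi>(\<tau>\<^sub>0)\<close> and some \<open>\<rho>\<close>. If
  \<open>\<rho>(v) = 0\<close>, then \<open>\<rho>\<close> is a multiple of \<open>t - v = \<sigma> \<rho>\<close>, and cancelling \<open>\<rho>\<close>
  makes \<open>\<sigma>\<close> a unit, which it is not since \<open>s\<close> is none. Hence \<open>\<sigma>(v) = 0\<close>, and the
  multiples of \<open>\<sigma>\<close> are exactly the polynomials that vanish at \<open>v\<close>. So
  \<open>a \<mapsto> \<phi>(a)(v)\<close> is the isomorphism \<open>A \<cong> A[s]/(s) \<cong> B[t]/(t - v) \<cong> B\<close>; it respects
  the bracket because \<open>v\<close> is central.\<close>

theorem poisson_isomorphic_if_center_constants:
  fixes A :: "('k, 'a, 'x) poisson_alg_scheme" and B :: "('k, 'b, 'y) poisson_alg_scheme"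
  assumes PA: "poisson_algebra K A" and PB: "poisson_algebra K B" and domA: "domain A"
    and \<phi>: "\<phi> \<in> poisson_iso K (upa A) (upa B)"
    and cen: "\<And>z. z \<in> poisson_center A \<Longrightarrow> \<exists>b\<in>poisson_center B. \<phi> (cst A z) = cst B b"
  shows "poisson_isomorphic K A B"
proof -
  interpret A: poisson_algebra K A by fact
  interpret B: poisson_algebra K B by fact
  interpret UA: UP_cring A "UP A" by (simp_all add: UP_cringI A.M_cring)
  interpret UB: UP_cring B "UP B" by (simp_all add: UP_cringI B.M_cring)
  have rA: "ring (upa A)" and rB: "ring (upa B)"
    using cring_upa[OF A.M_cring] cring_upa[OF B.M_cring] by (simp_all add: cring_def)
  have \<phi>0: "\<phi> \<zero>\<^bsub>upa A\<^esub> = \<zero>\<^bsub>upa B\<^esub>" by (rule poisson_iso_zero[OF \<phi> rA rB])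
  have \<phi>ai: "\<phi> \<in> alg_iso K (upa A) (upa B)" by (rule poisson_iso_alg_iso) fact+
  have domB: "domain B"
    by (rule domain_coefficients[OF B.M_cring domain_alg_iso[OF domain_upa[OF domA] \<phi>ai]])
  interpret dB: "domain" B by (rule domB)
  interpret dU: "domain" "UP B" by (rule UP_domain.UP_domain) (simp add: UP_domain_def domB)
  define \<psi> where "\<psi> = inv_into (up A) \<phi>"
  interpret pair: poisson_iso_pair K "upa A" "upa B" \<phi> \<psi>
    unfolding \<psi>_def by (rule A.poisson_iso_pair_upa[OF \<phi> \<phi>0])
  interpret swap: poisson_iso_pair K "upa B" "upa A" \<psi> \<phi> by (rule pair.swap_poisson)
  note F = poisson_isoD[OF pair.h_iso, simplified] and G = poisson_isoD[OF pair.g_iso, simplified]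
  note [simp] = UP_carrier
  have sA: "indet A \<in> up A" and tB: "indet B \<in> up B"
    using UA.monom_closed[of "\<one>\<^bsub>A\<^esub>" "Suc 0"] UB.monom_closed[of "\<one>\<^bsub>B\<^esub>" "Suc 0"] by simp_all
  have "indet B \<in> poisson_center (upa B)"
    using tB subringE(2,3)[OF B.poisson_center_subring]
    by (auto simp: B.poisson_center_upa B.up_center UP_monom)
  then have "\<psi> (indet B) \<in> poisson_center (upa A)" by (rule swap.center_closed)
  then have \<tau>: "\<psi> (indet B) \<in> up A" "\<psi> (indet B) 0 \<in> poisson_center A"
    by (auto simp: A.poisson_center_upa A.up_center)
  define \<tau>0 where "\<tau>0 = \<psi> (indet B) 0"
  have \<tau>0: "\<tau>0 \<in> poisson_center A" "\<tau>0 \<in> carrier A"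
    using \<tau>(2) A.poisson_center_subset by (auto simp: \<tau>0_def)
  have cstA: "cst A a \<in> up A" if "a \<in> carrier A" for a using UA.monom_closed[OF that, of 0] by simp
  have cstB: "cst B b \<in> up B" if "b \<in> carrier B" for b using UB.monom_closed[OF that, of 0] by simp
  obtain v where v: "v \<in> poisson_center B" "\<phi> (cst A \<tau>0) = cst B v" using cen[OF \<tau>0(1)] by blast
  have vc: "v \<in> carrier B" using v B.poisson_center_subset by blast
  define \<sigma> where "\<sigma> = \<phi> (indet A)"
  have \<sigma>: "\<sigma> \<in> up B" using F(7)[OF sA] by (simp add: \<sigma>_def)
  have split: "\<exists>w\<in>up B. \<phi> p = \<phi> (cst A (p 0)) \<oplus>\<^bsub>UP B\<^esub> \<sigma> \<otimes>\<^bsub>UP B\<^esub> w" if p: "p \<in> up A" for p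
  proof -
    obtain q where q: "q \<in> up A" "p = cst A (p 0) \<oplus>\<^bsub>UP A\<^esub> indet A \<otimes>\<^bsub>UP A\<^esub> q"
      using UP_split[OF A.M_cring p] by (rule bexE)
    have "indet A \<otimes>\<^bsub>UP A\<^esub> q \<in> up A" using UA.UP_mult_closed[of "indet A" q] sA q(1) by simp
    then have "\<phi> (cst A (p 0) \<oplus>\<^bsub>UP A\<^esub> indet A \<otimes>\<^bsub>UP A\<^esub> q) = \<phi> (cst A (p 0)) \<oplus>\<^bsub>UP B\<^esub> \<sigma> \<otimes>\<^bsub>UP B\<^esub> \<phi> q"
      using F(8) F(9)[OF sA q(1)] cstA[OF mem_upD[OF p]] by (simp add: \<sigma>_def)
    then have "\<phi> p = \<phi> (cst A (p 0)) \<oplus>\<^bsub>UP B\<^esub> \<sigma> \<otimes>\<^bsub>UP B\<^esub> \<phi> q" by (subst q(2))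
    then show ?thesis using F(7)[OF q(1)] by blast
  qed
  obtain \<rho> where \<rho>: "\<rho> \<in> up B" "indet B = cst B v \<oplus>\<^bsub>UP B\<^esub> \<sigma> \<otimes>\<^bsub>UP B\<^esub> \<rho>"
    using split[OF \<tau>(1)] pair.hg[of "indet B"] tB v(2) by (auto simp: \<tau>0_def)
  have \<sigma>\<rho>: "\<sigma> \<otimes>\<^bsub>UP B\<^esub> \<rho> \<in> up B" using UB.UP_mult_closed[of \<sigma> \<rho>] \<sigma> \<rho>(1) by simp
  have lin: "indet B \<ominus>\<^bsub>UP B\<^esub> cst B v = \<sigma> \<otimes>\<^bsub>UP B\<^esub> \<rho>"
  proof -
    have "(cst B v \<oplus>\<^bsub>UP B\<^esub> \<sigma> \<otimes>\<^bsub>UP B\<^esub> \<rho>) \<ominus>\<^bsub>UP B\<^esub> cst B v = \<sigma> \<otimes>\<^bsub>UP B\<^esub> \<rho>"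
      using cstB[OF vc] \<sigma>\<rho> UB.UP_a_inv_closed[of "cst B v"]
      by (simp add: a_minus_def UB.P.a_comm[of "cst B v" "\<sigma> \<otimes>\<^bsub>UP B\<^esub> \<rho>"] UB.P.a_assoc UB.P.r_neg)
    then show ?thesis using \<rho>(2) by simp
  qed
  have idh: "id \<in> ring_hom B B" by (rule ring_hom_memI) auto
  interpret ev: UP_pre_univ_prop B B id "UP B"
    by (simp_all add: UP_pre_univ_propI[OF B.M_cring B.M_cring idh])
  let ?ev = "UnivPoly.eval B B id v"
  have evh: "?ev \<in> ring_hom (UP B) B" by (rule ev.eval_ring_hom[OF vc])
  note E = ring_hom_memE[OF evh, unfolded UP_carrier]
  have evc: "?ev (cst B b) = b" if "b \<in> carrier B" for b using ev.eval_const[OF vc that] by simp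
  have oneB: "\<one>\<^bsub>B\<^esub> \<in> carrier B"
    using subringE(3)[OF B.poisson_center_subring] B.poisson_center_subset by blast
  then have nt: "carrier B \<noteq> {\<zero>\<^bsub>B\<^esub>}" using domain.one_not_zero[OF domB] by (metis singletonD)
  have rem: "\<exists>q\<in>up B. p = (\<sigma> \<otimes>\<^bsub>UP B\<^esub> \<rho>) \<otimes>\<^bsub>UP B\<^esub> q \<oplus>\<^bsub>UP B\<^esub> cst B (?ev p)" if "p \<in> up B" for p
    using UB.remainder_theorem[OF _ vc nt, of p] that lin by auto
  have ker: "\<exists>q\<in>up B. p = (\<sigma> \<otimes>\<^bsub>UP B\<^esub> \<rho>) \<otimes>\<^bsub>UP B\<^esub> q" if "p \<in> up B" "?ev p = \<zero>\<^bsub>B\<^esub>" for p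
  proof -
    from rem[OF that(1)] obtain q where q: "q \<in> up B"
      "p = (\<sigma> \<otimes>\<^bsub>UP B\<^esub> \<rho>) \<otimes>\<^bsub>UP B\<^esub> q \<oplus>\<^bsub>UP B\<^esub> cst B (?ev p)" by (rule bexE)
    have "p = (\<sigma> \<otimes>\<^bsub>UP B\<^esub> \<rho>) \<otimes>\<^bsub>UP B\<^esub> q \<oplus>\<^bsub>UP B\<^esub> \<zero>\<^bsub>UP B\<^esub>"
      using q(2) that(2) by (metis UB.monom_zero)
    moreover have "(\<sigma> \<otimes>\<^bsub>UP B\<^esub> \<rho>) \<otimes>\<^bsub>UP B\<^esub> q \<in> carrier (UP B)"
      using UB.UP_mult_closed \<sigma>\<rho> q(1) by simp
    ultimately show ?thesis using q(1) UB.P.r_zero by metis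
  qed
  have zeroth: "(indet A \<otimes>\<^bsub>UP A\<^esub> q) 0 = \<zero>\<^bsub>A\<^esub>" if "q \<in> up A" for q
    using that sA by (simp add: UP_mult mem_upD) (simp add: UP_monom mem_upD)
  have divs: "\<psi> (\<sigma> \<otimes>\<^bsub>UP B\<^esub> w) 0 = \<zero>\<^bsub>A\<^esub>" if "w \<in> up B" for w
    using G(9)[OF \<sigma> that] G(7)[OF that] zeroth pair.gh[of "indet A"] sA by (simp add: \<sigma>_def)
  have nonunit: "\<sigma> \<otimes>\<^bsub>UP B\<^esub> w \<noteq> \<one>\<^bsub>UP B\<^esub>" if "w \<in> up B" for w
  proof
    assume "\<sigma> \<otimes>\<^bsub>UP B\<^esub> w = \<one>\<^bsub>UP B\<^esub>"
    then have "\<zero>\<^bsub>A\<^esub> = \<one>\<^bsub>A\<^esub>" using divs[OF that] G(6) by (simp add: UP_one)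
    then show False using domain.one_not_zero[OF domA] by simp
  qed
  have ev\<sigma>: "?ev \<sigma> = \<zero>\<^bsub>B\<^esub>"
  proof (rule ccontr)
    assume ne: "?ev \<sigma> \<noteq> \<zero>\<^bsub>B\<^esub>"
    have "?ev (indet B \<ominus>\<^bsub>UP B\<^esub> cst B v) = \<zero>\<^bsub>B\<^esub>"
      using UB.eval_monom_expr[OF vc] by simp
    then have "?ev \<sigma> \<otimes>\<^bsub>B\<^esub> ?ev \<rho> = \<zero>\<^bsub>B\<^esub>" using lin E(2)[OF \<sigma> \<rho>(1)] by simp
    then have "?ev \<rho> = \<zero>\<^bsub>B\<^esub>" using ne dB.integral E(1)[OF \<sigma>] E(1)[OF \<rho>(1)] by blast
    from ker[OF \<rho>(1) this] obtain q where q: "q \<in> up B" "\<rho> = (\<sigma> \<otimes>\<^bsub>UP B\<^esub> \<rho>) \<otimes>\<^bsub>UP B\<^esub> q"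
      by (rule bexE)
    have \<sigma>q: "\<sigma> \<otimes>\<^bsub>UP B\<^esub> q \<in> up B" using UB.UP_mult_closed[of \<sigma> q] \<sigma> q(1) by simp
    have "\<rho> \<noteq> \<zero>\<^bsub>UP B\<^esub>"
    proof
      assume "\<rho> = \<zero>\<^bsub>UP B\<^esub>"
      then have "indet B = cst B v" using \<rho>(2) \<sigma> cstB[OF vc] by simp
      then have "indet B (Suc 0) = cst B v (Suc 0)" by simp
      then show False using vc by (simp add: UP_monom)
    qed
    moreover have "\<rho> \<otimes>\<^bsub>UP B\<^esub> (\<sigma> \<otimes>\<^bsub>UP B\<^esub> q) = \<rho> \<otimes>\<^bsub>UP B\<^esub> \<one>\<^bsub>UP B\<^esub>"
    proof -
      have "\<rho> \<otimes>\<^bsub>UP B\<^esub> (\<sigma> \<otimes>\<^bsub>UP B\<^esub> q) = (\<sigma> \<otimes>\<^bsub>UP B\<^esub> \<rho>) \<otimes>\<^bsub>UP B\<^esub> q"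
        using q(1) \<sigma> \<rho>(1) UB.P.m_assoc[of \<rho> \<sigma> q] UB.P.m_comm[of \<rho> \<sigma>] by simp
      also have "\<dots> = \<rho>" by (rule q(2)[symmetric])
      finally show ?thesis using \<rho>(1) by simp
    qed
    ultimately have "\<sigma> \<otimes>\<^bsub>UP B\<^esub> q = \<one>\<^bsub>UP B\<^esub>"
      using dU.m_lcancel[of \<rho> "\<sigma> \<otimes>\<^bsub>UP B\<^esub> q" "\<one>\<^bsub>UP B\<^esub>"] \<rho>(1) \<sigma>q UB.UP_one_closed by simp
    then show False using nonunit[OF q(1)] by simp
  qed
  let ?f = "\<lambda>a. ?ev (\<phi> (cst A a))"
  have \<phi>c: "\<phi> (cst A a) \<in> up B" if "a \<in> carrier A" for a using F(7)[OF cstA[OF that]] .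
  have evhom: "?ev \<in> alg_hom K (upa B) B"
  proof (rule alg_homI_one[OF algebra_upa[OF B.algebra_axioms] B.algebra_axioms])
    show "?ev \<in> ring_hom (upa B) B" using evh by (simp add: ring_hom_upa)
    fix r assume r: "r \<in> carrier K"
    note cB = alg_homD[OF alg_hom_cst[OF B.algebra_axioms]]
    have "r \<odot>\<^bsub>upa B\<^esub> \<one>\<^bsub>upa B\<^esub> = cst B (r \<odot>\<^bsub>B\<^esub> \<one>\<^bsub>B\<^esub>)"
      using cB(2) cB(6)[OF r oneB] by (simp only:)
    then show "?ev (r \<odot>\<^bsub>upa B\<^esub> \<one>\<^bsub>upa B\<^esub>) = r \<odot>\<^bsub>B\<^esub> \<one>\<^bsub>B\<^esub>"
      using evc r oneB by (simp del: upa_simps)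
  qed
  have \<phi>h: "\<phi> \<in> alg_hom K (upa A) (upa B)"
    by (rule alg_iso_alg_hom[OF \<phi>ai])
  note f = alg_hom_comp[OF alg_hom_comp[OF alg_hom_cst[OF A.algebra_axioms] \<phi>h] evhom]
  have inj: "inj_on ?f (carrier A)"
  proof -
    have z0: "a = \<zero>\<^bsub>A\<^esub>" if a: "a \<in> carrier A" and z: "?f a = \<zero>\<^bsub>B\<^esub>" for a
    proof -
      obtain q where q: "q \<in> up B" "\<phi> (cst A a) = (\<sigma> \<otimes>\<^bsub>UP B\<^esub> \<rho>) \<otimes>\<^bsub>UP B\<^esub> q"
        using ker[OF \<phi>c[OF a] z] by (rule bexE)
      have "\<rho> \<otimes>\<^bsub>UP B\<^esub> q \<in> up B" using UB.UP_mult_closed[of \<rho> q] \<rho>(1) q(1) by simp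
      moreover have "\<phi> (cst A a) = \<sigma> \<otimes>\<^bsub>UP B\<^esub> (\<rho> \<otimes>\<^bsub>UP B\<^esub> q)"
        using q \<sigma> \<rho>(1) UB.P.m_assoc[of \<sigma> \<rho> q] by simp
      ultimately have "\<psi> (\<phi> (cst A a)) 0 = \<zero>\<^bsub>A\<^esub>" using divs by simp
      then show ?thesis using pair.gh[of "cst A a"] cstA[OF a] a by (simp add: UP_monom)
    qed
    have rings: "ring A" "ring B" using A.M_cring B.M_cring unfolding cring_def by blast+
    have fh: "?f \<in> ring_hom A B" by (rule alg_homD(1)[OF f])
    have "\<zero>\<^bsub>A\<^esub> \<in> carrier A" by (rule ring.ring_simprules(2)[OF rings(1)])
    then have "a_kernel A B ?f = {\<zero>\<^bsub>A\<^esub>}"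
      using z0 ring_hom_zero[OF fh rings] unfolding a_kernel_def' by blast
    then show ?thesis
      by (rule ring_hom_ring.trivial_ker_imp_inj[OF ring_hom_ringI2[OF rings fh]])
  qed
  have surj: "?f ` carrier A = carrier B"
  proof (intro equalityI subsetI)
    fix b assume b: "b \<in> carrier B"
    let ?p = "\<psi> (cst B b)"
    have p: "?p \<in> up A" using G(7)[OF cstB[OF b]] .
    obtain w where w: "w \<in> up B" "\<phi> ?p = \<phi> (cst A (?p 0)) \<oplus>\<^bsub>UP B\<^esub> \<sigma> \<otimes>\<^bsub>UP B\<^esub> w" using split[OF p] by (rule bexE)
    have p0: "?p 0 \<in> carrier A" using p by (rule mem_upD)
    have \<sigma>w: "\<sigma> \<otimes>\<^bsub>UP B\<^esub> w \<in> up B" using UB.UP_mult_closed[of \<sigma> w] \<sigma> w(1) by simp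
    have "b = ?ev (\<phi> ?p)" using evc[OF b] pair.hg[of "cst B b"] cstB[OF b] by simp
    also have "\<dots> = ?f (?p 0) \<oplus>\<^bsub>B\<^esub> ?ev \<sigma> \<otimes>\<^bsub>B\<^esub> ?ev w"
      unfolding w(2) E(3)[OF \<phi>c[OF p0] \<sigma>w] E(2)[OF \<sigma> w(1)] ..
    also have "\<dots> = ?f (?p 0)"
      using ev\<sigma> E(1)[OF w(1)] alg_homD(3)[OF f p0] by simp
    finally show "b \<in> ?f ` carrier A" using p0 by blast
  qed (use alg_homD(3)[OF f] in auto)
  have br: "?f (bracket A a b) = bracket B (?f a) (?f b)" if a: "a \<in> carrier A" and b: "b \<in> carrier A" for a b
  proof -
    have "cst A (bracket A a b) = bracket (upa A) (cst A a) (cst A b)"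
      using A.bracket_upa_monom[OF a b, of 0 0] by simp
    then have "\<phi> (cst A (bracket A a b)) = bracket (upa B) (\<phi> (cst A a)) (\<phi> (cst A b))"
      using poisson_isoD(11)[OF \<phi>, of "cst A a" "cst A b"] cstA a b by simp
    then show ?thesis using B.eval_center_bracket[OF v(1) \<phi>c[OF a] \<phi>c[OF b]] by simp
  qed
  have "?f \<in> poisson_iso K A B"
    using alg_homD(1,6)[OF f] inj surj br by (simp add: poisson_iso_def ring_iso_def bij_betw_def)
  then show ?thesis by (auto simp: poisson_isomorphic_def)
qed

section \<open>The discriminant under isomorphisms of polynomial algebras\<close>

lemma alg_iso_center:
  assumes PA: "poisson_algebra K A" and PB: "poisson_algebra K B"
    and \<phi>: "\<phi> \<in> poisson_iso K (upa A) (upa B)" and \<phi>0: "\<phi> \<zero>\<^bsub>upa A\<^esub> = \<zero>\<^bsub>upa B\<^esub>"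
  shows "\<phi> \<in> alg_iso K (upa (center_alg A)) (upa (center_alg B))"
proof -
  interpret A: poisson_algebra K A by fact
  interpret B: poisson_algebra K B by fact
  define \<psi> where "\<psi> = inv_into (up A) \<phi>"
  interpret pair: poisson_iso_pair K "upa A" "upa B" \<phi> \<psi>
    unfolding \<psi>_def by (rule A.poisson_iso_pair_upa[OF \<phi> \<phi>0])
  interpret swap: poisson_iso_pair K "upa B" "upa A" \<psi> \<phi> by (rule pair.swap_poisson)
  note F = poisson_isoD[OF pair.h_iso, simplified]
  have rings: "ring A" "ring B" using A.M_cring B.M_cring unfolding cring_def by blast+
  note UA = UP_carrier_update[OF rings(1) A.poisson_center_subring]
    and UB = UP_carrier_update[OF rings(2) B.poisson_center_subring]
  let ?ZA = "up (center_alg A)" and ?ZB = "up (center_alg B)"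
  have cl: "\<phi> p \<in> ?ZB" if "p \<in> ?ZA" for p
    using pair.center_closed that by (simp add: A.poisson_center_upa B.poisson_center_upa)
  have cl': "\<psi> q \<in> ?ZA" if "q \<in> ?ZB" for q
    using swap.center_closed that by (simp add: A.poisson_center_upa B.poisson_center_upa)
  have subA: "p \<in> up A" if "p \<in> ?ZA" for p using that by (simp add: A.up_center)
  have subB: "q \<in> up B" if "q \<in> ?ZB" for q using that by (simp add: B.up_center)
  have "\<phi> ` ?ZA = ?ZB"
  proof (intro equalityI subsetI)
    fix q assume q: "q \<in> ?ZB"
    then show "q \<in> \<phi> ` ?ZA"
      using cl'[OF q] pair.hg[of q] subB[OF q] by (intro image_eqI[of _ _ "\<psi> q"]) simp_all
  qed (use cl in auto)
  moreover have "inj_on \<phi> ?ZA"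
    using F(4) by (rule inj_on_subset) (use subA in auto)
  ultimately have bij: "bij_betw \<phi> ?ZA ?ZB" by (simp add: bij_betw_def)
  have "\<phi> \<in> ring_iso (upa (center_alg A)) (upa (center_alg B))"
  proof (rule ring_iso_memI)
    fix p q assume pq: "p \<in> carrier (upa (center_alg A))" "q \<in> carrier (upa (center_alg A))"
    then have pq: "p \<in> ?ZA" "q \<in> ?ZA" by simp_all
    show "\<phi> (p \<otimes>\<^bsub>upa (center_alg A)\<^esub> q) = \<phi> p \<otimes>\<^bsub>upa (center_alg B)\<^esub> \<phi> q"
      using UA(2)[OF pq] UB(2)[OF cl[OF pq(1)] cl[OF pq(2)]] F(9)[OF subA[OF pq(1)] subA[OF pq(2)]] by simp
    show "\<phi> (p \<oplus>\<^bsub>upa (center_alg A)\<^esub> q) = \<phi> p \<oplus>\<^bsub>upa (center_alg B)\<^esub> \<phi> q"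
      using UA(1)[OF pq] UB(1)[OF cl[OF pq(1)] cl[OF pq(2)]] F(8)[OF subA[OF pq(1)] subA[OF pq(2)]] by simp
  next
    show "\<phi> \<one>\<^bsub>upa (center_alg A)\<^esub> = \<one>\<^bsub>upa (center_alg B)\<^esub>"
      using UA(3) UB(3) F(6) by simp
  qed (use cl bij in simp_all)
  moreover have "\<phi> \<zero>\<^bsub>upa (center_alg A)\<^esub> = \<zero>\<^bsub>upa (center_alg B)\<^esub>"
    using \<phi>0 by (simp add: UP_zero)
  moreover have "\<phi> (r \<odot>\<^bsub>upa (center_alg A)\<^esub> p) = r \<odot>\<^bsub>upa (center_alg B)\<^esub> \<phi> p"
    if "r \<in> carrier K" "p \<in> carrier (upa (center_alg A))" for r p
    using F(10)[of r p] that subA by simp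
  ultimately show ?thesis unfolding alg_iso_def by blast
qed

text \<open>The hypotheses on discriminant ideals, which hold by stability, say that \<open>\<phi>\<close> maps the
  coefficientwise multiples of \<open>d\<close> onto the polynomials with coefficients in the discriminant
  ideal of \<open>B\<close>. A nonzero constant among the latter, such as a nonzero coefficient of
  \<open>\<phi>(d)\<close>, is divisible by \<open>\<phi>(d)\<close>, which therefore has degree zero.\<close>

lemma discriminant_constant:
  fixes A :: "('k, 'u) poisson_alg" and B :: "('k, 'v) poisson_alg"
    and P :: "('k, 'w) poisson_alg \<Rightarrow> bool"
  assumes PA: "poisson_algebra K A" and PB: "poisson_algebra K B" and domA: "domain A"
    and \<phi>: "\<phi> \<in> poisson_iso K (upa A) (upa B)" and \<phi>0: "\<phi> \<zero>\<^bsub>upa A\<^esub> = \<zero>\<^bsub>upa B\<^esub>"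
    and discA: "disc_ideal K P (upa A) = {p \<in> up A. range p \<subseteq> disc_ideal K P A}"
    and discB: "disc_ideal K P (upa B) = {p \<in> up B. range p \<subseteq> disc_ideal K P B}"
    and d: "is_discriminant K P A d" and dnz: "d \<noteq> \<zero>\<^bsub>A\<^esub>"
  shows "\<exists>b\<in>poisson_center B. \<phi> (cst A d) = cst B b"
proof -
  interpret A: poisson_algebra K A by fact
  interpret B: poisson_algebra K B by fact
  interpret UA: UP_cring A "UP A" by (simp_all add: UP_cringI A.M_cring)
  interpret UB: UP_cring B "UP B" by (simp_all add: UP_cringI B.M_cring)
  have \<phi>ai: "\<phi> \<in> alg_iso K (upa A) (upa B)" by (rule poisson_iso_alg_iso) fact+
  have domB: "domain B"
    by (rule domain_coefficients[OF B.M_cring domain_alg_iso[OF domain_upa[OF domA] \<phi>ai]])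
  interpret DB: UP_domain B "UP B" by (simp_all add: UP_domain_def domB)
  define \<psi> where "\<psi> = inv_into (up A) \<phi>"
  interpret pair: poisson_iso_pair K "upa A" "upa B" \<phi> \<psi>
    unfolding \<psi>_def by (rule A.poisson_iso_pair_upa[OF \<phi> \<phi>0])
  note F = poisson_isoD[OF pair.h_iso, simplified]
  have dZ: "d \<in> poisson_center A" and I: "disc_ideal K P A = {x \<otimes>\<^bsub>A\<^esub> d | x. x \<in> poisson_center A}"
    using d by (auto simp: is_discriminant_def cgenideal_def)
  have dc: "d \<in> carrier A" using dZ A.poisson_center_subset by blast
  note ZA = subringE[OF A.poisson_center_subring]
  have cd: "cst A d \<in> up A" using UA.monom_closed[OF dc, of 0] by (simp add: UP_carrier)
  have "\<zero>\<^bsub>A\<^esub> = \<zero>\<^bsub>A\<^esub> \<otimes>\<^bsub>A\<^esub> d" "d = \<one>\<^bsub>A\<^esub> \<otimes>\<^bsub>A\<^esub> d" using dc by simp_all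
  then have "\<zero>\<^bsub>A\<^esub> \<in> disc_ideal K P A" "d \<in> disc_ideal K P A" unfolding I using ZA(2,3) by blast+
  then have "cst A d \<in> disc_ideal K P (upa A)" unfolding discA using cd dc by (auto simp: UP_monom)
  then have "\<phi> (cst A d) \<in> disc_ideal K P (upa B)" using pair.disc_ideal_h_iff[of "cst A d" P] cd by simp
  then have im: "\<phi> (cst A d) \<in> up B" "range (\<phi> (cst A d)) \<subseteq> disc_ideal K P B" by (auto simp: discB)
  have nz: "\<phi> (cst A d) \<noteq> \<zero>\<^bsub>UP B\<^esub>"
  proof
    assume "\<phi> (cst A d) = \<zero>\<^bsub>UP B\<^esub>"
    then have "\<phi> (cst A d) = \<phi> \<zero>\<^bsub>UP A\<^esub>" using \<phi>0 by simp
    then have "cst A d = \<zero>\<^bsub>UP A\<^esub>"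
      using inj_onD[OF F(4), of "cst A d" "\<zero>\<^bsub>UP A\<^esub>"] cd UA.UP_zero_closed by (simp add: UP_carrier)
    then have "cst A d 0 = \<zero>\<^bsub>A\<^esub>" by (simp add: UP_zero)
    then show False using dnz dc by (simp add: UP_monom)
  qed
  then obtain n where n: "\<phi> (cst A d) n \<noteq> \<zero>\<^bsub>B\<^esub>" by (auto simp: UP_zero)
  obtain m where m: "\<phi> (cst A d) m = \<zero>\<^bsub>B\<^esub>" using im(1) by (auto simp: up_def bound_def)
  define \<beta> where "\<beta> = \<phi> (cst A d) n"
  have \<beta>: "\<beta> \<in> disc_ideal K P B" "\<beta> \<in> carrier B" "\<beta> \<noteq> \<zero>\<^bsub>B\<^esub>"
    using im n mem_upD by (auto simp: \<beta>_def)
  have "\<zero>\<^bsub>B\<^esub> \<in> disc_ideal K P B" using m im(2) by (metis rangeI subsetD)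
  then have "cst B \<beta> \<in> disc_ideal K P (upa B)"
    using \<beta> UB.monom_closed[OF \<beta>(2), of 0] by (auto simp: discB UP_monom UP_carrier[symmetric])
  then have "\<psi> (cst B \<beta>) \<in> disc_ideal K P (upa A)" by (rule pair.disc_ideal_g)
  then have p: "\<psi> (cst B \<beta>) \<in> up A" "range (\<psi> (cst B \<beta>)) \<subseteq> disc_ideal K P A" by (auto simp: discA)
  let ?p = "\<psi> (cst B \<beta>)"
  have "\<exists>x. x \<in> poisson_center A \<and> ?p i = x \<otimes>\<^bsub>A\<^esub> d \<and> (?p i = \<zero>\<^bsub>A\<^esub> \<longrightarrow> x = \<zero>\<^bsub>A\<^esub>)" for i
  proof (cases "?p i = \<zero>\<^bsub>A\<^esub>")
    case True
    then show ?thesis using ZA(2) dc by (intro exI[of _ "\<zero>\<^bsub>A\<^esub>"]) simp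
  next
    case False
    have "?p i \<in> disc_ideal K P A" using p(2) by blast
    with False show ?thesis unfolding I by blast
  qed
  \<comment> \<open>Choosing zero as the cofactor of zero makes the family of cofactors a polynomial.\<close>
  then obtain x where x: "\<And>i. x i \<in> poisson_center A" "\<And>i. ?p i = x i \<otimes>\<^bsub>A\<^esub> d"
    "\<And>i. ?p i = \<zero>\<^bsub>A\<^esub> \<Longrightarrow> x i = \<zero>\<^bsub>A\<^esub>" by metis
  have xc: "x i \<in> carrier A" for i using x(1) A.poisson_center_subset by blast
  obtain k where "\<And>i. i > k \<Longrightarrow> ?p i = \<zero>\<^bsub>A\<^esub>" using p(1) by (auto simp: up_def bound_def)
  then have "bound \<zero>\<^bsub>A\<^esub> k x" using x(3) by blast
  then have xu: "x \<in> up A" using xc by blast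
  have "?p = x \<otimes>\<^bsub>UP A\<^esub> cst A d"
  proof
    fix i
    have "(x \<otimes>\<^bsub>UP A\<^esub> cst A d) i = (\<Oplus>\<^bsub>A\<^esub> j\<in>{..i}. if i = j then x j \<otimes>\<^bsub>A\<^esub> d else \<zero>\<^bsub>A\<^esub>)"
      unfolding UP_mult[OF xu cd]
      by (rule A.M.finsum_cong') (use xc dc in \<open>auto simp: UP_monom\<close>)
    also have "\<dots> = x i \<otimes>\<^bsub>A\<^esub> d" using xc dc by (intro A.M.finsum_singleton) auto
    finally show "?p i = (x \<otimes>\<^bsub>UP A\<^esub> cst A d) i" by (simp add: x(2))
  qed
  then have "\<phi> ?p = \<phi> x \<otimes>\<^bsub>UP B\<^esub> \<phi> (cst A d)" using F(9)[OF xu cd] by simp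
  moreover have "\<phi> ?p = cst B \<beta>"
    using pair.hg[of "cst B \<beta>"] UB.monom_closed[OF \<beta>(2), of 0] by (simp add: UP_carrier)
  ultimately have prod: "cst B \<beta> = \<phi> x \<otimes>\<^bsub>UP B\<^esub> \<phi> (cst A d)" by simp
  have fc: "\<phi> x \<in> carrier (UP B)" "\<phi> (cst A d) \<in> carrier (UP B)"
    using F(7)[OF xu] im(1) by (simp_all add: UP_carrier)
  have "cst B \<beta> \<noteq> \<zero>\<^bsub>UP B\<^esub>"
  proof
    assume "cst B \<beta> = \<zero>\<^bsub>UP B\<^esub>"
    then have "cst B \<beta> 0 = \<zero>\<^bsub>B\<^esub>" by (simp add: UP_zero)
    then show False using \<beta> by (simp add: UP_monom)
  qed
  then have "\<phi> x \<noteq> \<zero>\<^bsub>UP B\<^esub>" using prod fc(2) by auto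
  then have "deg B (cst B \<beta>) = deg B (\<phi> x) + deg B (\<phi> (cst A d))"
    unfolding prod using DB.deg_mult nz fc by blast
  then have "deg B (\<phi> (cst A d)) = 0" using \<beta>(2) by simp
  then have e: "\<phi> (cst A d) = cst B (up_ring.coeff (UP B) (\<phi> (cst A d)) 0)"
    by (rule UB.deg_zero_impl_monom[OF fc(2)])
  have "up_ring.coeff (UP B) (\<phi> (cst A d)) 0 \<in> disc_ideal K P B"
    using im by (auto simp: UP_coeff)
  then have "up_ring.coeff (UP B) (\<phi> (cst A d)) 0 \<in> poisson_center B" by (simp add: disc_ideal_def)
  with e show ?thesis by (rule bexI)
qed

theorem poisson_isomorphic_if_effective_discriminant:
  fixes A B :: "('k, 'u) poisson_alg" and P :: "('k, 'u) poisson_alg \<Rightarrow> bool"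
  assumes inf: "infinite (UNIV :: 'u set)"
    and PA: "poisson_algebra K A" and PB: "poisson_algebra K B" and domA: "domain A"
    and aff: "affine_alg K (center_alg A)" and stable: "stable_property K P"
    and d: "is_discriminant K P A d"
    and eff: "effective K A d \<or> effective K (center_alg A) d"
    and \<phi>: "\<phi> \<in> poisson_iso K (upa A) (upa B)"
  shows "poisson_isomorphic K A B"
proof -
  interpret A: poisson_algebra K A by fact
  interpret B: poisson_algebra K B by fact
  have rings: "ring A" "ring B" using A.M_cring B.M_cring unfolding cring_def by blast+
  have "ring (upa A)" "ring (upa B)"
    using cring_upa[OF A.M_cring] cring_upa[OF B.M_cring] by (simp_all add: cring_def)
  then have \<phi>0: "\<phi> \<zero>\<^bsub>upa A\<^esub> = \<zero>\<^bsub>upa B\<^esub>" by (rule poisson_iso_zero[OF \<phi>])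
  have \<phi>ai: "\<phi> \<in> alg_iso K (upa A) (upa B)" by (rule poisson_iso_alg_iso) fact+
  have \<phi>Z: "\<phi> \<in> alg_iso K (upa (center_alg A)) (upa (center_alg B))"
    by (rule alg_iso_center[OF PA PB \<phi> \<phi>0])
  have affB: "affine_alg K (center_alg B)"
    by (rule affine_alg_coefficients[OF A.algebra_center B.algebra_center \<phi>Z aff])
  have dnz: "d \<noteq> \<zero>\<^bsub>A\<^esub>" using eff by (auto simp: effective_def)
  have "\<exists>b\<in>poisson_center B. \<phi> (cst A d) = cst B b"
    by (rule discriminant_constant[OF PA PB domA \<phi> \<phi>0 disc_ideal_upa[OF PA aff stable]
          disc_ideal_upa[OF PB affB stable] d dnz])
  then obtain b where b: "b \<in> poisson_center B" "\<phi> (cst A d) = cst B b" by blast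
  have bc: "b \<in> carrier B" using b(1) B.poisson_center_subset by blast
  have dZ: "d \<in> poisson_center A" using d by (simp add: is_discriminant_def)
  note cZA = UP_carrier_update(4)[OF rings(1) A.poisson_center_subring]
    and cZB = UP_carrier_update(4)[OF rings(2) B.poisson_center_subring]
  have "\<exists>b\<in>poisson_center B. \<phi> (cst A z) = cst B b" if z: "z \<in> poisson_center A" for z
    using eff
  proof
    assume "effective K A d"
    moreover have zc: "z \<in> carrier A" using z A.poisson_center_subset by blast
    ultimately have "\<exists>b'\<in>carrier B. \<phi> (cst A z) = cst B b'"
      by (rule effective_imp_constants[OF inf A.algebra_axioms domA B.algebra_axioms \<phi>ai _ bc b(2)])
    then obtain b' where b': "b' \<in> carrier B" "\<phi> (cst A z) = cst B b'" by blast
    \<comment> \<open>The image of \<open>z\<close> is a constant, and it is central because \<open>z\<close> is.\<close>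
    interpret pair: poisson_iso_pair K "upa A" "upa B" \<phi> "inv_into (up A) \<phi>"
      by (rule A.poisson_iso_pair_upa[OF \<phi> \<phi>0])
    interpret UA: UP_cring A "UP A" by (simp_all add: UP_cringI A.M_cring)
    have "cst A z \<in> up A" using UA.monom_closed[OF zc, of 0] by (simp add: UP_carrier)
    then have "cst A z \<in> poisson_center (upa A)"
      using z zc subringE(2)[OF A.poisson_center_subring]
      by (auto simp: A.poisson_center_upa A.up_center UP_monom)
    then have "\<phi> (cst A z) \<in> poisson_center (upa B)" by (rule pair.center_closed)
    then have "cst B b' 0 \<in> poisson_center B" by (auto simp: b'(2) B.poisson_center_upa B.up_center)
    then have "b' \<in> poisson_center B" using b'(1) by (simp add: UP_monom)
    with b'(2) show ?thesis by (rule bexI)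
  next
    assume effZ: "effective K (center_alg A) d"
    have domZ: "domain (center_alg A)"
      by (rule domain.subring_is_domain[OF domA A.poisson_center_subring])
    have e: "\<phi> (cst (center_alg A) d) = cst (center_alg B) b"
      using b(2) cZA[OF dZ] cZB[OF b(1)] by simp
    have "\<exists>b'\<in>carrier (center_alg B). \<phi> (cst (center_alg A) z) = cst (center_alg B) b'"
      by (rule effective_imp_constants[OF inf A.algebra_center domZ B.algebra_center \<phi>Z effZ _ e])
        (use b(1) z in simp_all)
    then show ?thesis using cZA[OF z] cZB by auto
  qed
  then show ?thesis by (rule poisson_isomorphic_if_center_constants[OF PA PB domA \<phi>])
qed

section \<open>Poisson cancellation\<close>

lemma poisson_iso_upa_map:
  assumes PR: "poisson_algebra K R" and PS: "poisson_algebra K S" and h: "h \<in> poisson_iso K R S"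
  shows "(\<lambda>p i. h (p i)) \<in> poisson_iso K (upa R) (upa S)"
proof -
  interpret R: poisson_algebra K R by fact
  interpret S: poisson_algebra K S by fact
  have rings: "ring R" "ring S" using R.M_cring S.M_cring unfolding cring_def by blast+
  note D = poisson_isoD[OF h]
  have h0: "h \<zero>\<^bsub>R\<^esub> = \<zero>\<^bsub>S\<^esub>" by (rule poisson_iso_zero[OF h rings])
  have hs: "h (finsum R f {..n}) = (\<Oplus>\<^bsub>S\<^esub> i\<in>{..n}. h (f i))" if "\<And>i. f i \<in> carrier R" for f and n :: nat
    using ring_hom_ring.hom_finsum[OF ring_hom_ringI2[OF rings D(2)], of f "{..n}"] that
    by (simp add: comp_def Pi_def)
  have cl: "(\<lambda>i. h (p i)) \<in> up S" if "p \<in> up R" for p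
  proof -
    obtain n where "bound \<zero>\<^bsub>R\<^esub> n p" using \<open>p \<in> up R\<close> by (auto simp: up_def)
    then have "bound \<zero>\<^bsub>S\<^esub> n (\<lambda>i. h (p i))" using h0 by (auto simp: bound_def)
    moreover have "h (p i) \<in> carrier S" for i by (rule D(7)[OF mem_upD[OF \<open>p \<in> up R\<close>]])
    ultimately show ?thesis by blast
  qed
  have sur: "\<exists>p\<in>up R. q = (\<lambda>i. h (p i))" if q: "q \<in> up S" for q
  proof -
    let ?g = "inv_into (carrier R) h"
    have g: "?g (q i) \<in> carrier R \<and> h (?g (q i)) = q i" for i
      using D(5) mem_upD[OF q, of i] by (metis f_inv_into_f inv_into_into)
    obtain n where "\<And>i. i > n \<Longrightarrow> q i = \<zero>\<^bsub>S\<^esub>" using q by (auto simp: up_def bound_def)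
    then have "?g (q i) = \<zero>\<^bsub>R\<^esub>" if "i > n" for i
      using that D(4) h0 ring.ring_simprules(2)[OF rings(1)] by (metis inv_into_f_f)
    then have "bound \<zero>\<^bsub>R\<^esub> n (\<lambda>i. ?g (q i))" by blast
    then have "(\<lambda>i. ?g (q i)) \<in> up R" using g by blast
    moreover have "q = (\<lambda>i. h (?g (q i)))" using g by simp
    ultimately show ?thesis by (intro bexI[of _ "\<lambda>i. ?g (q i)"])
  qed
  have "inj_on (\<lambda>p i. h (p i)) (up R)"
  proof (rule inj_onI)
    fix p q assume pq: "p \<in> up R" "q \<in> up R" "(\<lambda>i. h (p i)) = (\<lambda>i. h (q i))"
    show "p = q"
    proof
      fix i
      have "h (p i) = h (q i)" using fun_cong[OF pq(3), of i] .
      then show "p i = q i" using inj_onD[OF D(4)] mem_upD[OF pq(1)] mem_upD[OF pq(2)] by blast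
    qed
  qed
  moreover have "(\<lambda>p i. h (p i)) ` up R = up S"
    using cl sur by blast
  ultimately have bij: "bij_betw (\<lambda>p i. h (p i)) (up R) (up S)" by (simp add: bij_betw_def)
  show ?thesis
    unfolding poisson_iso_def
  proof (intro CollectI conjI ballI ring_iso_memI)
    fix p q assume p: "p \<in> carrier (upa R)" and q: "q \<in> carrier (upa R)"
    then have pq: "p \<in> up R" "q \<in> up R" by simp_all
    note m = mem_upD[OF pq(1)] mem_upD[OF pq(2)]
    show "(\<lambda>i. h ((p \<otimes>\<^bsub>upa R\<^esub> q) i)) = (\<lambda>i. h (p i)) \<otimes>\<^bsub>upa S\<^esub> (\<lambda>i. h (q i))"
      using m by (simp add: UP_mult pq cl hs D(9))
    show "(\<lambda>i. h ((p \<oplus>\<^bsub>upa R\<^esub> q) i)) = (\<lambda>i. h (p i)) \<oplus>\<^bsub>upa S\<^esub> (\<lambda>i. h (q i))"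
      using m by (simp add: UP_add pq cl D(8))
    show "(\<lambda>i. h (bracket (upa R) p q i)) = bracket (upa S) (\<lambda>i. h (p i)) (\<lambda>i. h (q i))"
      using m by (simp add: hs R.bracket_closed D(11))
  next
    show "(\<lambda>i. h (\<one>\<^bsub>upa R\<^esub> i)) = \<one>\<^bsub>upa S\<^esub>" using D(6) h0 by (auto simp: UP_one)
  next
    fix r p assume "r \<in> carrier K" "p \<in> carrier (upa R)"
    then show "(\<lambda>i. h ((r \<odot>\<^bsub>upa R\<^esub> p) i)) = r \<odot>\<^bsub>upa S\<^esub> (\<lambda>i. h (p i))"
      using D(10) by (simp add: mem_upD)
  qed (use cl bij in simp_all)
qed

lemma poisson_iso_upa_if_poly_ext:
  assumes PA: "poisson_algebra K A" and PB: "poisson_algebra K B"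
    and "poisson_isomorphic K (poly_ext A 1) (poly_ext B 1)"
  shows "\<exists>\<phi>. \<phi> \<in> poisson_iso K (upa A) (upa B)"
proof -
  interpret B: poisson_algebra K B by fact
  obtain h where h: "h \<in> poisson_iso K (poly_ext A 1) (poly_ext B 1)"
    using assms(3) by (auto simp: poisson_isomorphic_def)
  have "mset_poly B \<zero>\<^bsub>upa B\<^esub> = \<zero>\<^bsub>poly_ext B 1\<^esub>"
    by (simp add: UP_zero mset_poly_zero poly_ext_def)
  then interpret pair: poisson_iso_pair K "upa B" "poly_ext B 1" "mset_poly B" "inv_into (up B) (mset_poly B)"
    by (rule B.poisson_iso_pair_upa[OF mset_poly_iso[OF PB]])
  show ?thesis
    using poisson_iso_trans[OF poisson_iso_trans[OF mset_poly_iso[OF PA] h] pair.g_iso] by blast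
qed

theorem theorem1p6:
  fixes K :: "('k, 'm) ring_scheme"
    and A :: "('k, 'u) poisson_alg"
    and P :: "('k, 'u) poisson_alg \<Rightarrow> bool"
    and d :: 'u
  assumes "field K"
    and "infinite (UNIV :: 'u set)"
    and "poisson_algebra K A" and "domain A"
    and "affine_alg K A"
    and "affine_alg K (center_alg A)"
    and "poisson_property K P" and "stable_property K P"
    and "is_discriminant K P A d"
    and "effective K A d \<or> effective K (center_alg A) d"
  shows "poisson_cancellative TYPE('b) K A"
  unfolding poisson_cancellative_def
proof (intro allI impI)
  fix B :: "('k, 'b) poisson_alg"
  assume PB: "poisson_algebra K B" and iso: "poisson_isomorphic K (poly_ext A 1) (poly_ext B 1)"
  interpret A: poisson_algebra K A by fact
  interpret B: poisson_algebra K B by fact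
  obtain \<phi> where \<phi>: "\<phi> \<in> poisson_iso K (upa A) (upa B)"
    using poisson_iso_upa_if_poly_ext[OF \<open>poisson_algebra K A\<close> PB iso] by blast
  obtain e0 :: "(nat \<Rightarrow> 'u) \<Rightarrow> 'u" where e0: "inj_on e0 (up A)"
    using inj_up_into_infinite[OF \<open>infinite (UNIV :: 'u set)\<close>] by blast
  \<comment> \<open>\<open>B\<close> embeds as the constants into \<open>B[t] \<cong> A[s]\<close>, hence into \<open>'u\<close>.\<close>
  define e where "e b = e0 (inv_into (up A) \<phi> (cst B b))" for b
  have sur: "\<phi> ` up A = up B" using poisson_isoD(5)[OF \<phi>] by simp
  interpret UB: UP_cring B "UP B" by (simp_all add: UP_cringI B.M_cring)
  have "inj_on e (carrier B)"
  proof (rule inj_onI)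
    fix a b assume ab: "a \<in> carrier B" "b \<in> carrier B" "e a = e b"
    have c: "cst B a \<in> \<phi> ` up A" "cst B b \<in> \<phi> ` up A"
      using UB.monom_closed[OF ab(1), of 0] UB.monom_closed[OF ab(2), of 0] by (simp_all add: sur UP_carrier)
    have "inv_into (up A) \<phi> (cst B a) = inv_into (up A) \<phi> (cst B b)"
    proof (rule inj_onD[OF e0])
      show "e0 (inv_into (up A) \<phi> (cst B a)) = e0 (inv_into (up A) \<phi> (cst B b))"
        using ab(3) by (simp only: e_def)
    qed (rule inv_into_into[OF c(1)], rule inv_into_into[OF c(2)])
    then have "cst B a = cst B b" by (rule inv_into_injective[OF _ c])
    then show "a = b" using inj_onD[OF UB.monom_inj[of 0]] ab(1,2) by blast
  qed
  note tr = transport_iso[OF this]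
  let ?B = "transport e B"
  have PB': "poisson_algebra K ?B" by (rule poisson_algebra_iso[OF PB tr])
  have "(\<lambda>p i. e (p i)) \<circ> \<phi> \<in> poisson_iso K (upa A) (upa ?B)"
    by (rule poisson_iso_trans[OF \<phi> poisson_iso_upa_map[OF PB PB' tr(1)]])
  then have "poisson_isomorphic K A ?B"
    by (rule poisson_isomorphic_if_effective_discriminant[OF assms(2,3) PB' assms(4,6,8,9,10)])
  moreover have "poisson_isomorphic K ?B B"
    using poisson_algebra_iso_sym[OF tr(1) PB] by (auto simp: poisson_isomorphic_def)
  ultimately show "poisson_isomorphic K A B" by (rule poisson_isomorphic_trans)
qed

end
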